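(* Let $\theta\in\mathbb R\setminus\pi\mathbb Z$ and let $\phi\in L^2(\mathbb R)$ be such that: (i) $\phi(t)$ is well-defined everywhere on $\mathbb R$; (ii) there are constants $B\ge A>0$ with $A\le |G_{\phi,\theta}(\xi)|\le B$ for a.e. $\xi\in[0,\Delta]$; (iii) $C_{\phi,\theta}(t)<\infty$ for all $t\in\mathbb R$. Let $\mathcal J_\theta$ be the bounded linear operator from $L^2[0,\Delta]$ into $V_\theta(\phi)$ defined by $$(\mathcal J_\theta F)(t)=\big(\{\langle F,K_\theta(n,\cdot)\rangle_{L^2[0,\Delta]}\}_n\ast_\theta\phi\big)(t)=\big\langle F,\ \lambda_\theta(t)\,\overline{c(\theta)Z_{\phi,\theta}(t,\cdot)}\big\rangle_{L^2[0,\Delta]}.$$ Then: (a) $\mathcal J_\theta$ is an isomorphism from $L^2[0,\Delta]$ onto $V_\theta(\phi)$. (b) $\mathcal F_\theta[\mathcal J_\theta F](\xi)=\overline{\lambda_\theta(\xi)}\,F(\xi)\,\hat\phi_\theta(\xi)$ for every $F\in L^2[0,\Delta]$, where on the right $F$ is extended from $[0,\Delta]$ to $\mathbb R$ so that $\overline{\lambda_\theta(\xi)}F(\xi)$ is $\Delta$-periodic. (c) $\lambda_\theta(t)\,\mathcal J_\theta[F(\cdot)e^{-ibk\cdot}](t)=\lambda_\theta(t-k)\,(\mathcal J_\theta F)(t-k)$ for every $F\in L^2[0,\Delta]$, $k\in\mathbb Z$ and $t\in\mathbb R$.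
   Context: Notation, for $\theta\in\mathbb R\setminus\pi\mathbb Z$: $c(\theta)=\sqrt{\frac{1-i\cot\theta}{2\pi}}$, $a=\frac{\cot\theta}{2}$, $b=\csc\theta$, $\Delta=\frac{2\pi}{|b|}=2\pi|\sin\theta|$, $\lambda_\theta(x)=e^{iax^2}$, and $K_\theta(t,\xi)=c(\theta)e^{ia(t^2+\xi^2)-ibt\xi}$. The fractional Fourier transform (FrFT) is $\mathcal F_\theta[f](\xi)=\hat f_\theta(\xi)=\int_{\mathbb R}f(t)K_\theta(t,\xi)\,dt$, understood as a unitary operator on $L^2(\mathbb R)$. The chirp-modulated version of a function $f$ is $\vec f(t)=\lambda_\theta(t)f(t)$, and of a sequence $\mathbf c=\{c(n)\}_n$ is $\vec c(n)=\lambda_\theta(n)c(n)$. For $\phi\in L^2(\mathbb R)$: $C_{\phi,\theta}(t)=\sum_{n\in\mathbb Z}|\vec\phi(t-n)|^2$ and $G_{\phi,\theta}(\xi)=\sum_{n\in\mathbb Z}|\hat\phi_\theta(\xi+n\Delta)|^2$. Fractional semi-discrete convolution: $(\mathbf c\ast_\theta\phi)(t)=c(\theta)\overline{\lambda_\theta(t)}\sum_{n\in\mathbb Z}\vec c(n)\vec\phi(t-n)$, $\mathbf c\in\ell^2(\mathbb Z)$. The chirp-modulated shift-invariant space generated by $\phi$ is $V_\theta(\phi)=\overline{\mathrm{span}}\{c(\theta)\overline{\lambda_\theta(t)}\vec\phi(t-n):n\in\mathbb Z\}\subset L^2(\mathbb R)$. Under hypotheses (i)-(iii), $\{c(\theta)\overline{\lambda_\theta(t)}\vec\phi(t-n)\}_n$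 is a Riesz basis of $V_\theta(\phi)$ and $V_\theta(\phi)$ is a reproducing kernel Hilbert space whose elements $f=\mathbf c\ast_\theta\phi$ are everywhere-defined functions given by the pointwise sums above. The fractional Zak transform is $Z_{\phi,\theta}(t,\xi)=\sum_{n\in\mathbb Z}\vec\phi(t-n)\lambda_\theta(n)\overline{K_\theta(n,\xi)}$, the series converging in $L^2[0,\Delta]$ in $\xi$ for each fixed $t$ with $C_{\phi,\theta}(t)<\infty$. The inner product $\langle F,G\rangle_{L^2[0,\Delta]}=\int_0^\Delta F\overline G$. "Isomorphism" means a bounded linear bijection with bounded inverse. *)

theory Defs
  imports "HOL-Analysis.Analysis" "HOL-Library.Real_Mod"
begin

subsection \<open>Square-integrable functions\<close>

text \<open>
  Elements of \<open>L\<^sup>2\<close> are represented by functions; identification modulo null sets is made explicit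
  by \<open>AE\<close> wherever a statement is about classes.
\<close>

definition L2 :: "'a measure \<Rightarrow> ('a \<Rightarrow> complex) set" where
  "L2 M = {f \<in> borel_measurable M. integrable M (\<lambda>x. (cmod (f x))\<^sup>2)}"

definition L2norm :: "'a measure \<Rightarrow> ('a \<Rightarrow> complex) \<Rightarrow> real" where
  "L2norm M f = sqrt (LINT x|M. (cmod (f x))\<^sup>2)"

definition L2inner :: "'a measure \<Rightarrow> ('a \<Rightarrow> complex) \<Rightarrow> ('a \<Rightarrow> complex) \<Rightarrow> complex" where
  "L2inner M f g = (LINT x|M. f x * cnj (g x))"

definition L2_tendsto ::
    "'a measure \<Rightarrow> ('i \<Rightarrow> 'a \<Rightarrow> complex) \<Rightarrow> ('a \<Rightarrow> complex) \<Rightarrow> 'i filter \<Rightarrow> bool" where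
  "L2_tendsto M f g \<F> \<longleftrightarrow>
     g \<in> L2 M \<and> (\<forall>\<^sub>F i in \<F>. f i \<in> L2 M) \<and> ((\<lambda>i. L2norm M (\<lambda>x. f i x - g x)) \<longlongrightarrow> 0) \<F>"

text \<open>A representative of the limit in the mean (determined up to a null set).\<close>

definition L2_lim :: "'a measure \<Rightarrow> ('i \<Rightarrow> 'a \<Rightarrow> complex) \<Rightarrow> 'i filter \<Rightarrow> 'a \<Rightarrow> complex" where
  "L2_lim M f \<F> = (SOME g. L2_tendsto M f g \<F>)"

definition L2_bounded_linear ::
    "'a measure \<Rightarrow> ('a \<Rightarrow> complex) set \<Rightarrow> 'b measure \<Rightarrow> ('b \<Rightarrow> complex) set
      \<Rightarrow> (('a \<Rightarrow> complex) \<Rightarrow> 'b \<Rightarrow> complex) \<Rightarrow> bool" where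
  "L2_bounded_linear M D N R T \<longleftrightarrow>
     (\<forall>F\<in>D. T F \<in> R) \<and>
     (\<forall>F\<in>D. \<forall>G\<in>D. (AE x in M. F x = G x) \<longrightarrow> (AE y in N. T F y = T G y)) \<and>
     (\<forall>F\<in>D. \<forall>G\<in>D. AE y in N. T (\<lambda>x. F x + G x) y = T F y + T G y) \<and>
     (\<forall>z. \<forall>F\<in>D. AE y in N. T (\<lambda>x. z * F x) y = z * T F y) \<and>
     (\<exists>C. \<forall>F\<in>D. L2norm N (T F) \<le> C * L2norm M F)"

text \<open>
  \<open>D\<close> and \<open>R\<close> are to be subspaces of \<open>L2 M\<close> and \<open>L2 N\<close>; both compositions are the identity on
  almost-everywhere classes.
\<close>

definition L2_isomorphism ::
    "'a measure \<Rightarrow> ('a \<Rightarrow> complex) set \<Rightarrow> 'b measure \<Rightarrow> ('b \<Rightarrow> complex) set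
      \<Rightarrow> (('a \<Rightarrow> complex) \<Rightarrow> 'b \<Rightarrow> complex) \<Rightarrow> bool" where
  "L2_isomorphism M D N R T \<longleftrightarrow>
     L2_bounded_linear M D N R T \<and>
     (\<exists>S. L2_bounded_linear N R M D S \<and>
          (\<forall>F\<in>D. AE x in M. S (T F) x = F x) \<and>
          (\<forall>f\<in>R. AE y in N. T (S f) y = f y))"


subsection \<open>The fractional Fourier transform\<close>

definition frft_const :: "real \<Rightarrow> complex" where
  "frft_const \<theta> = csqrt ((1 - \<i> * of_real (cot \<theta>)) / of_real (2 * pi))"

definition frft_a :: "real \<Rightarrow> real" where
  "frft_a \<theta> = cot \<theta> / 2"

definition frft_b :: "real \<Rightarrow> real" where
  "frft_b \<theta> = 1 / sin \<theta>"

definition frft_period :: "real \<Rightarrow> real" where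
  "frft_period \<theta> = 2 * pi / \<bar>frft_b \<theta>\<bar>"

definition chirp :: "real \<Rightarrow> real \<Rightarrow> complex" where
  "chirp \<theta> x = exp (\<i> * of_real (frft_a \<theta> * x\<^sup>2))"

definition frft_kernel :: "real \<Rightarrow> real \<Rightarrow> real \<Rightarrow> complex" where
  "frft_kernel \<theta> t \<xi> =
     frft_const \<theta> *
     exp (\<i> * of_real (frft_a \<theta> * (t\<^sup>2 + \<xi>\<^sup>2)) - \<i> * of_real (frft_b \<theta> * t * \<xi>))"

text \<open>
  For \<open>f \<in> L\<^sup>2\<close> the defining integral need not converge absolutely; as for the Plancherel transform,
  it is the limit in \<open>L\<^sup>2\<close> of the integrals over \<open>[-N, N]\<close>.
\<close>

definition frft :: "real \<Rightarrow> (real \<Rightarrow> complex) \<Rightarrow> real \<Rightarrow> complex" where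
  "frft \<theta> f =
     L2_lim lebesgue
       (\<lambda>(N::nat) \<xi>. LINT t|lebesgue_on {- real N..real N}. f t * frft_kernel \<theta> t \<xi>)
       sequentially"


subsection \<open>Chirp-modulated shift-invariant spaces\<close>

definition chirp_mod :: "real \<Rightarrow> (real \<Rightarrow> complex) \<Rightarrow> real \<Rightarrow> complex" where
  "chirp_mod \<theta> f t = chirp \<theta> t * f t"

definition chirp_mod_seq :: "real \<Rightarrow> (int \<Rightarrow> complex) \<Rightarrow> int \<Rightarrow> complex" where
  "chirp_mod_seq \<theta> c n = chirp \<theta> (of_int n) * c n"

definition C_fun :: "real \<Rightarrow> (real \<Rightarrow> complex) \<Rightarrow> real \<Rightarrow> ennreal" where
  "C_fun \<theta> \<phi> t = (\<Sum>\<^sub>\<infinity>n::int. ennreal ((cmod (chirp_mod \<theta> \<phi> (t - of_int n)))\<^sup>2))"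

definition G_fun :: "real \<Rightarrow> (real \<Rightarrow> complex) \<Rightarrow> real \<Rightarrow> ennreal" where
  "G_fun \<theta> \<phi> \<xi> =
     (\<Sum>\<^sub>\<infinity>n::int. ennreal ((cmod (frft \<theta> \<phi> (\<xi> + of_int n * frft_period \<theta>)))\<^sup>2))"

definition semi_conv :: "real \<Rightarrow> (int \<Rightarrow> complex) \<Rightarrow> (real \<Rightarrow> complex) \<Rightarrow> real \<Rightarrow> complex" where
  "semi_conv \<theta> c \<phi> t =
     frft_const \<theta> * cnj (chirp \<theta> t) *
     (\<Sum>\<^sub>\<infinity>n::int. chirp_mod_seq \<theta> c n * chirp_mod \<theta> \<phi> (t - of_int n))"

definition V_gen :: "real \<Rightarrow> (real \<Rightarrow> complex) \<Rightarrow> int \<Rightarrow> real \<Rightarrow> complex" where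
  "V_gen \<theta> \<phi> n t = frft_const \<theta> * cnj (chirp \<theta> t) * chirp_mod \<theta> \<phi> (t - of_int n)"

definition V_space :: "real \<Rightarrow> (real \<Rightarrow> complex) \<Rightarrow> (real \<Rightarrow> complex) set" where
  "V_space \<theta> \<phi> =
     {f \<in> L2 lebesgue. \<forall>\<epsilon>>0. \<exists>S d. finite S \<and>
        L2norm lebesgue (\<lambda>t. f t - (\<Sum>n\<in>S. d n * V_gen \<theta> \<phi> n t)) < \<epsilon>}"

definition frft_cell :: "real \<Rightarrow> real measure" where
  "frft_cell \<theta> = lebesgue_on {0..frft_period \<theta>}"

definition zak :: "real \<Rightarrow> (real \<Rightarrow> complex) \<Rightarrow> real \<Rightarrow> real \<Rightarrow> complex" where
  "zak \<theta> \<phi> t =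
     L2_lim (frft_cell \<theta>)
       (\<lambda>S \<xi>. \<Sum>n\<in>S. chirp_mod \<theta> \<phi> (t - of_int n) * chirp \<theta> (of_int n)
                        * cnj (frft_kernel \<theta> (of_int n) \<xi>))
       (finite_subsets_at_top (UNIV :: int set))"

definition J_op :: "real \<Rightarrow> (real \<Rightarrow> complex) \<Rightarrow> (real \<Rightarrow> complex) \<Rightarrow> real \<Rightarrow> complex" where
  "J_op \<theta> \<phi> F =
     semi_conv \<theta> (\<lambda>n. L2inner (frft_cell \<theta>) F (frft_kernel \<theta> (of_int n))) \<phi>"

text \<open>
  The extension of \<open>F\<close> from \<open>[0, \<Delta>)\<close> to the line for which \<open>cnj (chirp \<theta> \<xi>) * F \<xi>\<close> is
  \<open>\<Delta>\<close>-periodic; the value of \<open>F\<close> at the endpoint \<open>\<Delta>\<close>, a null set, is not used.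
\<close>

definition chirp_ext :: "real \<Rightarrow> (real \<Rightarrow> complex) \<Rightarrow> real \<Rightarrow> complex" where
  "chirp_ext \<theta> F \<xi> =
     chirp \<theta> \<xi> * (cnj (chirp \<theta> (\<xi> rmod frft_period \<theta>)) * F (\<xi> rmod frft_period \<theta>))"

lemma cnj_chirp_mult_chirp: "cnj (chirp \<theta> x) * chirp \<theta> x = 1"
  by (simp add: chirp_def exp_cnj flip: exp_add)

lemma chirp_ext_eq:
  assumes "0 \<le> \<xi>" "\<xi> < frft_period \<theta>"
  shows "chirp_ext \<theta> F \<xi> = F \<xi>"
proof -
  have "\<xi> rmod frft_period \<theta> = \<xi>"
    using assms by (intro rmod_idem) auto
  then show ?thesis
    using cnj_chirp_mult_chirp[of \<theta> \<xi>] by (simp add: chirp_ext_def mult.commute mult.left_commute)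
qed

lemma chirp_ext_periodic:
  "cnj (chirp \<theta> (\<xi> + frft_period \<theta>)) * chirp_ext \<theta> F (\<xi> + frft_period \<theta>)
     = cnj (chirp \<theta> \<xi>) * chirp_ext \<theta> F \<xi>"
proof -
  have "(\<xi> + frft_period \<theta>) rmod frft_period \<theta> = \<xi> rmod frft_period \<theta>"
    by (cases "frft_period \<theta> = 0") (simp_all add: rmod_def frft_period_def add_divide_distrib algebra_simps)
  then show ?thesis
    by (simp add: chirp_ext_def cnj_chirp_mult_chirp flip: mult.assoc)
qed

end

theory Submission
  imports Defs
begin

text \<open>
  Write \<open>u(\<xi>) = cnj (chirp \<theta> \<xi>) F(\<xi>)\<close>, extended with period \<open>\<Delta>\<close>. The kernel functions
  \<open>K\<^sub>n = frft_kernel \<theta> n\<close> are, up to unimodular factors, the normalized exponentials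
  \<open>cis (- b n \<xi>)\<close> of period \<open>\<Delta>\<close>, so they form an orthonormal basis of \<open>L\<^sup>2[0, \<Delta>]\<close>. The operator
  \<open>J\<close> sends \<open>F\<close> to the series of generators whose coefficients are those of \<open>F\<close> in this basis.
  The transform turns a translation of the generator into multiplication by an exponential, so
  it maps the finite sums of the series to (trigonometric polynomial) times \<open>frft \<theta> \<phi>\<close>, and in the
  limit the transform of \<open>J F\<close> is \<open>u \<cdot> frft \<theta> \<phi>\<close>: this is part (b), lemma \<open>frft_J\<close>. Folding the
  line onto one period (\<open>nn_integral_periodization\<close>) and using that the transform is an isometry
  give \<open>\<parallel>J F\<parallel>\<^sup>2 = \<integral> \<bar>F\<bar>\<^sup>2 G\<close> over the cell, which lies between \<open>A \<parallel>F\<parallel>\<^sup>2\<close> and \<open>B \<parallel>F\<parallel>\<^sup>2\<close>. The lower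
  bound makes \<open>J\<close> injective with closed range; the range contains every finite combination of
  generators, hence all of \<open>V\<close>, and part (a) follows. The Zak formula and part (c) are manipulations
  of coefficients: the first interchanges an inner product with a series converging in the mean, the
  second uses that multiplying \<open>F\<close> by an exponential shifts its coefficient sequence.

  Two classical facts carry the argument. The exponentials are complete on a period
  (\<open>fourier_basis_complete\<close>), by the Stone--Weierstrass theorem and inner regularity of Lebesgue
  measure. The transform is an isometry (\<open>frft_isometry\<close>); for functions of compact support this is
  obtained from Parseval's identity for Fourier series, applied on one long period to all
  modulations of the function and then integrated over the modulation parameter
  (\<open>Plancherel_compact_support_nn\<close>).
\<close>

section \<open>The space of square-integrable functions\<close>

lemma borel_measurable_cnj [measurable (raw)]:
  assumes "f \<in> borel_measurable M" shows "(\<lambda>x. cnj (f x)) \<in> borel_measurable M"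
  using assms by (rule borel_measurable_continuous_on[OF continuous_on_cnj[OF continuous_on_id]])

lemma L2_measurable [measurable_dest]: "f \<in> L2 M \<Longrightarrow> f \<in> borel_measurable M"
  by (simp add: L2_def)

lemma L2_integrable_square: "f \<in> L2 M \<Longrightarrow> integrable M (\<lambda>x. (cmod (f x))\<^sup>2)"
  by (simp add: L2_def)

lemma L2norm_nonneg [simp]: "0 \<le> L2norm M f"
  by (simp add: L2norm_def)

lemma L2norm_power2: "(L2norm M f)\<^sup>2 = (LINT x|M. (cmod (f x))\<^sup>2)"
  by (simp add: L2norm_def)

lemma nn_integral_L2:
  assumes "f \<in> L2 M"
  shows "(\<integral>\<^sup>+x. ennreal ((cmod (f x))\<^sup>2) \<partial>M) = ennreal ((L2norm M f)\<^sup>2)"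
  unfolding L2norm_power2
  by (rule nn_integral_eq_integral[OF L2_integrable_square[OF assms]]) simp

lemma L2_I_nn:
  assumes "f \<in> borel_measurable M" "(\<integral>\<^sup>+x. ennreal ((cmod (f x))\<^sup>2) \<partial>M) \<le> ennreal (C\<^sup>2)" "0 \<le> C"
  shows "f \<in> L2 M" "L2norm M f \<le> C"
proof -
  have "integrable M (\<lambda>x. (cmod (f x))\<^sup>2)"
    using assms by (intro integrableI_nonneg) (auto intro: le_less_trans)
  then show f: "f \<in> L2 M" using assms by (simp add: L2_def)
  show "L2norm M f \<le> C"
    using assms(2,3) unfolding nn_integral_L2[OF f]
    by (simp add: ennreal_le_iff power2_le_iff_abs_le)
qed

lemma L2_I_nn_less:
  assumes "f \<in> borel_measurable M" "(\<integral>\<^sup>+x. ennreal ((cmod (f x))\<^sup>2) \<partial>M) < \<infinity>"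
  shows "f \<in> L2 M"
  using assms by (auto simp: L2_def intro!: integrableI_nonneg)

lemma L2norm_eq_nn:
  assumes "f \<in> L2 M" "(\<integral>\<^sup>+x. ennreal ((cmod (f x))\<^sup>2) \<partial>M) = ennreal (C\<^sup>2)" "0 \<le> C"
  shows "L2norm M f = C"
  using assms(2,3) unfolding nn_integral_L2[OF assms(1)] by (simp add: power2_eq_iff_nonneg)

lemma L2_cong_AE:
  assumes "f \<in> L2 M" "g \<in> borel_measurable M" "AE x in M. f x = g x"
  shows "g \<in> L2 M"
proof -
  have "integrable M (\<lambda>x. (cmod (g x))\<^sup>2)"
    by (rule integrable_cong_AE_imp[OF L2_integrable_square[OF assms(1)]])
       (use assms in \<open>auto elim!: eventually_mono\<close>)
  with assms show ?thesis by (simp add: L2_def)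
qed

lemma L2norm_cong_AE:
  assumes "f \<in> borel_measurable M" "g \<in> borel_measurable M" "AE x in M. f x = g x"
  shows "L2norm M f = L2norm M g"
  unfolding L2norm_def
  by (intro arg_cong[where f=sqrt] integral_cong_AE) (use assms in \<open>auto elim!: eventually_mono\<close>)

lemma L2norm_zero [simp]: "L2norm M (\<lambda>x. 0) = 0"
  by (simp add: L2norm_def)

lemma L2_zero [simp]: "(\<lambda>x. 0) \<in> L2 M"
  by (simp add: L2_def)

lemma L2norm_eq_0_iff:
  assumes "f \<in> L2 M"
  shows "L2norm M f = 0 \<longleftrightarrow> (AE x in M. f x = 0)"
  unfolding L2norm_def
  using integral_nonneg_eq_0_iff_AE[OF L2_integrable_square[OF assms]] by simp

lemma L2_cmult:
  assumes "f \<in> L2 M" shows "(\<lambda>x. z * f x) \<in> L2 M"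
  using assms by (auto simp: L2_def norm_mult power_mult_distrib)

lemma L2norm_cmult: "L2norm M (\<lambda>x. z * f x) = cmod z * L2norm M f"
  by (simp add: L2norm_def norm_mult power_mult_distrib real_sqrt_mult)

lemma L2norm_minus_commute: "L2norm M (\<lambda>x. f x - g x) = L2norm M (\<lambda>x. g x - f x)"
  by (simp add: L2norm_def norm_minus_commute)

lemma L2_cnj: "f \<in> L2 M \<Longrightarrow> (\<lambda>x. cnj (f x)) \<in> L2 M"
  by (auto simp: L2_def intro: borel_measurable_cnj)

lemma L2_mult_unimodular:
  assumes "f \<in> L2 M" "u \<in> borel_measurable M" "\<And>x. cmod (u x) = 1"
  shows "(\<lambda>x. u x * f x) \<in> L2 M"
  using assms by (auto simp: L2_def norm_mult)

lemma L2norm_mult_unimodular: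
  assumes "\<And>x. cmod (u x) = 1"
  shows "L2norm M (\<lambda>x. u x * f x) = L2norm M f"
  using assms by (simp add: L2norm_def norm_mult)

lemma cmod_add_power2_le:
  assumes "0 < a" "0 < b"
  shows "(cmod (z + w))\<^sup>2 \<le> (1 + b / a) * (cmod z)\<^sup>2 + (1 + a / b) * (cmod w)\<^sup>2"
proof -
  have "(cmod (z + w))\<^sup>2 \<le> (cmod z + cmod w)\<^sup>2"
    by (simp add: norm_triangle_ineq power_mono)
  also have "\<dots> \<le> (1 + b / a) * (cmod z)\<^sup>2 + (1 + a / b) * (cmod w)\<^sup>2"
  proof -
    have "0 \<le> (b * cmod z - a * cmod w)\<^sup>2 / (a * b)" using assms by simp
    also have "\<dots> = b / a * (cmod z)\<^sup>2 + a / b * (cmod w)\<^sup>2 - 2 * cmod z * cmod w"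
      using assms by (simp add: field_simps power2_eq_square)
    finally show ?thesis by (simp add: algebra_simps power2_eq_square)
  qed
  finally show ?thesis .
qed

lemma L2_add:
  assumes "f \<in> L2 M" "g \<in> L2 M" shows "(\<lambda>x. f x + g x) \<in> L2 M"
proof -
  have [measurable]: "f \<in> borel_measurable M" "g \<in> borel_measurable M"
    using assms by (auto simp: L2_def)
  have "integrable M (\<lambda>x. (cmod (f x + g x))\<^sup>2)"
  proof (rule Bochner_Integration.integrable_bound)
    show "integrable M (\<lambda>x. (1 + 1 / 1) * (cmod (f x))\<^sup>2 + (1 + 1 / 1) * (cmod (g x))\<^sup>2)"
      by (intro Bochner_Integration.integrable_add integrable_mult_right L2_integrable_square assms)
  qed (use cmod_add_power2_le[of 1 1] in auto)
  then show ?thesis by (simp add: L2_def)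
qed

lemma L2_diff:
  assumes "f \<in> L2 M" "g \<in> L2 M" shows "(\<lambda>x. f x - g x) \<in> L2 M"
  using L2_add[OF assms(1) L2_cmult[OF assms(2), of "-1"]] by simp

lemma L2_sum:
  assumes "\<And>i. i \<in> S \<Longrightarrow> f i \<in> L2 M" shows "(\<lambda>x. \<Sum>i\<in>S. f i x) \<in> L2 M"
  using assms by (induction S rule: infinite_finite_induct) (auto intro: L2_add)

text \<open>
  Integrating a weighted form of \<open>2 a b \<le> a\<^sup>2 + b\<^sup>2\<close> proves this, the weight being the ratio of
  the two norms. Both norms are enlarged by \<open>e / 2\<close> so that the ratio makes sense when one
  of them is zero.
\<close>

lemma L2norm_add_le:
  assumes f: "f \<in> L2 M" and g: "g \<in> L2 M"
  shows "L2norm M (\<lambda>x. f x + g x) \<le> L2norm M f + L2norm M g"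
proof (rule field_le_epsilon)
  fix e :: real assume "0 < e"
  define a b where "a = L2norm M f + e / 2" and "b = L2norm M g + e / 2"
  have ab: "0 < a" "0 < b" "L2norm M f \<le> a" "L2norm M g \<le> b"
    using \<open>0 < e\<close> by (auto simp: a_def b_def add_nonneg_pos)
  have "(L2norm M (\<lambda>x. f x + g x))\<^sup>2
      \<le> (LINT x|M. (1 + b / a) * (cmod (f x))\<^sup>2 + (1 + a / b) * (cmod (g x))\<^sup>2)"
    unfolding L2norm_power2
    by (intro integral_mono Bochner_Integration.integrable_add integrable_mult_right
        L2_integrable_square assms L2_add cmod_add_power2_le ab)
  also have "\<dots> = (1 + b / a) * (L2norm M f)\<^sup>2 + (1 + a / b) * (L2norm M g)\<^sup>2"
    unfolding L2norm_power2
    by (subst Bochner_Integration.integral_add)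
       (simp_all add: L2_integrable_square[OF f] L2_integrable_square[OF g])
  also have "\<dots> \<le> (1 + b / a) * a\<^sup>2 + (1 + a / b) * b\<^sup>2"
    using ab by (intro add_mono mult_left_mono power_mono) auto
  also have "\<dots> = (a + b)\<^sup>2"
    using ab by (simp add: field_simps power2_eq_square)
  finally have "L2norm M (\<lambda>x. f x + g x) \<le> a + b"
    using ab by (meson add_nonneg_nonneg less_imp_le power2_le_imp_le)
  then show "L2norm M (\<lambda>x. f x + g x) \<le> L2norm M f + L2norm M g + e"
    by (simp add: a_def b_def)
qed

lemma L2norm_diff_triangle:
  assumes "f \<in> L2 M" "g \<in> L2 M" "h \<in> L2 M"
  shows "L2norm M (\<lambda>x. f x - h x) \<le> L2norm M (\<lambda>x. f x - g x) + L2norm M (\<lambda>x. g x - h x)"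
  using L2norm_add_le[OF L2_diff[OF assms(1,2)] L2_diff[OF assms(2,3)]] by simp

lemma L2norm_diff_abs_le:
  assumes "f \<in> L2 M" "g \<in> L2 M"
  shows "\<bar>L2norm M f - L2norm M g\<bar> \<le> L2norm M (\<lambda>x. f x - g x)"
  using L2norm_diff_triangle[OF assms(1,2) L2_zero] L2norm_diff_triangle[OF assms(2,1) L2_zero]
  by (simp add: L2norm_minus_commute[of M f g])

lemma L2_inner_integrable:
  assumes "f \<in> L2 M" "g \<in> L2 M" shows "integrable M (\<lambda>x. f x * cnj (g x))"
proof (rule Bochner_Integration.integrable_bound)
  have [measurable]: "f \<in> borel_measurable M" "g \<in> borel_measurable M"
    using assms by (auto simp: L2_def)
  show "integrable M (\<lambda>x. (cmod (f x))\<^sup>2 + (cmod (g x))\<^sup>2)"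
    by (intro Bochner_Integration.integrable_add L2_integrable_square assms)
  show "(\<lambda>x. f x * cnj (g x)) \<in> borel_measurable M" by measurable
  have "a * b \<le> a\<^sup>2 + b\<^sup>2" if "0 \<le> a" "0 \<le> b" for a b :: real
  proof -
    have "0 \<le> a * b" using that by simp
    then show ?thesis using sum_squares_bound[of a b] by linarith
  qed
  then show "AE x in M. norm (f x * cnj (g x)) \<le> norm ((cmod (f x))\<^sup>2 + (cmod (g x))\<^sup>2)"
    by (intro AE_I2) (simp add: norm_mult)
qed

lemma L2inner_Cauchy_Schwarz:
  assumes f: "f \<in> L2 M" and g: "g \<in> L2 M"
  shows "cmod (L2inner M f g) \<le> L2norm M f * L2norm M g"
proof -
  have [measurable]: "f \<in> borel_measurable M" "g \<in> borel_measurable M"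
    using assms by (auto simp: L2_def)
  have "ennreal (cmod (L2inner M f g)) \<le> (\<integral>\<^sup>+x. ennreal (cmod (f x)) * ennreal (cmod (g x)) \<partial>M)"
    unfolding L2inner_def
    by (rule order_trans[OF integral_norm_bound_ennreal[OF L2_inner_integrable[OF assms]]])
       (simp add: norm_mult ennreal_mult)
  then have "ennreal ((cmod (L2inner M f g))\<^sup>2)
      \<le> (\<integral>\<^sup>+x. ennreal (cmod (f x)) * ennreal (cmod (g x)) \<partial>M)\<^sup>2"
    by (simp add: power_mono flip: ennreal_power)
  also have "\<dots> \<le> (\<integral>\<^sup>+x. (ennreal (cmod (f x)))\<^sup>2 \<partial>M) * (\<integral>\<^sup>+x. (ennreal (cmod (g x)))\<^sup>2 \<partial>M)"
    by (rule Cauchy_Schwarz_nn_integral) auto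
  also have "\<dots> = ennreal ((L2norm M f * L2norm M g)\<^sup>2)"
    by (simp add: ennreal_power nn_integral_L2 f g power_mult_distrib flip: ennreal_mult)
  finally show ?thesis
    by (simp add: power2_le_iff_abs_le)
qed

lemma L2inner_add_left:
  assumes "f \<in> L2 M" "g \<in> L2 M" "h \<in> L2 M"
  shows "L2inner M (\<lambda>x. f x + g x) h = L2inner M f h + L2inner M g h"
  using L2_inner_integrable[OF assms(1,3)] L2_inner_integrable[OF assms(2,3)]
  by (simp add: L2inner_def algebra_simps)

lemma L2inner_diff_left:
  assumes "f \<in> L2 M" "g \<in> L2 M" "h \<in> L2 M"
  shows "L2inner M (\<lambda>x. f x - g x) h = L2inner M f h - L2inner M g h"
  using L2_inner_integrable[OF assms(1,3)] L2_inner_integrable[OF assms(2,3)]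
  by (simp add: L2inner_def algebra_simps)

lemma L2inner_cmult_left: "L2inner M (\<lambda>x. z * f x) h = z * L2inner M f h"
  by (simp add: L2inner_def mult.assoc)

lemma L2inner_sum_left:
  assumes "\<And>i. i \<in> S \<Longrightarrow> f i \<in> L2 M" "h \<in> L2 M"
  shows "L2inner M (\<lambda>x. \<Sum>i\<in>S. f i x) h = (\<Sum>i\<in>S. L2inner M (f i) h)"
  using assms
proof (induction S rule: infinite_finite_induct)
  case (insert i S)
  then show ?case by (simp add: L2inner_add_left L2_sum)
qed (auto simp: L2inner_def)

lemma L2inner_commute: "L2inner M f g = cnj (L2inner M g f)"
  using Bochner_Integration.integral_cnj[of M "\<lambda>x. g x * cnj (f x)"] by (simp add: L2inner_def mult.commute)

lemma L2inner_self: "L2inner M f f = of_real ((L2norm M f)\<^sup>2)"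
  unfolding L2inner_def L2norm_power2 complex_norm_square[symmetric]
  by (simp flip: integral_complex_of_real)

lemma L2inner_cong_AE_left:
  assumes "f \<in> borel_measurable M" "g \<in> borel_measurable M" "h \<in> borel_measurable M"
    "AE x in M. f x = g x"
  shows "L2inner M f h = L2inner M g h"
  unfolding L2inner_def
  by (rule integral_cong_AE) (use assms in \<open>auto elim!: eventually_mono\<close>)

section \<open>Convergence in the mean and completeness\<close>

lemma L2_tendsto_in_L2: "L2_tendsto M f g F \<Longrightarrow> g \<in> L2 M"
  by (simp add: L2_tendsto_def)

lemma L2_tendsto_unique:
  assumes "F \<noteq> bot" and f: "L2_tendsto M f g F" and f': "L2_tendsto M f g' F"
  shows "AE x in M. g x = g' x"
proof -
  have g: "g \<in> L2 M" "g' \<in> L2 M" using f f' by (auto simp: L2_tendsto_def)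
  have "((\<lambda>i. L2norm M (\<lambda>x. f i x - g x) + L2norm M (\<lambda>x. f i x - g' x)) \<longlongrightarrow> 0 + 0) F"
    using f f' by (intro tendsto_add) (auto simp: L2_tendsto_def)
  moreover have "\<forall>\<^sub>F i in F. f i \<in> L2 M" using f by (simp add: L2_tendsto_def)
  then have "\<forall>\<^sub>F i in F. L2norm M (\<lambda>x. g x - g' x)
      \<le> L2norm M (\<lambda>x. f i x - g x) + L2norm M (\<lambda>x. f i x - g' x)"
  proof eventually_elim
    case (elim i)
    then show ?case
      using L2norm_diff_triangle[OF g(1) elim g(2)] L2norm_minus_commute[of M g "f i"] by simp
  qed
  ultimately have "L2norm M (\<lambda>x. g x - g' x) \<le> 0 + 0"
    using \<open>F \<noteq> bot\<close> by (rule tendsto_lowerbound)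
  then have "L2norm M (\<lambda>x. g x - g' x) = 0" by (simp add: antisym)
  then show ?thesis using L2norm_eq_0_iff[OF L2_diff[OF g]] by simp
qed

lemma L2_tendsto_cong_AE:
  assumes f: "L2_tendsto M f g F" and g': "g' \<in> borel_measurable M" and eq: "AE x in M. g x = g' x"
  shows "L2_tendsto M f g' F"
proof -
  have g: "g \<in> L2 M" and fL: "\<forall>\<^sub>F i in F. f i \<in> L2 M" using f by (auto simp: L2_tendsto_def)
  have "\<forall>\<^sub>F i in F. L2norm M (\<lambda>x. f i x - g x) = L2norm M (\<lambda>x. f i x - g' x)"
    using fL
  proof eventually_elim
    case (elim i)
    show ?case
      by (rule L2norm_cong_AE)
         (use elim g g' eq L2_measurable[OF elim] L2_measurable[OF g] in \<open>auto elim!: eventually_mono\<close>)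
  qed
  then have "((\<lambda>i. L2norm M (\<lambda>x. f i x - g' x)) \<longlongrightarrow> 0) F"
    using f by (auto simp: L2_tendsto_def intro: Lim_transform_eventually)
  then show ?thesis using L2_cong_AE[OF g g' eq] fL by (simp add: L2_tendsto_def)
qed

lemma tendsto_L2norm:
  assumes "L2_tendsto M f g F" shows "((\<lambda>i. L2norm M (f i)) \<longlongrightarrow> L2norm M g) F"
proof (rule Lim_null_comparison[THEN LIM_zero_cancel])
  show "\<forall>\<^sub>F i in F. norm (L2norm M (f i) - L2norm M g) \<le> L2norm M (\<lambda>x. f i x - g x)"
    using assms by (auto simp: L2_tendsto_def elim!: eventually_mono intro: L2norm_diff_abs_le)
qed (use assms in \<open>simp add: L2_tendsto_def\<close>)

lemma tendsto_L2inner: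
  assumes f: "L2_tendsto M f g F" and h: "h \<in> L2 M"
  shows "((\<lambda>i. L2inner M (f i) h) \<longlongrightarrow> L2inner M g h) F"
proof (rule Lim_null_comparison[THEN LIM_zero_cancel])
  have "\<forall>\<^sub>F i in F. f i \<in> L2 M" "g \<in> L2 M" using f by (auto simp: L2_tendsto_def)
  then show "\<forall>\<^sub>F i in F. norm (L2inner M (f i) h - L2inner M g h)
      \<le> L2norm M (\<lambda>x. f i x - g x) * L2norm M h"
    by (auto elim!: eventually_mono
        simp: L2inner_diff_left[symmetric] h intro!: L2inner_Cauchy_Schwarz L2_diff)
  have "((\<lambda>i. L2norm M (\<lambda>x. f i x - g x)) \<longlongrightarrow> 0) F" using f by (simp add: L2_tendsto_def)
  from tendsto_mult_right[OF this, of "L2norm M h"]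
  show "((\<lambda>i. L2norm M (\<lambda>x. f i x - g x) * L2norm M h) \<longlongrightarrow> 0) F" by simp
qed

lemma L2_tendsto_add:
  assumes f: "L2_tendsto M f g F" and f': "L2_tendsto M f' g' F"
  shows "L2_tendsto M (\<lambda>i x. f i x + f' i x) (\<lambda>x. g x + g' x) F"
proof -
  have g: "g \<in> L2 M" "g' \<in> L2 M" using f f' by (auto simp: L2_tendsto_def)
  have ev: "\<forall>\<^sub>F i in F. f i \<in> L2 M \<and> f' i \<in> L2 M"
    using f f' by (auto simp: L2_tendsto_def eventually_conj)
  have "((\<lambda>i. L2norm M (\<lambda>x. f i x - g x) + L2norm M (\<lambda>x. f' i x - g' x)) \<longlongrightarrow> 0 + 0) F"
    using f f' by (intro tendsto_add) (auto simp: L2_tendsto_def)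
  then have *: "((\<lambda>i. L2norm M (\<lambda>x. f i x - g x) + L2norm M (\<lambda>x. f' i x - g' x)) \<longlongrightarrow> 0) F" by simp
  have "((\<lambda>i. L2norm M (\<lambda>x. (f i x + f' i x) - (g x + g' x))) \<longlongrightarrow> 0) F"
  proof (rule Lim_null_comparison[OF _ *])
    show "\<forall>\<^sub>F i in F. norm (L2norm M (\<lambda>x. (f i x + f' i x) - (g x + g' x)))
        \<le> L2norm M (\<lambda>x. f i x - g x) + L2norm M (\<lambda>x. f' i x - g' x)"
      using ev
    proof eventually_elim
      case (elim i)
      then show ?case
        using L2norm_add_le[of "\<lambda>x. f i x - g x" M "\<lambda>x. f' i x - g' x"] g
        by (simp add: L2_diff add_diff_add)
    qed
  qed
  moreover have "\<forall>\<^sub>F i in F. (\<lambda>x. f i x + f' i x) \<in> L2 M"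
    using ev by eventually_elim (simp add: L2_add)
  ultimately show ?thesis by (simp add: L2_tendsto_def L2_add g)
qed

lemma L2_tendsto_cmult:
  assumes "L2_tendsto M f g F" shows "L2_tendsto M (\<lambda>i x. z * f i x) (\<lambda>x. z * g x) F"
  using assms unfolding L2_tendsto_def
  by (auto simp: L2_cmult L2norm_cmult tendsto_mult_right_zero simp flip: right_diff_distrib
      elim!: eventually_mono)

lemma L2_tendsto_cong_seq:
  assumes f: "L2_tendsto M f g F"
    and f': "\<And>i. f' i \<in> borel_measurable M" and eq: "\<And>i. AE x in M. f i x = f' i x"
  shows "L2_tendsto M f' g F"
proof -
  have g: "g \<in> L2 M" and ev: "\<forall>\<^sub>F i in F. f i \<in> L2 M"
    and lim: "((\<lambda>i. L2norm M (\<lambda>x. f i x - g x)) \<longlongrightarrow> 0) F"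
    using f by (auto simp: L2_tendsto_def)
  have ev': "\<forall>\<^sub>F i in F. f' i \<in> L2 M"
    using ev by eventually_elim (rule L2_cong_AE[OF _ f' eq])
  have "\<forall>\<^sub>F i in F. L2norm M (\<lambda>x. f i x - g x) = L2norm M (\<lambda>x. f' i x - g x)"
    using ev
  proof eventually_elim
    case (elim i)
    show ?case
      using eq[of i]
      by (intro L2norm_cong_AE borel_measurable_diff L2_measurable[OF elim] f' L2_measurable[OF g])
         (auto elim!: eventually_mono)
  qed
  from Lim_transform_eventually[OF lim this] show ?thesis by (simp add: L2_tendsto_def g ev')
qed

lemma L2_tendsto_mult_unimodular:
  assumes f: "L2_tendsto M f g F" and u: "u \<in> borel_measurable M" "\<And>x. cmod (u x) = 1"
  shows "L2_tendsto M (\<lambda>i x. u x * f i x) (\<lambda>x. u x * g x) F"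
proof -
  have "L2norm M (\<lambda>x. u x * f i x - u x * g x) = L2norm M (\<lambda>x. f i x - g x)" for i
    using L2norm_mult_unimodular[where u = u and M = M and f = "\<lambda>x. f i x - g x", OF u(2)] by (simp add: right_diff_distrib)
  then show ?thesis
    using f unfolding L2_tendsto_def
    by (auto simp: L2_mult_unimodular[OF _ u] elim!: eventually_mono)
qed

lemma L2_tendsto_compose:
  assumes "L2_tendsto M f g F" "filterlim r F F'"
  shows "L2_tendsto M (\<lambda>i. f (r i)) g F'"
  using assms unfolding L2_tendsto_def
  by (auto intro: filterlim_compose[where f=r] eventually_compose_filterlim)

definition L2_Cauchy :: "'a measure \<Rightarrow> (nat \<Rightarrow> 'a \<Rightarrow> complex) \<Rightarrow> bool" where
  "L2_Cauchy M f \<longleftrightarrow> (\<forall>n. f n \<in> L2 M) \<and>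
     (\<forall>e>0. \<exists>N. \<forall>m\<ge>N. \<forall>n\<ge>N. L2norm M (\<lambda>x. f m x - f n x) \<le> e)"

lemma L2_tendsto_imp_Cauchy:
  assumes f: "L2_tendsto M f g sequentially" and L: "\<And>n. f n \<in> L2 M"
  shows "L2_Cauchy M f"
  unfolding L2_Cauchy_def
proof (intro conjI allI impI)
  fix e :: real assume "0 < e"
  have "(\<lambda>n. L2norm M (\<lambda>x. f n x - g x)) \<longlonglongrightarrow> 0" and g: "g \<in> L2 M"
    using f by (auto simp: L2_tendsto_def)
  from order_tendstoD(2)[OF this(1), of "e / 2"] \<open>0 < e\<close>
  obtain N where N: "\<And>n. n \<ge> N \<Longrightarrow> L2norm M (\<lambda>x. f n x - g x) < e / 2"
    by (auto simp: eventually_sequentially)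
  have "L2norm M (\<lambda>x. f m x - f n x) \<le> e" if "m \<ge> N" "n \<ge> N" for m n
    using L2norm_diff_triangle[OF L[of m] g L[of n]] N[OF that(1)] N[OF that(2)]
      L2norm_minus_commute[of M g "f n"] by linarith
  then show "\<exists>N. \<forall>m\<ge>N. \<forall>n\<ge>N. L2norm M (\<lambda>x. f m x - f n x) \<le> e" by blast
qed (rule L)

text \<open>
  Fatou's lemma bounds \<open>\<parallel>f\<^sub>n - g\<parallel>\<close> by the lower limit of \<open>\<parallel>f\<^sub>n - f\<^sub>m\<parallel>\<close> over \<open>m\<close>, which is small for
  large \<open>n\<close>.
\<close>

lemma L2_Cauchy_pointwise_limit:
  assumes C: "L2_Cauchy M f" and g[measurable]: "g \<in> borel_measurable M"
    and lim: "AE x in M. (\<lambda>n. f n x) \<longlonglongrightarrow> g x"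
  shows "L2_tendsto M f g sequentially"
proof -
  have fL: "f n \<in> L2 M" for n using C by (simp add: L2_Cauchy_def)
  note [measurable] = L2_measurable[OF fL]
  have main: "(\<lambda>x. f n x - g x) \<in> L2 M \<and> L2norm M (\<lambda>x. f n x - g x) \<le> e"
    if e: "0 < e" and N: "\<And>m n. m \<ge> N \<Longrightarrow> n \<ge> N \<Longrightarrow> L2norm M (\<lambda>x. f m x - f n x) \<le> e" and n: "n \<ge> N"
    for e N n
  proof -
    have "(\<integral>\<^sup>+x. ennreal ((cmod (f n x - g x))\<^sup>2) \<partial>M)
        = (\<integral>\<^sup>+x. liminf (\<lambda>m. ennreal ((cmod (f n x - f m x))\<^sup>2)) \<partial>M)"
    proof (rule nn_integral_cong_AE)
      show "AE x in M. ennreal ((cmod (f n x - g x))\<^sup>2)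
          = liminf (\<lambda>m. ennreal ((cmod (f n x - f m x))\<^sup>2))"
        using lim
      proof eventually_elim
        case (elim x)
        have "(\<lambda>m. ennreal ((cmod (f n x - f m x))\<^sup>2)) \<longlonglongrightarrow> ennreal ((cmod (f n x - g x))\<^sup>2)"
          by (intro tendsto_intros elim)
        then show ?case by (metis lim_imp_Liminf sequentially_bot)
      qed
    qed
    also have "\<dots> \<le> liminf (\<lambda>m. \<integral>\<^sup>+x. ennreal ((cmod (f n x - f m x))\<^sup>2) \<partial>M)"
      by (rule nn_integral_liminf) auto
    also have "\<dots> \<le> ennreal (e\<^sup>2)"
    proof (rule Liminf_le)
      show "\<forall>\<^sub>F m in sequentially. (\<integral>\<^sup>+x. ennreal ((cmod (f n x - f m x))\<^sup>2) \<partial>M) \<le> ennreal (e\<^sup>2)"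
        using N[OF n] by (auto simp: nn_integral_L2 L2_diff fL eventually_sequentially
            intro!: exI[of _ N] power_mono)
    qed simp
    finally show ?thesis using L2_I_nn[of "\<lambda>x. f n x - g x" M e] e by auto
  qed
  have ex: "\<exists>N. \<forall>m\<ge>N. \<forall>n\<ge>N. L2norm M (\<lambda>x. f m x - f n x) \<le> e" if "0 < e" for e
    using C that by (auto simp: L2_Cauchy_def)
  obtain N where "\<And>m n. m \<ge> N \<Longrightarrow> n \<ge> N \<Longrightarrow> L2norm M (\<lambda>x. f m x - f n x) \<le> 1"
    using ex[of 1] by auto
  from main[OF _ this, of N] have "(\<lambda>x. f N x - g x) \<in> L2 M" by simp
  from L2_diff[OF fL[of N] this] have gL: "g \<in> L2 M" by simp
  have "(\<lambda>n. L2norm M (\<lambda>x. f n x - g x)) \<longlonglongrightarrow> 0"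
  proof (rule LIMSEQ_I)
    fix r :: real assume "0 < r"
    then obtain N where "\<And>m n. m \<ge> N \<Longrightarrow> n \<ge> N \<Longrightarrow> L2norm M (\<lambda>x. f m x - f n x) \<le> r / 2"
      using ex[of "r / 2"] by (meson half_gt_zero)
    from main[OF _ this] \<open>0 < r\<close> have "L2norm M (\<lambda>x. f n x - g x) \<le> r / 2" if "n \<ge> N" for n
      using that by simp
    then have "norm (L2norm M (\<lambda>x. f n x - g x) - 0) < r" if "n \<ge> N" for n
      using \<open>0 < r\<close> that by fastforce
    then show "\<exists>N. \<forall>n\<ge>N. norm (L2norm M (\<lambda>x. f n x - g x) - 0) < r" by blast
  qed
  then show ?thesis using gL fL by (simp add: L2_tendsto_def)
qed

text \<open>
  Pass to a subsequence \<open>h\<close> whose increments have norm at most \<open>2\<^sup>-\<^sup>k\<close>. Then the sum of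
  \<open>2\<^sup>k \<bar>h (k+1) - h k\<bar>\<^sup>2\<close> over \<open>k\<close> has finite integral, so it is finite almost everywhere. Since
  \<open>\<bar>z\<bar> \<le> 2\<^sup>-\<^sup>k + 2\<^sup>k \<bar>z\<bar>\<^sup>2\<close>, the increments themselves are then summable, and \<open>h\<close> converges
  pointwise; the weights \<open>2\<^sup>k\<close> replace the usual appeal to Minkowski's inequality for series.
\<close>

theorem L2_complete:
  assumes C: "L2_Cauchy M f"
  obtains g where "L2_tendsto M f g sequentially"
proof -
  have fL: "f n \<in> L2 M" for n using C by (simp add: L2_Cauchy_def)
  have "\<forall>k. \<exists>N. \<forall>m\<ge>N. \<forall>n\<ge>N. L2norm M (\<lambda>x. f m x - f n x) \<le> (1/2) ^ k"
    using C by (auto simp: L2_Cauchy_def)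
  then obtain N where N: "\<And>k m n. m \<ge> N k \<Longrightarrow> n \<ge> N k \<Longrightarrow> L2norm M (\<lambda>x. f m x - f n x) \<le> (1/2) ^ k"
    by metis
  define r where "r k = (\<Sum>i\<le>k. N i) + k" for k
  have rN: "r k \<ge> N k" for k
    unfolding r_def by (rule trans_le_add1) (simp add: member_le_sum)
  have rS: "r k < r (Suc k)" for k by (simp add: r_def)
  then have "strict_mono r" by (simp add: strict_mono_Suc_iff)
  define h where "h k = f (r k)" for k
  have hL: "h k \<in> L2 M" for k by (simp add: h_def fL)
  note [measurable] = L2_measurable[OF hL]
  have h_inc: "L2norm M (\<lambda>x. h (Suc k) x - h k x) \<le> (1/2) ^ k" for k
    unfolding h_def using rN[of k] rS[of k] by (intro N) auto
  define d where "d k x = 2 ^ k * (cmod (h (Suc k) x - h k x))\<^sup>2" for k x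
  have [measurable]: "d k \<in> borel_measurable M" for k unfolding d_def by measurable
  have "(\<integral>\<^sup>+x. (\<Sum>k. ennreal (d k x)) \<partial>M) = (\<Sum>k. \<integral>\<^sup>+x. ennreal (d k x) \<partial>M)"
    by (rule nn_integral_suminf) measurable
  also have "\<dots> \<le> (\<Sum>k. ennreal ((1/2) ^ k))"
  proof (rule suminf_le[OF _ summableI summableI])
    fix k
    have "(\<integral>\<^sup>+x. ennreal (d k x) \<partial>M) = ennreal (2 ^ k * (L2norm M (\<lambda>x. h (Suc k) x - h k x))\<^sup>2)"
      unfolding d_def by (simp add: ennreal_mult nn_integral_cmult nn_integral_L2 L2_diff hL)
    also have "\<dots> \<le> ennreal (2 ^ k * ((1/2) ^ k)\<^sup>2)"
      by (intro ennreal_leI mult_left_mono power_mono h_inc) auto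
    also have "2 ^ k * ((1/2) ^ k)\<^sup>2 = ((1/2) ^ k :: real)"
      by (simp add: power2_eq_square power_one_over field_simps)
    finally show "(\<integral>\<^sup>+x. ennreal (d k x) \<partial>M) \<le> ennreal ((1/2) ^ k)" .
  qed
  also have "(\<Sum>k. ennreal ((1/2) ^ k)) = ennreal (\<Sum>k. (1/2) ^ k)"
    by (rule suminf_ennreal2) (simp, rule summable_geometric, simp)
  also have "\<dots> < \<infinity>" by (rule ennreal_less_top[folded infinity_ennreal_def])
  finally have "AE x in M. (\<Sum>k. ennreal (d k x)) \<noteq> \<infinity>"
    by (intro nn_integral_PInf_AE) auto
  then have "AE x in M. convergent (\<lambda>k. h k x)"
  proof eventually_elim
    case (elim x)
    have "summable (\<lambda>k. d k x)"
      by (rule summable_suminf_not_top) (use elim in \<open>auto simp: d_def\<close>)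
    then have s: "summable (\<lambda>k. (1/2) ^ k + d k x)"
      by (intro summable_add) (auto simp: summable_geometric)
    have le: "cmod (h (Suc k) x - h k x) \<le> (1/2) ^ k + d k x" for k
    proof -
      let ?a = "cmod (h (Suc k) x - h k x)"
      have "0 \<le> (2 ^ k * ?a - 1)\<^sup>2" by simp
      then have "2 * (2 ^ k * ?a) \<le> (2 ^ k * ?a)\<^sup>2 + 1" by (simp add: power2_diff)
      moreover have "2 ^ k * ((1/2) ^ k + d k x) = (2 ^ k * ?a)\<^sup>2 + 1"
        by (simp add: d_def power2_eq_square power_one_over distrib_left)
      ultimately have "2 ^ k * (2 * ?a) \<le> 2 ^ k * ((1/2) ^ k + d k x)"
        by (simp only: mult.left_commute)
      then have "2 * ?a \<le> (1/2) ^ k + d k x" by simp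
      then show ?thesis by (smt (verit) norm_ge_zero)
    qed
    have "summable (\<lambda>k. h (Suc k) x - h k x)"
      by (rule summable_comparison_test'[OF s, of 0]) (use le in auto)
    then have "convergent (\<lambda>n. h n x - h 0 x)"
      by (simp add: summable_iff_convergent sum_lessThan_telescope[of "\<lambda>k. h k x"])
    from convergent_add[OF this convergent_const[of "h 0 x"]] show ?case by simp
  qed
  define g where "g x = lim (\<lambda>k. h k x)" for x
  have gm: "g \<in> borel_measurable M" unfolding g_def by measurable
  have hg: "L2_tendsto M h g sequentially"
  proof (rule L2_Cauchy_pointwise_limit[OF _ gm])
    show "L2_Cauchy M h"
      unfolding L2_Cauchy_def
    proof (intro conjI allI impI hL)
      fix e :: real assume "0 < e"
      then obtain N where "\<And>m n. m \<ge> N \<Longrightarrow> n \<ge> N \<Longrightarrow> L2norm M (\<lambda>x. f m x - f n x) \<le> e"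
        using C unfolding L2_Cauchy_def by blast
      then show "\<exists>N. \<forall>m\<ge>N. \<forall>n\<ge>N. L2norm M (\<lambda>x. h m x - h n x) \<le> e"
        unfolding h_def by (meson \<open>strict_mono r\<close> seq_suble order_trans)
    qed
    show "AE x in M. (\<lambda>n. h n x) \<longlonglongrightarrow> g x"
      using \<open>AE x in M. convergent (\<lambda>k. h k x)\<close> by eventually_elim (simp add: g_def convergent_LIMSEQ_iff)
  qed
  have gL: "g \<in> L2 M" by (rule L2_tendsto_in_L2[OF hg])
  have "(\<lambda>n. L2norm M (\<lambda>x. f n x - g x)) \<longlonglongrightarrow> 0"
  proof (rule LIMSEQ_I)
    fix e :: real assume "0 < e"
    then have "0 < e / 2" by simp
    then obtain K where K: "\<And>m n. m \<ge> K \<Longrightarrow> n \<ge> K \<Longrightarrow> L2norm M (\<lambda>x. f m x - f n x) \<le> e / 2"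
      using C unfolding L2_Cauchy_def by blast
    have "(\<lambda>n. L2norm M (\<lambda>x. h n x - g x)) \<longlonglongrightarrow> 0" using hg by (simp add: L2_tendsto_def)
    then have "\<forall>\<^sub>F k in sequentially. k \<ge> K \<and> L2norm M (\<lambda>x. h k x - g x) < e / 2"
      using \<open>0 < e / 2\<close> by (intro eventually_conj eventually_ge_at_top order_tendstoD(2))
    then obtain k where k: "k \<ge> K" "L2norm M (\<lambda>x. h k x - g x) < e / 2"
      by (auto dest: eventually_happens)
    have "L2norm M (\<lambda>x. f n x - g x) < e" if "n \<ge> K" for n
      using L2norm_diff_triangle[OF fL[of n] hL[of k] gL] k K[OF that, of "r k"]
        seq_suble[OF \<open>strict_mono r\<close>, of k] unfolding h_def by linarith
    then show "\<exists>N. \<forall>n\<ge>N. norm (L2norm M (\<lambda>x. f n x - g x) - 0) < e" by auto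
  qed
  then show ?thesis using that gL fL by (auto simp: L2_tendsto_def)
qed

section \<open>Orthonormal systems\<close>

text \<open>
  Reduction to sequences: the index sets \<open>T k\<close> that witness the Cauchy condition with tolerance
  \<open>2\<^sup>-\<^sup>k\<close> are accumulated into an increasing sequence \<open>U k\<close>, along which completeness applies.
\<close>

lemma L2_complete_finite_subsets:
  fixes P :: "'i set \<Rightarrow> 'a \<Rightarrow> complex"
  assumes PL: "\<And>S. finite S \<Longrightarrow> P S \<in> L2 M"
    and C: "\<And>e. 0 < e \<Longrightarrow> \<exists>S0. finite S0 \<and>
      (\<forall>S. finite S \<and> S0 \<subseteq> S \<longrightarrow> L2norm M (\<lambda>x. P S x - P S0 x) \<le> e)"
  obtains g where "L2_tendsto M P g (finite_subsets_at_top UNIV)"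
proof -
  have "\<forall>k::nat. \<exists>S0. finite S0 \<and>
      (\<forall>S. finite S \<and> S0 \<subseteq> S \<longrightarrow> L2norm M (\<lambda>x. P S x - P S0 x) \<le> (1/2) ^ k)"
    using C by simp
  then obtain T where fT: "\<And>k. finite (T k)"
    and T: "\<And>k S. finite S \<Longrightarrow> T k \<subseteq> S \<Longrightarrow> L2norm M (\<lambda>x. P S x - P (T k) x) \<le> (1/2) ^ k"
    by metis
  define U where "U k = (\<Union>i\<le>k. T i)" for k
  have fU: "finite (U k)" for k by (simp add: U_def fT)
  have TU: "T k \<subseteq> U m" if "k \<le> m" for k m using that by (auto simp: U_def)
  have U: "L2norm M (\<lambda>x. P S x - P S' x) \<le> 2 * (1/2) ^ k"
    if "finite S" "T k \<subseteq> S" "finite S'" "T k \<subseteq> S'" for k S S'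
    using L2norm_diff_triangle[OF PL[OF that(1)] PL[OF fT[of k]] PL[OF that(3)]]
      T[OF that(1,2)] T[OF that(3,4)] L2norm_minus_commute[of M "P (T k)" "P S'"] by simp
  have small: "\<exists>k::nat. 2 * (1/2) ^ k \<le> e" if "0 < e" for e :: real
  proof -
    obtain k where "(1/2) ^ k < e / 2"
      using real_arch_pow_inv[of "e / 2" "1/2"] \<open>0 < e\<close> by auto
    then show ?thesis by (intro exI[of _ k]) simp
  qed
  have "L2_Cauchy M (\<lambda>k. P (U k))"
    unfolding L2_Cauchy_def
  proof (intro conjI allI impI PL fU)
    fix e :: real assume "0 < e"
    then obtain k :: nat where "2 * (1/2) ^ k \<le> e" using small by blast
    then show "\<exists>N. \<forall>m\<ge>N. \<forall>n\<ge>N. L2norm M (\<lambda>x. P (U m) x - P (U n) x) \<le> e"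
      by (intro exI[of _ k] allI impI order_trans[OF U[of _ k]] fU TU)
  qed
  then obtain g where g: "L2_tendsto M (\<lambda>k. P (U k)) g sequentially" by (rule L2_complete)
  then have gL: "g \<in> L2 M" and g0: "(\<lambda>k. L2norm M (\<lambda>x. P (U k) x - g x)) \<longlonglongrightarrow> 0"
    by (auto simp: L2_tendsto_def)
  have "((\<lambda>S. L2norm M (\<lambda>x. P S x - g x)) \<longlongrightarrow> 0) (finite_subsets_at_top UNIV)"
  proof (rule tendstoI)
    fix e :: real assume "0 < e"
    then obtain k :: nat where k: "2 * (1/2) ^ k \<le> e / 2" using small[of "e / 2"] by auto
    have "\<forall>\<^sub>F m in sequentially. m \<ge> k \<and> L2norm M (\<lambda>x. P (U m) x - g x) < e / 2"
      using \<open>0 < e\<close> g0 by (intro eventually_conj eventually_ge_at_top order_tendstoD(2)) auto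
    then obtain m where m: "m \<ge> k" "L2norm M (\<lambda>x. P (U m) x - g x) < e / 2"
      by (auto dest: eventually_happens)
    have "dist (L2norm M (\<lambda>x. P S x - g x)) 0 < e" if S: "finite S" "T k \<subseteq> S" for S
      using L2norm_diff_triangle[OF PL[OF S(1)] PL[OF fU[of m]] gL]
        U[OF S fU TU[OF m(1)]] k m(2) by (simp add: dist_real_def)
    then show "\<forall>\<^sub>F S in finite_subsets_at_top UNIV. dist (L2norm M (\<lambda>x. P S x - g x)) 0 < e"
      unfolding eventually_finite_subsets_at_top using fT[of k] by blast
  qed
  moreover have "\<forall>\<^sub>F S in finite_subsets_at_top UNIV. P S \<in> L2 M"
    using eventually_finite_subsets_at_top_weakI PL by blast
  ultimately show ?thesis using that gL by (simp add: L2_tendsto_def)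
qed

lemma summable_on_small_tail:
  fixes f :: "'i \<Rightarrow> real"
  assumes "f summable_on UNIV" "0 < e"
  obtains S0 where "finite S0" "\<And>S. finite S \<Longrightarrow> S0 \<subseteq> S \<Longrightarrow> \<bar>sum f (S - S0)\<bar> \<le> e"
proof -
  from assms(1) obtain s where s: "(f has_sum s) UNIV" by (auto simp: summable_on_def)
  then have "\<forall>\<^sub>F S in finite_subsets_at_top UNIV. dist (sum f S) s < e / 2"
    using assms(2) unfolding has_sum_def by (intro tendstoD) auto
  then obtain S0 where S0: "finite S0" "\<And>S. finite S \<Longrightarrow> S0 \<subseteq> S \<Longrightarrow> dist (sum f S) s < e / 2"
    unfolding eventually_finite_subsets_at_top by auto
  show ?thesis
  proof
    fix S assume S: "finite S" "S0 \<subseteq> S"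
    have "sum f (S - S0) = sum f S - sum f S0" using S by (rule sum_diff)
    then show "\<bar>sum f (S - S0)\<bar> \<le> e"
      using S0(2)[OF S] S0(2)[OF S0(1) order_refl] unfolding dist_real_def by linarith
  qed (rule S0(1))
qed

definition L2_orthonormal :: "'a measure \<Rightarrow> ('i \<Rightarrow> 'a \<Rightarrow> complex) \<Rightarrow> bool" where
  "L2_orthonormal M u \<longleftrightarrow>
     (\<forall>n. u n \<in> L2 M) \<and> (\<forall>m n. L2inner M (u m) (u n) = (if m = n then 1 else 0))"

definition L2_orthonormal_basis :: "'a measure \<Rightarrow> ('i \<Rightarrow> 'a \<Rightarrow> complex) \<Rightarrow> bool" where
  "L2_orthonormal_basis M u \<longleftrightarrow> L2_orthonormal M u \<and>
     (\<forall>f\<in>L2 M. (\<forall>n. L2inner M f (u n) = 0) \<longrightarrow> (AE x in M. f x = 0))"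

context
  fixes M :: "'a measure" and u :: "'i \<Rightarrow> 'a \<Rightarrow> complex"
  assumes on: "L2_orthonormal M u"
begin

lemma orthonormal_L2: "u n \<in> L2 M"
  using on by (simp add: L2_orthonormal_def)

lemma orthonormal_sum_L2: "(\<lambda>x. \<Sum>n\<in>S. c n * u n x) \<in> L2 M"
  by (intro L2_sum L2_cmult orthonormal_L2)

lemma L2inner_orthonormal_sum:
  assumes "finite S"
  shows "L2inner M (\<lambda>x. \<Sum>n\<in>S. c n * u n x) (u m) = (if m \<in> S then c m else 0)"
proof -
  have "L2inner M (\<lambda>x. \<Sum>n\<in>S. c n * u n x) (u m) = (\<Sum>n\<in>S. if n = m then c n else 0)"
    using on by (subst L2inner_sum_left)
      (auto simp: L2_cmult orthonormal_L2 L2inner_cmult_left L2_orthonormal_def intro!: sum.cong)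
  then show ?thesis using assms by simp
qed

lemma L2norm_orthonormal_sum:
  assumes "finite S"
  shows "(L2norm M (\<lambda>x. \<Sum>n\<in>S. c n * u n x))\<^sup>2 = (\<Sum>n\<in>S. (cmod (c n))\<^sup>2)"
proof -
  let ?P = "\<lambda>x. \<Sum>n\<in>S. c n * u n x"
  have "of_real ((L2norm M ?P)\<^sup>2) = L2inner M ?P ?P" by (simp add: L2inner_self)
  also have "\<dots> = (\<Sum>n\<in>S. c n * L2inner M (u n) ?P)"
    by (subst L2inner_sum_left) (auto simp: L2_cmult orthonormal_L2 orthonormal_sum_L2 L2inner_cmult_left)
  also have "\<dots> = (\<Sum>n\<in>S. c n * cnj (c n))"
    by (intro sum.cong refl)
       (subst L2inner_commute, simp add: L2inner_orthonormal_sum[OF assms])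
  also have "\<dots> = of_real (\<Sum>n\<in>S. (cmod (c n))\<^sup>2)"
    by (simp only: of_real_sum complex_norm_square)
  finally show ?thesis by (simp only: of_real_eq_iff)
qed

text \<open>
  By orthonormality the norm of a partial sum over \<open>S - S0\<close> is the square root of a tail of the
  coefficient series.
\<close>

lemma Riesz_Fischer:
  assumes "(\<lambda>n. (cmod (c n))\<^sup>2) summable_on UNIV"
  obtains g where "L2_tendsto M (\<lambda>S x. \<Sum>n\<in>S. c n * u n x) g (finite_subsets_at_top UNIV)"
proof (rule L2_complete_finite_subsets[where P = "\<lambda>S x. \<Sum>n\<in>S. c n * u n x"])
  fix e :: real assume "0 < e"
  then have "0 < e\<^sup>2" by simp
  then obtain S0 where S0: "finite S0"
    "\<And>S. finite S \<Longrightarrow> S0 \<subseteq> S \<Longrightarrow> \<bar>\<Sum>n\<in>S - S0. (cmod (c n))\<^sup>2\<bar> \<le> e\<^sup>2"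
    by (rule summable_on_small_tail[OF assms]) auto
  have "L2norm M (\<lambda>x. (\<Sum>n\<in>S. c n * u n x) - (\<Sum>n\<in>S0. c n * u n x)) \<le> e"
    if S: "finite S" "S0 \<subseteq> S" for S
  proof (rule power2_le_imp_le)
    have "(L2norm M (\<lambda>x. (\<Sum>n\<in>S. c n * u n x) - (\<Sum>n\<in>S0. c n * u n x)))\<^sup>2
        = (\<Sum>n\<in>S - S0. (cmod (c n))\<^sup>2)"
      using S by (simp add: L2norm_orthonormal_sum flip: sum_diff)
    also have "\<dots> \<le> e\<^sup>2" using S0(2)[OF S] by simp
    finally show "(L2norm M (\<lambda>x. (\<Sum>n\<in>S. c n * u n x) - (\<Sum>n\<in>S0. c n * u n x)))\<^sup>2 \<le> e\<^sup>2" .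
  qed (use \<open>0 < e\<close> in simp)
  with S0(1) show "\<exists>S0. finite S0 \<and> (\<forall>S. finite S \<and> S0 \<subseteq> S \<longrightarrow>
      L2norm M (\<lambda>x. (\<Sum>n\<in>S. c n * u n x) - (\<Sum>n\<in>S0. c n * u n x)) \<le> e)" by blast
qed (auto intro: orthonormal_sum_L2 that)

text \<open>
  The inner product of \<open>f\<close> with its partial sum \<open>P\<close>, and the squared norm of \<open>P\<close>, are both the sum
  \<open>s\<close> on the left. Cauchy--Schwarz then reads \<open>s \<le> sqrt s * \<parallel>f\<parallel>\<close>.
\<close>

lemma Bessel_inequality:
  assumes f: "f \<in> L2 M" and S: "finite S"
  shows "(\<Sum>n\<in>S. (cmod (L2inner M f (u n)))\<^sup>2) \<le> (L2norm M f)\<^sup>2"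
proof -
  define P where "P x = (\<Sum>n\<in>S. L2inner M f (u n) * u n x)" for x
  define s where "s = (\<Sum>n\<in>S. (cmod (L2inner M f (u n)))\<^sup>2)"
  have PL: "P \<in> L2 M" unfolding P_def by (rule orthonormal_sum_L2)
  have Ps: "(L2norm M P)\<^sup>2 = s" unfolding P_def s_def by (rule L2norm_orthonormal_sum[OF S])
  have "0 \<le> s" by (simp add: s_def sum_nonneg)
  have "L2inner M P f = (\<Sum>n\<in>S. L2inner M f (u n) * L2inner M (u n) f)"
    unfolding P_def
    by (subst L2inner_sum_left) (auto simp: L2_cmult orthonormal_L2 f L2inner_cmult_left)
  also have "\<dots> = (\<Sum>n\<in>S. L2inner M f (u n) * cnj (L2inner M f (u n)))"
    by (subst (2) L2inner_commute) simp
  also have "\<dots> = of_real s" by (simp only: s_def of_real_sum complex_norm_square)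
  finally have "s \<le> L2norm M P * L2norm M f"
    using L2inner_Cauchy_Schwarz[OF PL f] \<open>0 \<le> s\<close> by simp
  then have "s\<^sup>2 \<le> s * (L2norm M f)\<^sup>2"
    using \<open>0 \<le> s\<close> Ps by (metis power_mono power_mult_distrib)
  then show ?thesis
    using \<open>0 \<le> s\<close> unfolding s_def[symmetric] by (cases "s = 0") (auto simp: power2_eq_square)
qed

lemma Bessel_summable:
  assumes "f \<in> L2 M" shows "(\<lambda>n. (cmod (L2inner M f (u n)))\<^sup>2) summable_on UNIV"
  by (rule nonneg_bdd_above_summable_on)
     (auto intro!: bdd_aboveI[where M = "(L2norm M f)\<^sup>2"] Bessel_inequality assms)

end

lemma L2_orthonormal_cnj:
  assumes "L2_orthonormal M u"
  shows "L2_orthonormal M (\<lambda>n x. cnj (u n x))"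
proof -
  have "L2inner M (\<lambda>x. cnj (u m x)) (\<lambda>x. cnj (u n x)) = L2inner M (u n) (u m)" for m n
    by (simp add: L2inner_def mult.commute)
  then show ?thesis using assms by (auto simp: L2_orthonormal_def L2_cnj)
qed

text \<open>
  The series converges to some \<open>g\<close> by Riesz--Fischer. Passing to the limit in inner products, \<open>g\<close> has
  the same coefficients as \<open>f\<close>, so \<open>g - f\<close> is orthogonal to the basis and vanishes.
\<close>

lemma orthonormal_basis_expansion:
  assumes u: "L2_orthonormal_basis M u" and f: "f \<in> L2 M"
  shows "L2_tendsto M (\<lambda>S x. \<Sum>n\<in>S. L2inner M f (u n) * u n x) f (finite_subsets_at_top UNIV)"
proof -
  have on: "L2_orthonormal M u" using u by (simp add: L2_orthonormal_basis_def)
  let ?P = "\<lambda>S x. \<Sum>n\<in>S. L2inner M f (u n) * u n x"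
  obtain g where g: "L2_tendsto M ?P g (finite_subsets_at_top UNIV)"
    by (rule Riesz_Fischer[OF on Bessel_summable[OF on f]])
  have gL: "g \<in> L2 M" by (rule L2_tendsto_in_L2[OF g])
  have "L2inner M g (u m) = L2inner M f (u m)" for m
  proof -
    have "((\<lambda>S. L2inner M (?P S) (u m)) \<longlongrightarrow> L2inner M g (u m)) (finite_subsets_at_top UNIV)"
      by (rule tendsto_L2inner[OF g orthonormal_L2[OF on]])
    moreover have "\<forall>\<^sub>F S in finite_subsets_at_top UNIV. L2inner M (?P S) (u m) = L2inner M f (u m)"
      unfolding eventually_finite_subsets_at_top
      by (intro exI[of _ "{m}"]) (simp add: L2inner_orthonormal_sum[OF on])
    then have "((\<lambda>S. L2inner M (?P S) (u m)) \<longlongrightarrow> L2inner M f (u m)) (finite_subsets_at_top UNIV)"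
      by (rule tendsto_eventually)
    ultimately show ?thesis using tendsto_unique finite_subsets_at_top_neq_bot by blast
  qed
  then have "\<forall>n. L2inner M (\<lambda>x. g x - f x) (u n) = 0"
    by (simp add: L2inner_diff_left[OF gL f orthonormal_L2[OF on]])
  then have "AE x in M. g x - f x = 0"
    using u L2_diff[OF gL f] unfolding L2_orthonormal_basis_def by blast
  then have "AE x in M. g x = f x" by simp
  with g L2_measurable[OF f] show ?thesis by (rule L2_tendsto_cong_AE)
qed

lemma Parseval:
  assumes u: "L2_orthonormal_basis M u" and f: "f \<in> L2 M"
  shows "((\<lambda>n. (cmod (L2inner M f (u n)))\<^sup>2) has_sum (L2norm M f)\<^sup>2) UNIV"
  unfolding has_sum_def
proof (rule Lim_transform_eventually)
  have on: "L2_orthonormal M u" using u by (simp add: L2_orthonormal_basis_def)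
  let ?P = "\<lambda>S x. \<Sum>n\<in>S. L2inner M f (u n) * u n x"
  show "((\<lambda>S. (L2norm M (?P S))\<^sup>2) \<longlongrightarrow> (L2norm M f)\<^sup>2) (finite_subsets_at_top UNIV)"
    by (intro tendsto_power tendsto_L2norm orthonormal_basis_expansion[OF u f])
  show "\<forall>\<^sub>F S in finite_subsets_at_top UNIV.
      (L2norm M (?P S))\<^sup>2 = (\<Sum>n\<in>S. (cmod (L2inner M f (u n)))\<^sup>2)"
    by (rule eventually_finite_subsets_at_top_weakI) (rule L2norm_orthonormal_sum[OF on])
qed

section \<open>Completeness of the exponentials on a period\<close>

text \<open>
  One period of the exponentials \<open>cis (b n x)\<close>. The left end \<open>c\<close> is free because two positions are
  needed: \<open>[0, \<Delta>]\<close> on the frequency side, and symmetric intervals on the time side in the proof of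
  Plancherel's identity.
\<close>

definition period_cell :: "real \<Rightarrow> real \<Rightarrow> real measure" where
  "period_cell c b = lebesgue_on {c..c + 2 * pi / \<bar>b\<bar>}"

lemma finite_measure_period_cell: "finite_measure (period_cell c b)"
  unfolding period_cell_def by (rule finite_measureI) (simp add: emeasure_restrict_space)

lemma measure_period_cell: "measure (period_cell c b) (space (period_cell c b)) = 2 * pi / \<bar>b\<bar>"
  unfolding period_cell_def by (simp add: measure_restrict_space)

lemma period_cell_measurable_continuous:
  "continuous_on UNIV f \<Longrightarrow> f \<in> borel_measurable (period_cell c b)"
  unfolding period_cell_def
  by (rule continuous_imp_measurable_on_sets_lebesgue[OF continuous_on_subset]) auto

lemma period_cell_L2_bounded:
  assumes f: "f \<in> borel_measurable (period_cell c b)" and "\<And>x. cmod (f x) \<le> C"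
  shows "f \<in> L2 (period_cell c b)"
proof -
  interpret finite_measure "period_cell c b" by (rule finite_measure_period_cell)
  have "(cmod (f x))\<^sup>2 \<le> C\<^sup>2" for x using assms(2)[of x] by (intro power_mono) auto
  then show ?thesis
    using f by (auto simp: L2_def intro!: integrable_const_bound[where B = "C\<^sup>2"])
qed

lemma period_cell_L2_integrable:
  assumes "f \<in> L2 (period_cell c b)" shows "integrable (period_cell c b) f"
  using L2_inner_integrable[OF assms, of "\<lambda>_. 1"] by (simp add: period_cell_L2_bounded[where C = 1])

lemma continuous_on_cis_linear: "continuous_on S (\<lambda>x. cis (w * x))"
  unfolding cis_conv_exp by (intro continuous_intros)

lemma cis_linear_L2: "(\<lambda>x. cis (w * x)) \<in> L2 (period_cell c b)"
  by (rule period_cell_L2_bounded[where C = 1])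
     (auto intro!: period_cell_measurable_continuous continuous_on_cis_linear)

lemma integral_cis_period:
  fixes k :: int
  assumes b: "b \<noteq> 0"
  shows "(LINT x|period_cell c b. cis (b * of_int k * x)) = (if k = 0 then of_real (2 * pi / \<bar>b\<bar>) else 0)"
proof (cases "k = 0")
  case True
  then show ?thesis by (simp add: measure_period_cell scaleR_conv_of_real)
next
  case False
  define w where "w = b * of_int k"
  have w: "w \<noteq> 0" using b False by (simp add: w_def)
  let ?d = "c + 2 * pi / \<bar>b\<bar>"
  have "((\<lambda>x. cis (w * x)) has_integral (cis (w * ?d) / (\<i> * w) - cis (w * c) / (\<i> * w))) {c..?d}"
  proof (rule fundamental_theorem_of_calculus)
    show "c \<le> ?d" by simp
    fix x assume "x \<in> {c..?d}"
    have "((\<lambda>x. exp (\<i> * of_real w * of_real x) / (\<i> * w)) has_vector_derivative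
        exp (\<i> * of_real w * of_real x)) (at x within {c..?d})"
      using w by (auto intro!: derivative_eq_intros has_vector_derivative_real_field)
    then show "((\<lambda>x. cis (w * x) / (\<i> * w)) has_vector_derivative cis (w * x)) (at x within {c..?d})"
      by (simp add: cis_conv_exp mult.assoc)
  qed
  moreover have "cis (w * ?d) = cis (w * c)"
  proof -
    have "w * ?d = w * c + 2 * pi * of_int (sgn k * (if b > 0 then \<bar>k\<bar> else - \<bar>k\<bar>))"
      using b by (auto simp: w_def field_simps abs_real_def simp flip: of_int_mult) (auto simp: sgn_if)
    then show ?thesis by (simp add: cis_mult[symmetric])
  qed
  ultimately have "((\<lambda>x. cis (w * x)) has_integral 0) {c..?d}" by simp
  then show ?thesis
    using False period_cell_L2_integrable[OF cis_linear_L2[of w c b]]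
    unfolding period_cell_def w_def[symmetric]
    by (simp add: lebesgue_integral_eq_integral integral_unique)
qed

definition fourier_basis :: "real \<Rightarrow> int \<Rightarrow> real \<Rightarrow> complex" where
  "fourier_basis b n x = cis (b * of_int n * x) / sqrt (2 * pi / \<bar>b\<bar>)"

lemma fourier_basis_L2: "fourier_basis b n \<in> L2 (period_cell c b)"
  using L2_cmult[OF cis_linear_L2[of "b * of_int n"], of "1 / sqrt (2 * pi / \<bar>b\<bar>)"]
  by (simp add: fourier_basis_def[abs_def])

lemma fourier_basis_orthonormal:
  assumes b: "b \<noteq> 0"
  shows "L2_orthonormal (period_cell c b) (fourier_basis b)"
proof -
  have "L2inner (period_cell c b) (fourier_basis b m) (fourier_basis b n) = (if m = n then 1 else 0)"
    for m n
  proof -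
    define T where "T = 2 * pi / \<bar>b\<bar>"
    have T: "0 < T" using b by (simp add: T_def)
    then have sq: "complex_of_real (sqrt T) * complex_of_real (sqrt T) = complex_of_real T"
      by (simp flip: of_real_mult)
    have "fourier_basis b m x * cnj (fourier_basis b n x) = cis (b * of_int (m - n) * x) * (1 / of_real T)"
      for x
    proof -
      have "fourier_basis b m x * cnj (fourier_basis b n x)
          = cis (b * of_int m * x) * cis (- (b * of_int n * x)) / (of_real (sqrt T) * of_real (sqrt T))"
        by (simp only: fourier_basis_def complex_cnj_divide cis_cnj complex_cnj_complex_of_real
            times_divide_times_eq T_def)
      also have "cis (b * of_int m * x) * cis (- (b * of_int n * x)) = cis (b * of_int (m - n) * x)"
        by (simp add: cis_mult algebra_simps)
      finally show ?thesis by (simp add: sq)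
    qed
    then have "L2inner (period_cell c b) (fourier_basis b m) (fourier_basis b n)
        = (LINT x|period_cell c b. cis (b * of_int (m - n) * x)) * (1 / of_real T)"
      unfolding L2inner_def by simp
    then show ?thesis using T unfolding integral_cis_period[OF b] T_def[symmetric] by simp
  qed
  then show ?thesis by (simp add: L2_orthonormal_def fourier_basis_L2)
qed

text \<open>
  Finite sums of exponentials, generated inductively so that closure under products and vanishing
  of integrals are proved by rule induction, without arithmetic of coefficient sequences.
\<close>

inductive trig_polynomial :: "real \<Rightarrow> (real \<Rightarrow> complex) \<Rightarrow> bool" for b where
  monomial: "trig_polynomial b (\<lambda>x. z * cis (b * of_int n * x))"
| add: "trig_polynomial b g \<Longrightarrow> trig_polynomial b h \<Longrightarrow> trig_polynomial b (\<lambda>x. g x + h x)"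

lemma trig_polynomial_mult_monomial:
  assumes "trig_polynomial b h"
  shows "trig_polynomial b (\<lambda>x. z * cis (b * of_int n * x) * h x)"
  using assms
proof induction
  case (monomial w m)
  have "(\<lambda>x. z * cis (b * of_int n * x) * (w * cis (b * of_int m * x)))
      = (\<lambda>x. z * w * cis (b * of_int (n + m) * x))"
    by (rule ext) (simp add: distrib_left distrib_right flip: cis_mult)
  then show ?case using trig_polynomial.monomial[of b "z * w" "n + m"] by simp
next
  case (add g h)
  then show ?case using trig_polynomial.add by (fastforce simp: distrib_left)
qed

lemma trig_polynomial_mult:
  assumes "trig_polynomial b g" "trig_polynomial b h"
  shows "trig_polynomial b (\<lambda>x. g x * h x)"
  using assms
proof induction
  case (add g g')
  then show ?case using trig_polynomial.add by (fastforce simp: distrib_right)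
qed (rule trig_polynomial_mult_monomial)

text \<open>
  On the unit circle a real-linear functional of \<open>cis t\<close> is a combination of \<open>cos t\<close> and \<open>sin t\<close>, hence
  of \<open>cis t\<close> and \<open>cis (-t)\<close>; sums and products follow.
\<close>

lemma trig_polynomial_of_real_polynomial:
  assumes "real_polynomial_function q"
  shows "trig_polynomial b (\<lambda>x. of_real (q (cis (b * x))))"
  using assms
proof induction
  case (linear l)
  have l: "l (cis t) = cos t * l 1 + sin t * l \<i>" for t
  proof -
    have "cis t = cos t *\<^sub>R 1 + sin t *\<^sub>R \<i>" by (simp add: complex_eq_iff)
    then show ?thesis
      using linear by (simp add: bounded_linear.linear linear_add linear_scale)
  qed
  have "of_real (l (cis (b * x)))
      = (l 1 / 2 + l \<i> / (2 * \<i>)) * cis (b * of_int 1 * x)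
        + (l 1 / 2 - l \<i> / (2 * \<i>)) * cis (b * of_int (-1) * x)" for x
    unfolding l by (simp add: complex_eq_iff)
  then show ?case
    using trig_polynomial.add[OF trig_polynomial.monomial[of b "l 1 / 2 + l \<i> / (2 * \<i>)" 1]
        trig_polynomial.monomial[of b "l 1 / 2 - l \<i> / (2 * \<i>)" "-1"]] by simp
next
  case (const z)
  then show ?case using trig_polynomial.monomial[of b z 0] by simp
qed (simp_all add: trig_polynomial.add trig_polynomial_mult)

text \<open>
  A function orthogonal to all exponentials is orthogonal to every function of \<open>cis (b x)\<close> that is
  continuous on the unit circle (Stone--Weierstrass), hence to indicators of compact sets, hence, by
  inner regularity, it has integral zero over every measurable set.
\<close>

context
  fixes b c :: real and f :: "real \<Rightarrow> complex"
  assumes b: "b \<noteq> 0"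
    and f: "f \<in> L2 (period_cell c b)"
    and orth: "\<And>n::int. (LINT x|period_cell c b. f x * cis (b * of_int n * x)) = 0"
begin

lemma orthogonal_measurable [measurable]: "f \<in> borel_measurable (period_cell c b)"
  using f by (rule L2_measurable)

lemma orthogonal_integrable: "integrable (period_cell c b) f"
  by (rule period_cell_L2_integrable[OF f])

lemma orthogonal_trig_polynomial:
  assumes "trig_polynomial b h"
  shows "integrable (period_cell c b) (\<lambda>x. f x * h x) \<and> (LINT x|period_cell c b. f x * h x) = 0"
  using assms
proof induction
  case (monomial z n)
  have "integrable (period_cell c b) (\<lambda>x. f x * cis (b * of_int n * x))"
    using L2_inner_integrable[OF f cis_linear_L2[of "- (b * of_int n)"]] by (simp add: cis_cnj)
  then show ?case
    using orth[of n] by (simp add: mult.left_commute)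
next
  case (add g h)
  then show ?case by (simp add: distrib_left)
qed

lemma orthogonal_continuous_circle:
  fixes \<psi> :: "complex \<Rightarrow> real"
  assumes \<psi>: "continuous_on UNIV \<psi>"
  shows "(LINT x|period_cell c b. f x * of_real (\<psi> (cis (b * x)))) = 0"
proof -
  define L where "L = (LINT x|period_cell c b. cmod (f x))"
  have "L \<ge> 0" by (simp add: L_def)
  have "norm (LINT x|period_cell c b. f x * of_real (\<psi> (cis (b * x)))) \<le> e" if "0 < e" for e
  proof -
    have e': "0 < e / (L + 1)" using that \<open>L \<ge> 0\<close> by simp
    have "continuous_on (sphere 0 1) \<psi>" using \<psi> continuous_on_subset by blast
    then obtain q where q: "real_polynomial_function q"
      "\<And>z. z \<in> sphere 0 1 \<Longrightarrow> \<bar>\<psi> z - q z\<bar> < e / (L + 1)"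
      using Stone_Weierstrass_real_polynomial_function[OF compact_sphere _ e'] by metis
    note t = orthogonal_trig_polynomial[OF trig_polynomial_of_real_polynomial[OF q(1)]]
    have m: "(\<lambda>x. f x * of_real (\<psi> (cis (b * x)) - q (cis (b * x)))) \<in> borel_measurable (period_cell c b)"
      by (intro borel_measurable_times orthogonal_measurable period_cell_measurable_continuous continuous_intros
          continuous_on_compose2[OF \<psi> continuous_on_cis_linear]
          continuous_on_compose2[OF continuous_on_polymonial_function continuous_on_cis_linear])
         (use q(1) in \<open>auto simp: real_polynomial_function_eq\<close>)
    have le: "norm (f x * of_real (\<psi> (cis (b * x)) - q (cis (b * x)))) \<le> cmod (f x) * (e / (L + 1))" for x
      unfolding norm_mult norm_of_real using q(2)[of "cis (b * x)"] by (intro mult_left_mono) auto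
    have i: "integrable (period_cell c b) (\<lambda>x. f x * of_real (\<psi> (cis (b * x)) - q (cis (b * x))))"
      by (rule Bochner_Integration.integrable_bound[OF integrable_mult_left[OF integrable_norm[OF orthogonal_integrable], of "e / (L + 1)"] m])
         (use le \<open>L \<ge> 0\<close> that in \<open>auto simp del: of_real_diff intro!: AE_I2 order_trans[OF le]\<close>)
    have "(LINT x|period_cell c b. f x * of_real (\<psi> (cis (b * x))))
        = (LINT x|period_cell c b. f x * of_real (\<psi> (cis (b * x)) - q (cis (b * x))) + f x * of_real (q (cis (b * x))))"
      by (rule Bochner_Integration.integral_cong) (simp_all add: algebra_simps)
    also have "\<dots> = (LINT x|period_cell c b. f x * of_real (\<psi> (cis (b * x)) - q (cis (b * x))))"
      using t i by (subst Bochner_Integration.integral_add) auto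
    also have "norm \<dots> \<le> (LINT x|period_cell c b. cmod (f x) * (e / (L + 1)))"
      using le by (intro order_trans[OF integral_norm_bound] integral_mono integrable_norm i
          integrable_mult_left integrable_norm orthogonal_integrable) auto
    also have "\<dots> = L * (e / (L + 1))" by (simp add: L_def)
    also have "\<dots> \<le> e" using that \<open>L \<ge> 0\<close> by (simp add: field_simps)
    finally show ?thesis .
  qed
  then have "norm (LINT x|period_cell c b. f x * of_real (\<psi> (cis (b * x)))) \<le> 0"
    by (rule field_le_epsilon[where y = 0, simplified])
  then show ?thesis by simp
qed

lemma cis_period_inj:
  assumes "x \<in> {c..<c + 2 * pi / \<bar>b\<bar>}" "y \<in> {c..<c + 2 * pi / \<bar>b\<bar>}" "cis (b * x) = cis (b * y)"
  shows "x = y"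
proof -
  have "cis (b * x - b * y) = 1" using assms(3) by (simp flip: cis_divide)
  then have "cos (b * x - b * y) = 1" by (simp add: complex_eq_iff)
  then obtain k :: int where k: "b * x - b * y = of_int k * 2 * pi"
    using cos_one_2pi_int by auto
  have "\<bar>x - y\<bar> < 2 * pi / \<bar>b\<bar>" using assms(1,2) by (auto simp: abs_real_def)
  then have "\<bar>b\<bar> * \<bar>x - y\<bar> < \<bar>b\<bar> * (2 * pi / \<bar>b\<bar>)"
    using b by (intro mult_strict_left_mono) auto
  then have "\<bar>b * x - b * y\<bar> < 2 * pi"
    using b by (simp add: right_diff_distrib[symmetric] abs_mult)
  then have "k = 0" unfolding k by (simp add: abs_mult)
  then show ?thesis using k b by simp
qed

text \<open>
  The indicator of \<open>K\<close> is approximated by cutoffs of the distance to the image of \<open>K\<close> on the circle.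
  They converge to the indicator at every point of the half-open period, where \<open>x \<mapsto> cis (b x)\<close> is
  injective; the right end of the cell is a null set.
\<close>

lemma orthogonal_compact:
  assumes K: "compact K" "K \<subseteq> {c..<c + 2 * pi / \<bar>b\<bar>}"
  shows "(LINT x|period_cell c b. f x * indicator K x) = 0"
proof (cases "K = {}")
  case False
  define K' where "K' = (\<lambda>x. cis (b * x)) ` K"
  have K': "closed K'" "K' \<noteq> {}"
    using False K(1) unfolding K'_def
    by (auto intro!: compact_imp_closed compact_continuous_image continuous_on_cis_linear)
  define g where "g m z = max 0 (1 - real m * infdist z K')" for m z
  have gc: "continuous_on UNIV (g m)" for m unfolding g_def by (intro continuous_intros)
  have "(\<lambda>m. LINT x|period_cell c b. f x * of_real (g m (cis (b * x))))
      \<longlonglongrightarrow> (LINT x|period_cell c b. f x * indicator K x)"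
  proof (rule integral_dominated_convergence[where w = "\<lambda>x. cmod (f x)"])
    have "K \<in> sets lebesgue" using K(1) by (simp add: compact_imp_closed lmeasurable_compact fmeasurableD)
    then have "{x \<in> space (period_cell c b). x \<in> K} \<in> sets (period_cell c b)"
      unfolding period_cell_def by (auto simp: sets_restrict_space)
    then have "(indicator K :: real \<Rightarrow> complex) \<in> borel_measurable (period_cell c b)"
      by (simp add: borel_measurable_indicator_iff Int_def conj_commute)
    then show "(\<lambda>x. f x * indicator K x) \<in> borel_measurable (period_cell c b)"
      by (intro borel_measurable_times orthogonal_measurable)
    show "(\<lambda>x. f x * of_real (g m (cis (b * x)))) \<in> borel_measurable (period_cell c b)" for m
      by (intro borel_measurable_times orthogonal_measurable period_cell_measurable_continuous continuous_intros
          continuous_on_compose2[OF gc continuous_on_cis_linear]) auto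
    show "integrable (period_cell c b) (\<lambda>x. cmod (f x))" using orthogonal_integrable by simp
    have "\<bar>g m z\<bar> \<le> 1" for m z by (auto simp: g_def infdist_nonneg)
    then show "AE x in period_cell c b. norm (f x * of_real (g m (cis (b * x)))) \<le> cmod (f x)" for m
      by (intro AE_I2) (simp add: norm_mult mult_left_le)
    have "AE x in lebesgue. x \<notin> {c + 2 * pi / \<bar>b\<bar>}"
      by (rule AE_not_in) (auto simp flip: negligible_iff_null_sets)
    then have "AE x in period_cell c b. x < c + 2 * pi / \<bar>b\<bar>"
      unfolding period_cell_def by (subst AE_restrict_space_iff) (auto elim!: eventually_mono)
    moreover have "AE x in period_cell c b. c \<le> x"
      by (rule AE_I2) (simp add: period_cell_def)
    ultimately show "AE x in period_cell c b.
        (\<lambda>m. f x * of_real (g m (cis (b * x)))) \<longlonglongrightarrow> f x * indicator K x"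
    proof eventually_elim
      case (elim x)
      have "(\<lambda>m. g m (cis (b * x))) \<longlonglongrightarrow> indicator K x"
      proof (cases "x \<in> K")
        case True
        then have "cis (b * x) \<in> K'" by (simp add: K'_def)
        then show ?thesis using True by (simp add: g_def)
      next
        case xK: False
        then have "cis (b * x) \<notin> K'"
          using cis_period_inj elim K(2) by (auto simp: K'_def) (metis atLeastLessThan_iff subsetD)
        then have pos: "0 < infdist (cis (b * x)) K'" by (rule infdist_pos_not_in_closed[OF K'])
        then obtain n :: nat where n: "1 < of_nat n * infdist (cis (b * x)) K'"
          using reals_Archimedean3 by blast
        have "g m (cis (b * x)) = 0" if "m \<ge> n" for m
        proof -
          have "real n * infdist (cis (b * x)) K' \<le> real m * infdist (cis (b * x)) K'"
            using that pos by (intro mult_right_mono) auto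
          then show ?thesis using n by (simp add: g_def)
        qed
        then have "\<forall>\<^sub>F m in sequentially. g m (cis (b * x)) = 0"
          by (auto simp: eventually_sequentially)
        then show ?thesis using xK by (simp add: tendsto_eventually)
      qed
      from tendsto_mult[OF tendsto_const[of "f x"] tendsto_of_real[OF this, where 'a = complex]]
      show ?case by (cases "x \<in> K") simp_all
    qed
  qed
  moreover have "(LINT x|period_cell c b. f x * of_real (g m (cis (b * x)))) = 0" for m
    by (rule orthogonal_continuous_circle[OF gc])
  ultimately show ?thesis by (simp add: LIMSEQ_const_iff)
qed simp

lemma cnj_indicator: "cnj (indicator A x) = indicator A x"
  by (simp add: indicator_def)

text \<open>
  Inner regularity leaves a remainder \<open>A' - K\<close> of small measure, over which the integral of \<open>f\<close> is
  small by Cauchy--Schwarz. Removing the right end of the cell makes the sets \<open>K\<close> fit into the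
  half-open period.
\<close>

lemma orthogonal_measurable_set:
  assumes A: "A \<in> sets (period_cell c b)"
  shows "(LINT x|period_cell c b. f x * indicator A x) = 0"
proof -
  define T where "T = c + 2 * pi / \<bar>b\<bar>"
  define A' where "A' = A \<inter> {c..<T}"
  have "A \<in> sets lebesgue" "A \<subseteq> {c..T}"
    using A by (auto simp: period_cell_def T_def sets_restrict_space)
  then have A'm: "A' \<in> sets lebesgue" and sub: "A - A' \<subseteq> {T}" by (auto simp: A'_def)
  have cellI: "X \<in> sets (period_cell c b)" if "X \<in> sets lebesgue" "X \<subseteq> {c..T}" for X
    using that by (auto simp: period_cell_def T_def[symmetric] sets_restrict_space)
  have A'c: "A' \<in> sets (period_cell c b)" by (rule cellI[OF A'm]) (auto simp: A'_def)
  have ind: "indicator X \<in> L2 (period_cell c b)" if "X \<in> sets (period_cell c b)" for X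
    by (rule period_cell_L2_bounded[where C = 1, OF borel_measurable_indicator[OF that]])
       (simp add: indicator_def)
  have le: "norm (LINT x|period_cell c b. f x * indicator A' x) \<le> L2norm (period_cell c b) f * e"
    if e: "0 < e" for e
  proof -
    obtain K where K: "closed K" "K \<subseteq> A'" "A' - K \<in> lmeasurable"
      "emeasure lebesgue (A' - K) < ennreal (e\<^sup>2)"
      using sets_lebesgue_inner_closed[OF A'm, of "e\<^sup>2"] e by auto
    have "K \<subseteq> {c..T}" using K(2) by (auto simp: A'_def)
    then have "bounded K" by (rule bounded_subset[OF bounded_closed_interval])
    with K have "compact K" by (simp add: compact_eq_bounded_closed)
    have Kc: "K \<in> sets (period_cell c b)" "A' - K \<in> sets (period_cell c b)"
    proof -
      show "K \<in> sets (period_cell c b)"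
        using K(1) \<open>K \<subseteq> {c..T}\<close> by (intro cellI) auto
      have "A' - K \<subseteq> {c..T}" by (auto simp: A'_def)
      then show "A' - K \<in> sets (period_cell c b)" by (rule cellI[OF fmeasurableD[OF K(3)]])
    qed
    have i: "integrable (period_cell c b) (\<lambda>x. f x * indicator X x)" if "X \<in> sets (period_cell c b)" for X
      using L2_inner_integrable[OF f ind[OF that]] by (simp add: cnj_indicator)
    have "f x * indicator A' x = f x * indicator K x + f x * indicator (A' - K) x" for x
      by (cases "x \<in> K"; cases "x \<in> A'") (use K(2) in auto)
    then have "(LINT x|period_cell c b. f x * indicator A' x)
        = (LINT x|period_cell c b. f x * indicator K x + f x * indicator (A' - K) x)"
      by simp
    also have "\<dots> = (LINT x|period_cell c b. f x * indicator K x)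
        + (LINT x|period_cell c b. f x * indicator (A' - K) x)"
      by (rule Bochner_Integration.integral_add[OF i[OF Kc(1)] i[OF Kc(2)]])
    also have "\<dots> = (LINT x|period_cell c b. f x * indicator (A' - K) x)"
    proof -
      have "K \<subseteq> {c..<T}" using K(2) by (auto simp: A'_def)
      from orthogonal_compact[OF \<open>compact K\<close> this[unfolded T_def]] show ?thesis by simp
    qed
    also have "\<dots> = L2inner (period_cell c b) f (indicator (A' - K))"
      by (simp add: L2inner_def cnj_indicator)
    also have "norm \<dots> \<le> L2norm (period_cell c b) f * L2norm (period_cell c b) (indicator (A' - K))"
      by (rule L2inner_Cauchy_Schwarz[OF f ind[OF Kc(2)]])
    also have "\<dots> \<le> L2norm (period_cell c b) f * e"
    proof (intro mult_left_mono L2_I_nn(2))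
      have "(\<integral>\<^sup>+x. ennreal ((cmod (indicator (A' - K) x))\<^sup>2) \<partial>period_cell c b)
          = (\<integral>\<^sup>+x. indicator (A' - K) x \<partial>period_cell c b)"
        by (intro nn_integral_cong) (simp add: indicator_def)
      also have "\<dots> = emeasure (period_cell c b) (A' - K)" using Kc(2) by simp
      also have "\<dots> = emeasure lebesgue (A' - K)"
        unfolding period_cell_def T_def[symmetric]
        by (rule emeasure_restrict_space) (auto simp: A'_def)
      finally show "(\<integral>\<^sup>+x. ennreal ((cmod (indicator (A' - K) x))\<^sup>2) \<partial>period_cell c b) \<le> ennreal (e\<^sup>2)"
        using K(4) by simp
    qed (simp_all add: L2_measurable[OF ind[OF Kc(2)]] less_imp_le[OF e])
    finally show ?thesis .
  qed
  have "norm (LINT x|period_cell c b. f x * indicator A' x) \<le> 0 + e" if e: "0 < e" for e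
  proof -
    define L where "L = L2norm (period_cell c b) f"
    have L: "0 \<le> L" by (simp add: L_def)
    have "norm (LINT x|period_cell c b. f x * indicator A' x) \<le> L * (e / (L + 1))"
      unfolding L_def by (rule le) (use e L in \<open>simp add: L_def add_nonneg_pos\<close>)
    also have "\<dots> \<le> 0 + e" using e L by (simp add: field_simps)
    finally show ?thesis .
  qed
  then have "norm (LINT x|period_cell c b. f x * indicator A' x) \<le> 0" by (rule field_le_epsilon)
  then have "(LINT x|period_cell c b. f x * indicator A' x) = 0" by simp
  moreover have "(LINT x|period_cell c b. f x * indicator A x) = (LINT x|period_cell c b. f x * indicator A' x)"
  proof (rule integral_cong_AE)
    have "AE x in lebesgue. x \<notin> {T}"
      by (rule AE_not_in) (auto simp flip: negligible_iff_null_sets)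
    then have "AE x in lebesgue. f x * indicator A x = f x * indicator A' x"
    proof eventually_elim
      case (elim x)
      then have "x \<in> A \<longleftrightarrow> x \<in> A'" using sub by (auto simp: A'_def)
      then show ?case by (simp add: indicator_def)
    qed
    then show "AE x in period_cell c b. f x * indicator A x = f x * indicator A' x"
      unfolding period_cell_def by (subst AE_restrict_space_iff) (auto elim!: eventually_mono)
  qed (intro borel_measurable_times orthogonal_measurable borel_measurable_indicator A A'c)+
  ultimately show ?thesis by simp
qed

lemma orthogonal_imp_zero: "AE x in period_cell c b. f x = 0"
proof -
  have i: "integrable (period_cell c b) (\<lambda>x. f x * indicator A x)" if "A \<in> sets (period_cell c b)" for A
  proof (rule Bochner_Integration.integrable_bound[OF orthogonal_integrable])
    show "(\<lambda>x. f x * indicator A x) \<in> borel_measurable (period_cell c b)"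
      by (intro borel_measurable_times orthogonal_measurable borel_measurable_indicator that)
  qed (auto simp: norm_mult indicator_def)
  have "AE x in period_cell c b. Re (f x) = 0"
  proof (rule density_unique_real)
    fix A assume A: "A \<in> sets (period_cell c b)"
    have "(LINT x:A|period_cell c b. Re (f x)) = (LINT x|period_cell c b. Re (f x * indicator A x))"
      unfolding set_lebesgue_integral_def
      by (intro Bochner_Integration.integral_cong) (auto simp: indicator_def)
    also have "\<dots> = Re (LINT x|period_cell c b. f x * indicator A x)"
      by (rule Bochner_Integration.integral_Re[OF i[OF A]])
    finally show "(LINT x:A|period_cell c b. Re (f x)) = (LINT x:A|period_cell c b. 0)"
      by (simp add: orthogonal_measurable_set[OF A])
  qed (use orthogonal_integrable in auto)
  moreover have "AE x in period_cell c b. Im (f x) = 0"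
  proof (rule density_unique_real)
    fix A assume A: "A \<in> sets (period_cell c b)"
    have "(LINT x:A|period_cell c b. Im (f x)) = (LINT x|period_cell c b. Im (f x * indicator A x))"
      unfolding set_lebesgue_integral_def
      by (intro Bochner_Integration.integral_cong) (auto simp: indicator_def)
    also have "\<dots> = Im (LINT x|period_cell c b. f x * indicator A x)"
      by (rule Bochner_Integration.integral_Im[OF i[OF A]])
    finally show "(LINT x:A|period_cell c b. Im (f x)) = (LINT x:A|period_cell c b. 0)"
      by (simp add: orthogonal_measurable_set[OF A])
  qed (use orthogonal_integrable in auto)
  ultimately show ?thesis by eventually_elim (simp add: complex_eq_iff)
qed

end

theorem fourier_basis_complete:
  assumes b: "b \<noteq> 0"
  shows "L2_orthonormal_basis (period_cell c b) (fourier_basis b)"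
  unfolding L2_orthonormal_basis_def
proof (intro conjI ballI impI fourier_basis_orthonormal[OF b])
  fix f assume f: "f \<in> L2 (period_cell c b)"
    and 0: "\<forall>n. L2inner (period_cell c b) f (fourier_basis b n) = 0"
  have "(LINT x|period_cell c b. f x * cis (b * of_int n * x)) = 0" for n :: int
  proof -
    have "L2inner (period_cell c b) f (fourier_basis b (- n))
        = (LINT x|period_cell c b. f x * cis (b * of_int n * x) * (1 / of_real (sqrt (2 * pi / \<bar>b\<bar>))))"
      unfolding L2inner_def fourier_basis_def
      by (intro Bochner_Integration.integral_cong refl) (simp add: cis_cnj)
    also have "\<dots> = (LINT x|period_cell c b. f x * cis (b * of_int n * x)) * (1 / of_real (sqrt (2 * pi / \<bar>b\<bar>)))"
      by (rule integral_mult_left_zero)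
    finally show ?thesis using 0 b by simp
  qed
  with b f show "AE x in period_cell c b. f x = 0" by (rule orthogonal_imp_zero)
qed

section \<open>Periodization and the Fourier kernel\<close>

lemma sets_lebesgue_of_borel: "A \<in> sets borel \<Longrightarrow> A \<in> sets lebesgue"
  by (simp add: sets_completionI_sets)

lemma lebesgue_measurable_shift:
  assumes "f \<in> borel_measurable lebesgue" shows "(\<lambda>x. f (x + a :: real)) \<in> borel_measurable lebesgue"
proof -
  have "(\<lambda>x::real. a + x) \<in> lebesgue \<rightarrow>\<^sub>M lebesgue"
    using lebesgue_affine_measurable[of "\<lambda>_. 1" a] by simp
  from measurable_compose[OF this assms] show ?thesis by (simp add: add.commute)
qed

lemma nn_integral_lebesgue_shift:
  assumes "f \<in> borel_measurable lebesgue"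
  shows "(\<integral>\<^sup>+x. f (x + a :: real) \<partial>lebesgue) = (\<integral>\<^sup>+x. f x \<partial>lebesgue)"
  using nn_integral_real_affine_lebesgue[OF assms, of 1 a] by (simp add: add.commute)

text \<open>
  Integration commutes with countable sums in the form \<open>nn_integral_suminf\<close>, which is about series
  indexed by the natural numbers; this transfers it to sums over the integers.
\<close>

lemma infsum_int_eq_suminf:
  fixes f :: "int \<Rightarrow> ennreal"
  shows "(\<Sum>\<^sub>\<infinity>n. f n) = (\<Sum>k. f (int_decode k))"
proof -
  have "(\<Sum>\<^sub>\<infinity>n. f n) = (\<Sum>\<^sub>\<infinity>k. f (int_decode k))"
    using infsum_reindex_bij_betw[OF bij_int_decode, of f] by simp
  also have "\<dots> = (\<Sum>k. f (int_decode k))"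
    by (intro sums_unique has_sum_imp_sums has_sum_infsum nonneg_summable_on_complete) simp
  finally show ?thesis .
qed

lemma infsum_ennreal_of_has_sum:
  fixes f :: "'i \<Rightarrow> real"
  assumes "(f has_sum s) A" "\<And>n. 0 \<le> f n"
  shows "(\<Sum>\<^sub>\<infinity>n\<in>A. ennreal (f n)) = ennreal s"
proof (rule infsumI)
  have "((\<lambda>S. ennreal (sum f S)) \<longlongrightarrow> ennreal s) (finite_subsets_at_top A)"
    using assms(1) unfolding has_sum_def by (rule tendsto_ennrealI)
  moreover have "(\<lambda>S. ennreal (sum f S)) = sum (\<lambda>n. ennreal (f n))"
    by (rule ext) (simp add: sum_ennreal assms(2))
  ultimately show "((\<lambda>n. ennreal (f n)) has_sum ennreal s) A"
    unfolding has_sum_def by simp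
qed

lemma floor_cell:
  fixes x :: real
  assumes "0 < \<delta>"
  shows "x \<in> {of_int n * \<delta>..<of_int n * \<delta> + \<delta>} \<longleftrightarrow> n = \<lfloor>x / \<delta>\<rfloor>"
proof -
  have "n = \<lfloor>x / \<delta>\<rfloor> \<longleftrightarrow> of_int n \<le> x / \<delta> \<and> x / \<delta> < of_int n + 1"
    by (subst eq_commute) (rule floor_eq_iff)
  also have "\<dots> \<longleftrightarrow> x \<in> {of_int n * \<delta>..<of_int n * \<delta> + \<delta>}"
    using assms by (simp add: field_simps)
  finally show ?thesis by simp
qed

text \<open>
  The half-open intervals of length \<open>\<delta>\<close> starting at multiples of \<open>\<delta>\<close> tile the line, and each is a
  translate of the first.
\<close>

lemma nn_integral_periodization:
  fixes h :: "real \<Rightarrow> ennreal"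
  assumes h: "h \<in> borel_measurable lebesgue" and \<delta>: "0 < \<delta>"
  shows "(\<integral>\<^sup>+x. h x \<partial>lebesgue) = (\<integral>\<^sup>+s. (\<Sum>\<^sub>\<infinity>n::int. h (s + of_int n * \<delta>)) \<partial>lebesgue_on {0..\<delta>})"
proof -
  define C where "C n = {of_int n * \<delta>..<of_int n * \<delta> + \<delta>}" for n :: int
  have [measurable]: "C n \<in> sets lebesgue" for n unfolding C_def by (intro sets_lebesgue_of_borel) simp
  note [measurable] = h lebesgue_measurable_shift[OF h]
  have "h x = (\<Sum>\<^sub>\<infinity>n. h x * indicator (C n) x)" for x
  proof -
    have "(\<Sum>\<^sub>\<infinity>n. h x * indicator (C n) x) = (\<Sum>\<^sub>\<infinity>n\<in>{\<lfloor>x / \<delta>\<rfloor>}. h x * indicator (C n) x)"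
      by (rule infsum_cong_neutral) (auto simp: C_def floor_cell[OF \<delta>] simp del: atLeastLessThan_iff)
    also have "\<dots> = h x" by (simp add: C_def floor_cell[OF \<delta>] del: atLeastLessThan_iff)
    finally show ?thesis by simp
  qed
  then have "h x = (\<Sum>k. h x * indicator (C (int_decode k)) x)" for x
    unfolding infsum_int_eq_suminf .
  then have "(\<integral>\<^sup>+x. h x \<partial>lebesgue) = (\<integral>\<^sup>+x. (\<Sum>k. h x * indicator (C (int_decode k)) x) \<partial>lebesgue)"
    by (rule nn_integral_cong)
  also have "\<dots> = (\<Sum>k. \<integral>\<^sup>+x. h x * indicator (C (int_decode k)) x \<partial>lebesgue)"
    by (rule nn_integral_suminf) measurable
  also have "\<dots> = (\<Sum>k. \<integral>\<^sup>+s. h (s + of_int (int_decode k) * \<delta>) * indicator {0..<\<delta>} s \<partial>lebesgue)"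
  proof (intro suminf_cong)
    fix k
    define n where "n = int_decode k"
    have "(\<integral>\<^sup>+x. h x * indicator (C n) x \<partial>lebesgue)
        = (\<integral>\<^sup>+s. h (s + of_int n * \<delta>) * indicator (C n) (s + of_int n * \<delta>) \<partial>lebesgue)"
      by (rule nn_integral_lebesgue_shift[symmetric]) measurable
    also have "\<dots> = (\<integral>\<^sup>+s. h (s + of_int n * \<delta>) * indicator {0..<\<delta>} s \<partial>lebesgue)"
      by (intro nn_integral_cong) (simp add: C_def indicator_def)
    finally show "(\<integral>\<^sup>+x. h x * indicator (C (int_decode k)) x \<partial>lebesgue)
        = (\<integral>\<^sup>+s. h (s + of_int (int_decode k) * \<delta>) * indicator {0..<\<delta>} s \<partial>lebesgue)"
      by (simp add: n_def)
  qed
  also have "\<dots> = (\<integral>\<^sup>+s. (\<Sum>k. h (s + of_int (int_decode k) * \<delta>) * indicator {0..<\<delta>} s) \<partial>lebesgue)"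
    by (intro nn_integral_suminf[symmetric] borel_measurable_times_ennreal lebesgue_measurable_shift h
        borel_measurable_indicator sets_lebesgue_of_borel) simp
  also have "\<dots> = (\<integral>\<^sup>+s. (\<Sum>k. h (s + of_int (int_decode k) * \<delta>)) * indicator {0..\<delta>} s \<partial>lebesgue)"
  proof (rule nn_integral_cong_AE)
    have "AE s in lebesgue. s \<notin> {\<delta>}"
      by (rule AE_not_in) (auto simp flip: negligible_iff_null_sets)
    then show "AE s in lebesgue. (\<Sum>k. h (s + of_int (int_decode k) * \<delta>) * indicator {0..<\<delta>} s)
        = (\<Sum>k. h (s + of_int (int_decode k) * \<delta>)) * indicator {0..\<delta>} s"
      by eventually_elim (auto simp: indicator_def)
  qed
  also have "\<dots> = (\<integral>\<^sup>+s. (\<Sum>\<^sub>\<infinity>n::int. h (s + of_int n * \<delta>)) \<partial>lebesgue_on {0..\<delta>})"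
    unfolding infsum_int_eq_suminf by (subst nn_integral_restrict_space) auto
  finally show ?thesis .
qed

lemma cmod_chirp [simp]: "cmod (chirp \<theta> x) = 1"
  by (simp add: chirp_def)

lemma continuous_on_chirp: "continuous_on S (chirp \<theta>)"
  unfolding chirp_def[abs_def] by (intro continuous_intros)

lemma borel_measurable_lebesgue_continuous:
  "continuous_on UNIV f \<Longrightarrow> f \<in> borel_measurable lebesgue"
  using continuous_imp_measurable_on_sets_lebesgue[of UNIV f] by simp

lemma chirp_measurable: "chirp \<theta> \<in> borel_measurable lebesgue"
  by (rule borel_measurable_lebesgue_continuous[OF continuous_on_chirp])

lemma frft_kernel_eq:
  "frft_kernel \<theta> t \<xi> = frft_const \<theta> * chirp \<theta> t * chirp \<theta> \<xi> * cis (- (frft_b \<theta> * t * \<xi>))"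
  by (simp add: frft_kernel_def chirp_def cis_conv_exp algebra_simps flip: exp_add)

lemma cmod_frft_kernel: "cmod (frft_kernel \<theta> t \<xi>) = cmod (frft_const \<theta>)"
  by (simp add: frft_kernel_eq norm_mult)

lemma cmod_frft_const:
  assumes "sin \<theta> \<noteq> 0"
  shows "(cmod (frft_const \<theta>))\<^sup>2 = \<bar>frft_b \<theta>\<bar> / (2 * pi)"
proof -
  have "(cmod (frft_const \<theta>))\<^sup>2 = cmod ((1 - \<i> * of_real (cot \<theta>)) / of_real (2 * pi))"
    unfolding frft_const_def norm_power[symmetric] by simp
  also have "\<dots> = cmod (1 - \<i> * of_real (cot \<theta>)) / (2 * pi)"
    unfolding norm_divide norm_of_real by simp
  also have "cmod (1 - \<i> * of_real (cot \<theta>)) = sqrt (1 + (cot \<theta>)\<^sup>2)"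
    by (simp add: cmod_def)
  also have "1 + (cot \<theta>)\<^sup>2 = (frft_b \<theta>)\<^sup>2"
    using assms by (simp add: cot_def frft_b_def power_divide field_simps)
  finally show ?thesis by simp
qed

lemma continuous_on_frft_kernel: "continuous_on S (\<lambda>\<xi>. frft_kernel \<theta> t \<xi>)"
  unfolding frft_kernel_def by (intro continuous_intros)

lemma continuous_on_frft_kernel': "continuous_on S (\<lambda>t. frft_kernel \<theta> t \<xi>)"
  unfolding frft_kernel_def by (intro continuous_intros)

text \<open>
  The transform as an absolutely convergent integral; for integrable \<open>f\<close> only.
\<close>

definition frft_int :: "real \<Rightarrow> (real \<Rightarrow> complex) \<Rightarrow> real \<Rightarrow> complex" where
  "frft_int \<theta> f \<xi> = (LINT t|lebesgue. f t * frft_kernel \<theta> t \<xi>)"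

lemma frft_int_integrable:
  assumes "integrable lebesgue f"
  shows "integrable lebesgue (\<lambda>t. f t * frft_kernel \<theta> t \<xi>)"
proof (rule Bochner_Integration.integrable_bound)
  show "integrable lebesgue (\<lambda>t. cmod (f t) * cmod (frft_const \<theta>))"
    by (intro integrable_mult_left integrable_norm assms)
  show "(\<lambda>t. f t * frft_kernel \<theta> t \<xi>) \<in> borel_measurable lebesgue"
    by (intro borel_measurable_times borel_measurable_integrable[OF assms]
        borel_measurable_lebesgue_continuous continuous_on_frft_kernel')
qed (simp add: norm_mult cmod_frft_kernel)

lemma frft_int_measurable:
  assumes "integrable lebesgue f"
  shows "frft_int \<theta> f \<in> borel_measurable lebesgue"
proof (rule borel_measurable_lebesgue_continuous)
  have "isCont (frft_int \<theta> f) \<xi>" for \<xi>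
  proof (rule continuous_at_sequentiallyI)
    fix u :: "nat \<Rightarrow> real" assume u: "u \<longlonglongrightarrow> \<xi>"
    show "(\<lambda>n. frft_int \<theta> f (u n)) \<longlonglongrightarrow> frft_int \<theta> f \<xi>"
      unfolding frft_int_def
    proof (rule integral_dominated_convergence[where w = "\<lambda>t. cmod (f t) * cmod (frft_const \<theta>)"])
      have "isCont (\<lambda>\<xi>. frft_kernel \<theta> t \<xi>) \<xi>" for t
        using continuous_on_frft_kernel[of UNIV \<theta> t] by (simp add: continuous_on_eq_continuous_at)
      from tendsto_mult[OF tendsto_const isCont_tendsto_compose[OF this u]]
      show "AE t in lebesgue. (\<lambda>n. f t * frft_kernel \<theta> t (u n)) \<longlonglongrightarrow> f t * frft_kernel \<theta> t \<xi>"
        by (intro AE_I2)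
      show "integrable lebesgue (\<lambda>t. cmod (f t) * cmod (frft_const \<theta>))"
        by (intro integrable_mult_left integrable_norm assms)
    qed (auto intro: borel_measurable_integrable frft_int_integrable[OF assms] simp: norm_mult cmod_frft_kernel)
  qed
  then show "continuous_on UNIV (frft_int \<theta> f)" by (simp add: continuous_at_imp_continuous_on)
qed

lemma L2_compact_support_integrable:
  fixes f :: "real \<Rightarrow> complex"
  assumes f: "f \<in> L2 lebesgue" and R: "\<And>t. R < \<bar>t\<bar> \<Longrightarrow> f t = 0"
  shows "integrable lebesgue f"
proof -
  have "(indicator {-R..R} :: real \<Rightarrow> complex) \<in> L2 lebesgue"
  proof (rule L2_I_nn_less)
    have "(\<integral>\<^sup>+t. ennreal ((cmod (indicator {-R..R} t))\<^sup>2) \<partial>lebesgue)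
        = (\<integral>\<^sup>+t. indicator {-R..R} t \<partial>lebesgue)"
      by (intro nn_integral_cong) (simp add: indicator_def)
    also have "\<dots> = emeasure lebesgue {-R..R}"
      by (intro nn_integral_indicator sets_lebesgue_of_borel borel_closed closed_atLeastAtMost)
    also have "\<dots> < \<infinity>" by (simp add: emeasure_lborel_Icc_eq)
    finally show "(\<integral>\<^sup>+t. ennreal ((cmod (indicator {-R..R} t))\<^sup>2) \<partial>lebesgue) < \<infinity>" .
  qed (intro borel_measurable_indicator sets_lebesgue_of_borel borel_closed
      closed_atLeastAtMost)
  from L2_inner_integrable[OF f this]
  show ?thesis
  proof (rule Bochner_Integration.integrable_cong[THEN iffD1, rotated -1])
    show "f t * cnj (indicator {-R..R} t) = f t" for t
      using R[of t] by (cases "R < \<bar>t\<bar>") (auto simp: indicator_def)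
  qed simp
qed

section \<open>Plancherel for the fractional Fourier transform\<close>

lemma frft_b_nonzero: "sin \<theta> \<noteq> 0 \<Longrightarrow> frft_b \<theta> \<noteq> 0"
  by (simp add: frft_b_def)

lemma nn_integral_square_restrict:
  assumes S: "S \<in> sets lebesgue" and 0: "\<And>t. t \<notin> S \<Longrightarrow> f t = 0"
  shows "(\<integral>\<^sup>+t. ennreal ((cmod (f t))\<^sup>2) \<partial>lebesgue_on S) = (\<integral>\<^sup>+t. ennreal ((cmod (f t))\<^sup>2) \<partial>lebesgue)"
  by (subst nn_integral_restrict_space) (use S in \<open>auto simp: indicator_def 0 intro!: nn_integral_cong\<close>)

lemma integral_lebesgue_on_support:
  fixes f :: "real \<Rightarrow> complex"
  assumes S: "S \<in> sets lebesgue" and 0: "\<And>t. t \<notin> S \<Longrightarrow> f t = 0"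
  shows "(LINT t|lebesgue_on S. f t) = (LINT t|lebesgue. f t)"
  by (subst integral_restrict_space)
     (use S in \<open>auto simp: indicator_def 0 intro!: Bochner_Integration.integral_cong\<close>)

text \<open>
  Let \<open>f\<close> live on \<open>[-r, r]\<close>, put \<open>T = 2 r\<close>, and sample the transform at the points \<open>s + n \<delta>\<close> with
  \<open>\<delta> = 2 \<pi> / (\<bar>b\<bar> T)\<close>. Up to a factor of modulus \<open>\<bar>c\<bar> sqrt T\<close> the samples are the Fourier
  coefficients, on a period of length \<open>T\<close>, of a function \<open>g\<close> with \<open>\<bar>g\<bar> = \<bar>f\<bar>\<close>. By Parseval the sum of their
  squares is \<open>\<bar>c\<bar>\<^sup>2 T \<parallel>f\<parallel>\<^sup>2\<close> for every \<open>s\<close>. Integrating over \<open>s\<close> in \<open>[0, \<delta>]\<close> recovers the integral over the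
  line, and \<open>\<bar>c\<bar>\<^sup>2 T \<delta> = 1\<close>.
\<close>

lemma Plancherel_compact_support_nn:
  fixes f :: "real \<Rightarrow> complex"
  assumes s: "sin \<theta> \<noteq> 0" and f: "f \<in> L2 lebesgue" and supp: "\<And>t. R < \<bar>t\<bar> \<Longrightarrow> f t = 0"
  shows "(\<integral>\<^sup>+\<xi>. ennreal ((cmod (frft_int \<theta> f \<xi>))\<^sup>2) \<partial>lebesgue) = ennreal ((L2norm lebesgue f)\<^sup>2)"
proof -
  define c b where "c = frft_const \<theta>" and "b = frft_b \<theta>"
  have b: "b \<noteq> 0" using s by (simp add: b_def frft_b_nonzero)
  \<comment> \<open>The maximum keeps the period positive for every \<open>R\<close>.\<close>
  define r where "r = max R 1"
  have r: "0 < r" "\<And>t. r < \<bar>t\<bar> \<Longrightarrow> f t = 0" by (auto simp: r_def supp)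
  define T where "T = 2 * r"
  define \<delta> where "\<delta> = 2 * pi / (\<bar>b\<bar> * T)"
  have T: "0 < T" and \<delta>: "0 < \<delta>" using r b by (auto simp: T_def \<delta>_def)
  have per: "2 * pi / \<bar>b * \<delta>\<bar> = T" using b T \<delta> by (simp add: \<delta>_def abs_mult)
  define M where "M = period_cell (- r) (b * \<delta>)"
  have M: "M = lebesgue_on {-r..r}" unfolding M_def period_cell_def per by (simp add: T_def)
  have Im: "{-r..r} \<in> sets lebesgue" by (intro sets_lebesgue_of_borel) simp
  have supp': "f t = 0" if "t \<notin> {-r..r}" for t using that by (intro r(2)) auto
  have nnM: "(\<integral>\<^sup>+t. ennreal ((cmod (f t))\<^sup>2) \<partial>M) = ennreal ((L2norm lebesgue f)\<^sup>2)"
    unfolding M using nn_integral_square_restrict[OF Im supp'] nn_integral_L2[OF f] by simp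
  have fM: "f \<in> L2 M"
    using nnM L2_measurable[OF f] by (intro L2_I_nn_less) (auto simp: M intro: measurable_restrict_space1)
  have normM: "L2norm M f = L2norm lebesgue f" by (rule L2norm_eq_nn[OF fM nnM]) simp
  have basis: "L2_orthonormal_basis M (fourier_basis (b * \<delta>))"
    unfolding M_def using b \<delta> by (intro fourier_basis_complete) simp
  have per_s: "(\<Sum>\<^sub>\<infinity>n::int. ennreal ((cmod (frft_int \<theta> f (s + of_int n * \<delta>)))\<^sup>2))
      = ennreal ((cmod c)\<^sup>2 * T * (L2norm lebesgue f)\<^sup>2)" for s
  proof (rule infsum_ennreal_of_has_sum)
    define u where "u t = chirp \<theta> t * cis (- (b * s * t))" for t
    have u1: "cmod (u t) = 1" for t by (simp add: u_def norm_mult)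
    have um: "u \<in> borel_measurable M"
      unfolding M u_def[abs_def]
      by (intro measurable_restrict_space1 borel_measurable_lebesgue_continuous continuous_intros
          continuous_on_chirp)
    define g where "g t = u t * f t" for t
    have gL: "g \<in> L2 M" unfolding g_def[abs_def] by (rule L2_mult_unimodular[OF fM um u1])
    have gn: "L2norm M g = L2norm lebesgue f"
      unfolding g_def[abs_def] normM[symmetric] by (rule L2norm_mult_unimodular[OF u1])
    have coeff: "frft_int \<theta> f (s + of_int n * \<delta>)
        = c * chirp \<theta> (s + of_int n * \<delta>) * of_real (sqrt T) * L2inner M g (fourier_basis (b * \<delta>) n)" for n
    proof -
      have "frft_int \<theta> f (s + of_int n * \<delta>)
          = (LINT t|M. f t * frft_kernel \<theta> t (s + of_int n * \<delta>))"
        unfolding frft_int_def M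
        by (rule integral_lebesgue_on_support[symmetric, OF Im]) (simp add: supp')
      also have "\<dots> = (LINT t|M. c * chirp \<theta> (s + of_int n * \<delta>) * of_real (sqrt T)
          * (g t * cnj (fourier_basis (b * \<delta>) n t)))"
      proof (rule Bochner_Integration.integral_cong[OF refl])
        fix t
        have "cis (- (b * t * (s + of_int n * \<delta>))) = cis (- (b * s * t)) * cis (- (b * \<delta> * of_int n * t))"
          by (simp add: cis_mult algebra_simps)
        moreover have "complex_of_real (sqrt T) * cnj (fourier_basis (b * \<delta>) n t) = cis (- (b * \<delta> * of_int n * t))"
          using T unfolding fourier_basis_def per by (simp add: cis_cnj)
        ultimately show "f t * frft_kernel \<theta> t (s + of_int n * \<delta>)
            = c * chirp \<theta> (s + of_int n * \<delta>) * of_real (sqrt T) * (g t * cnj (fourier_basis (b * \<delta>) n t))"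
          unfolding frft_kernel_eq g_def u_def c_def[symmetric] b_def[symmetric] by simp
      qed
      also have "\<dots> = c * chirp \<theta> (s + of_int n * \<delta>) * of_real (sqrt T) * L2inner M g (fourier_basis (b * \<delta>) n)"
        unfolding L2inner_def by (rule integral_mult_right_zero)
      finally show ?thesis .
    qed
    have "(cmod (frft_int \<theta> f (s + of_int n * \<delta>)))\<^sup>2
        = (cmod c)\<^sup>2 * T * (cmod (L2inner M g (fourier_basis (b * \<delta>) n)))\<^sup>2" for n
      unfolding coeff using T by (simp add: norm_mult power_mult_distrib)
    moreover have "((\<lambda>n. (cmod c)\<^sup>2 * T * (cmod (L2inner M g (fourier_basis (b * \<delta>) n)))\<^sup>2)
        has_sum (cmod c)\<^sup>2 * T * (L2norm M g)\<^sup>2) UNIV"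
      by (rule has_sum_cmult_right[OF Parseval[OF basis gL]])
    ultimately show "((\<lambda>n::int. (cmod (frft_int \<theta> f (s + of_int n * \<delta>)))\<^sup>2)
        has_sum (cmod c)\<^sup>2 * T * (L2norm lebesgue f)\<^sup>2) UNIV" by (simp add: gn)
  qed simp
  have "(\<integral>\<^sup>+\<xi>. ennreal ((cmod (frft_int \<theta> f \<xi>))\<^sup>2) \<partial>lebesgue)
      = (\<integral>\<^sup>+s. (\<Sum>\<^sub>\<infinity>n::int. ennreal ((cmod (frft_int \<theta> f (s + of_int n * \<delta>)))\<^sup>2)) \<partial>lebesgue_on {0..\<delta>})"
  proof (rule nn_integral_periodization[OF _ \<delta>])
    show "(\<lambda>\<xi>. ennreal ((cmod (frft_int \<theta> f \<xi>))\<^sup>2)) \<in> borel_measurable lebesgue"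
      using frft_int_measurable[OF L2_compact_support_integrable[OF f supp]] by measurable
  qed
  also have "\<dots> = ennreal ((cmod c)\<^sup>2 * T * (L2norm lebesgue f)\<^sup>2) * ennreal \<delta>"
    unfolding per_s using \<delta> by (simp add: emeasure_restrict_space)
  also have "\<dots> = ennreal ((cmod c)\<^sup>2 * T * \<delta> * (L2norm lebesgue f)\<^sup>2)"
    using T \<delta> by (simp add: mult_ac flip: ennreal_mult)
  also have "(cmod c)\<^sup>2 * T * \<delta> = 1"
    unfolding c_def cmod_frft_const[OF s] b_def[symmetric] using b T by (simp add: \<delta>_def)
  finally show ?thesis by simp
qed

lemma Plancherel_compact_support:
  fixes f :: "real \<Rightarrow> complex"
  assumes s: "sin \<theta> \<noteq> 0" and f: "f \<in> L2 lebesgue" and supp: "\<And>t. R < \<bar>t\<bar> \<Longrightarrow> f t = 0"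
  shows "frft_int \<theta> f \<in> L2 lebesgue" "L2norm lebesgue (frft_int \<theta> f) = L2norm lebesgue f"
proof -
  note m = frft_int_measurable[OF L2_compact_support_integrable[of f R, OF f supp], of \<theta>]
  note nn = Plancherel_compact_support_nn[of \<theta> f R, OF s f supp]
  show L: "frft_int \<theta> f \<in> L2 lebesgue" by (rule L2_I_nn_less[OF m]) (simp_all add: nn)
  show "L2norm lebesgue (frft_int \<theta> f) = L2norm lebesgue f" by (rule L2norm_eq_nn[OF L nn L2norm_nonneg])
qed

definition truncate_fun :: "nat \<Rightarrow> (real \<Rightarrow> complex) \<Rightarrow> real \<Rightarrow> complex" where
  "truncate_fun N f t = (if t \<in> {- real N..real N} then f t else 0)"

lemma truncate_fun_support: "real N < \<bar>t\<bar> \<Longrightarrow> truncate_fun N f t = 0"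
  by (auto simp: truncate_fun_def)

lemma truncate_fun_L2:
  assumes "f \<in> L2 lebesgue" shows "truncate_fun N f \<in> L2 lebesgue"
proof -
  have eq: "truncate_fun N f = (\<lambda>t. indicator {- real N..real N} t * f t)"
    by (auto simp: truncate_fun_def fun_eq_iff)
  have m: "truncate_fun N f \<in> borel_measurable lebesgue"
    unfolding eq
    by (intro borel_measurable_times borel_measurable_indicator sets_lebesgue_of_borel L2_measurable[OF assms]) simp
  have "integrable lebesgue (\<lambda>t. (cmod (truncate_fun N f t))\<^sup>2)"
  proof (rule Bochner_Integration.integrable_bound[OF L2_integrable_square[OF assms]])
    show "(\<lambda>t. (cmod (truncate_fun N f t))\<^sup>2) \<in> borel_measurable lebesgue"
      using m by measurable
  qed (simp add: truncate_fun_def)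
  with m show ?thesis by (simp add: L2_def)
qed

lemma truncate_fun_tendsto:
  assumes f: "f \<in> L2 lebesgue"
  shows "L2_tendsto lebesgue (\<lambda>N. truncate_fun N f) f sequentially"
proof -
  have m: "(\<lambda>t. truncate_fun N f t - f t) \<in> borel_measurable lebesgue" for N
    using L2_measurable[OF L2_diff[OF truncate_fun_L2[OF f] f]] .
  have "(\<lambda>N. LINT t|lebesgue. (cmod (truncate_fun N f t - f t))\<^sup>2) \<longlonglongrightarrow> (LINT (t::real)|lebesgue. 0)"
  proof (rule integral_dominated_convergence[OF _ _ L2_integrable_square[OF f]])
    have "(\<lambda>N. (cmod (truncate_fun N f t - f t))\<^sup>2) \<longlonglongrightarrow> 0" for t
    proof (rule tendsto_eventually)
      obtain N0 :: nat where "\<bar>t\<bar> \<le> real N0" using real_arch_simple by blast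
      then show "\<forall>\<^sub>F N in sequentially. (cmod (truncate_fun N f t - f t))\<^sup>2 = 0"
        unfolding eventually_sequentially by (intro exI[of _ N0]) (auto simp: truncate_fun_def)
    qed
    then show "AE t in lebesgue. (\<lambda>N. (cmod (truncate_fun N f t - f t))\<^sup>2) \<longlonglongrightarrow> 0" by simp
    show "AE t in lebesgue. norm ((cmod (truncate_fun N f t - f t))\<^sup>2) \<le> (cmod (f t))\<^sup>2" for N
      by (intro AE_I2) (simp add: truncate_fun_def)
  qed (use m in auto)
  then have "(\<lambda>N. sqrt (LINT t|lebesgue. (cmod (truncate_fun N f t - f t))\<^sup>2)) \<longlonglongrightarrow> sqrt 0"
    by (intro tendsto_real_sqrt) simp
  then show ?thesis by (simp add: L2_tendsto_def f truncate_fun_L2 L2norm_def)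
qed

lemma frft_int_diff:
  assumes "integrable lebesgue f" "integrable lebesgue g"
  shows "frft_int \<theta> (\<lambda>t. f t - g t) \<xi> = frft_int \<theta> f \<xi> - frft_int \<theta> g \<xi>"
  using frft_int_integrable[OF assms(1)] frft_int_integrable[OF assms(2)]
  by (simp add: frft_int_def left_diff_distrib)

lemma frft_int_add:
  assumes "integrable lebesgue f" "integrable lebesgue g"
  shows "frft_int \<theta> (\<lambda>t. f t + g t) \<xi> = frft_int \<theta> f \<xi> + frft_int \<theta> g \<xi>"
  using frft_int_integrable[OF assms(1)] frft_int_integrable[OF assms(2)]
  by (simp add: frft_int_def distrib_right)

lemma truncate_fun_integrable:
  "f \<in> L2 lebesgue \<Longrightarrow> integrable lebesgue (truncate_fun N f)"
  by (rule L2_compact_support_integrable[OF truncate_fun_L2 truncate_fun_support])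

lemma frft_truncation_eq:
  "(LINT t|lebesgue_on {- real N..real N}. f t * frft_kernel \<theta> t \<xi>) = frft_int \<theta> (truncate_fun N f) \<xi>"
proof -
  have I: "{- real N..real N} \<in> sets lebesgue" by (intro sets_lebesgue_of_borel) simp
  have "(LINT t|lebesgue_on {- real N..real N}. f t * frft_kernel \<theta> t \<xi>)
      = (LINT t|lebesgue_on {- real N..real N}. truncate_fun N f t * frft_kernel \<theta> t \<xi>)"
    by (rule Bochner_Integration.integral_cong) (auto simp: truncate_fun_def)
  also have "\<dots> = frft_int \<theta> (truncate_fun N f) \<xi>"
    unfolding frft_int_def by (rule integral_lebesgue_on_support[OF I]) (auto simp: truncate_fun_def)
  finally show ?thesis .
qed

text \<open>
  Truncations of \<open>f\<close> converge to \<open>f\<close> in the mean, so by the isometry their transforms form a Cauchy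
  sequence; completeness supplies the limit that defines the transform of \<open>f\<close>.
\<close>

lemma frft_tendsto:
  assumes s: "sin \<theta> \<noteq> 0" and f: "f \<in> L2 lebesgue"
  shows "L2_tendsto lebesgue (\<lambda>N. frft_int \<theta> (truncate_fun N f)) (frft \<theta> f) sequentially"
proof -
  note fN = truncate_fun_L2[OF f]
  note C = L2_tendsto_imp_Cauchy[OF truncate_fun_tendsto[OF f] fN]
  have "L2_Cauchy lebesgue (\<lambda>N. frft_int \<theta> (truncate_fun N f))"
    unfolding L2_Cauchy_def
  proof (intro conjI allI impI)
    show "frft_int \<theta> (truncate_fun N f) \<in> L2 lebesgue" for N
      by (rule Plancherel_compact_support(1)[OF s fN truncate_fun_support])
    fix e :: real assume "0 < e"
    have "L2norm lebesgue (\<lambda>\<xi>. frft_int \<theta> (truncate_fun m f) \<xi> - frft_int \<theta> (truncate_fun n f) \<xi>)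
        = L2norm lebesgue (\<lambda>t. truncate_fun m f t - truncate_fun n f t)" for m n
    proof -
      have "L2norm lebesgue (frft_int \<theta> (\<lambda>t. truncate_fun m f t - truncate_fun n f t))
          = L2norm lebesgue (\<lambda>t. truncate_fun m f t - truncate_fun n f t)"
        by (rule Plancherel_compact_support(2)[OF s L2_diff[OF fN fN], of "real (max m n)"])
           (simp add: truncate_fun_support)
      moreover have "frft_int \<theta> (\<lambda>t. truncate_fun m f t - truncate_fun n f t)
          = (\<lambda>\<xi>. frft_int \<theta> (truncate_fun m f) \<xi> - frft_int \<theta> (truncate_fun n f) \<xi>)"
        by (rule ext) (rule frft_int_diff[OF truncate_fun_integrable[OF f] truncate_fun_integrable[OF f]])
      ultimately show ?thesis by simp
    qed
    then show "\<exists>N. \<forall>m\<ge>N. \<forall>n\<ge>N.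
        L2norm lebesgue (\<lambda>\<xi>. frft_int \<theta> (truncate_fun m f) \<xi> - frft_int \<theta> (truncate_fun n f) \<xi>) \<le> e"
      using C \<open>0 < e\<close> unfolding L2_Cauchy_def by simp
  qed
  then obtain g where "L2_tendsto lebesgue (\<lambda>N. frft_int \<theta> (truncate_fun N f)) g sequentially"
    by (rule L2_complete)
  then show ?thesis
    unfolding frft_def L2_lim_def frft_truncation_eq
    by (rule someI[where P = "\<lambda>g. L2_tendsto lebesgue (\<lambda>N. frft_int \<theta> (truncate_fun N f)) g sequentially"])
qed

lemma frft_L2: "sin \<theta> \<noteq> 0 \<Longrightarrow> f \<in> L2 lebesgue \<Longrightarrow> frft \<theta> f \<in> L2 lebesgue"
  by (rule L2_tendsto_in_L2[OF frft_tendsto])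

theorem frft_isometry:
  assumes s: "sin \<theta> \<noteq> 0" and f: "f \<in> L2 lebesgue"
  shows "L2norm lebesgue (frft \<theta> f) = L2norm lebesgue f"
proof (rule LIMSEQ_unique)
  show "(\<lambda>N. L2norm lebesgue (frft_int \<theta> (truncate_fun N f))) \<longlonglongrightarrow> L2norm lebesgue (frft \<theta> f)"
    by (rule tendsto_L2norm[OF frft_tendsto[OF s f]])
  show "(\<lambda>N. L2norm lebesgue (frft_int \<theta> (truncate_fun N f))) \<longlonglongrightarrow> L2norm lebesgue f"
    using tendsto_L2norm[OF truncate_fun_tendsto[OF f]]
    by (simp add: Plancherel_compact_support(2)[OF s truncate_fun_L2[OF f] truncate_fun_support])
qed

lemma frft_add:
  assumes s: "sin \<theta> \<noteq> 0" and f: "f \<in> L2 lebesgue" and g: "g \<in> L2 lebesgue"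
  shows "AE \<xi> in lebesgue. frft \<theta> (\<lambda>t. f t + g t) \<xi> = frft \<theta> f \<xi> + frft \<theta> g \<xi>"
proof (rule L2_tendsto_unique[OF sequentially_bot])
  show "L2_tendsto lebesgue (\<lambda>N. frft_int \<theta> (truncate_fun N (\<lambda>t. f t + g t))) (frft \<theta> (\<lambda>t. f t + g t)) sequentially"
    by (rule frft_tendsto[OF s L2_add[OF f g]])
  have "truncate_fun N (\<lambda>t. f t + g t) = (\<lambda>t. truncate_fun N f t + truncate_fun N g t)" for N
    by (auto simp: truncate_fun_def)
  then have "frft_int \<theta> (truncate_fun N (\<lambda>t. f t + g t))
      = (\<lambda>\<xi>. frft_int \<theta> (truncate_fun N f) \<xi> + frft_int \<theta> (truncate_fun N g) \<xi>)" for N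
    using frft_int_add[OF truncate_fun_integrable[OF f] truncate_fun_integrable[OF g]] by auto
  then show "L2_tendsto lebesgue (\<lambda>N. frft_int \<theta> (truncate_fun N (\<lambda>t. f t + g t)))
      (\<lambda>\<xi>. frft \<theta> f \<xi> + frft \<theta> g \<xi>) sequentially"
    using L2_tendsto_add[OF frft_tendsto[OF s f] frft_tendsto[OF s g]] by simp
qed

lemma frft_cmult:
  assumes s: "sin \<theta> \<noteq> 0" and f: "f \<in> L2 lebesgue"
  shows "AE \<xi> in lebesgue. frft \<theta> (\<lambda>t. z * f t) \<xi> = z * frft \<theta> f \<xi>"
proof (rule L2_tendsto_unique[OF sequentially_bot])
  show "L2_tendsto lebesgue (\<lambda>N. frft_int \<theta> (truncate_fun N (\<lambda>t. z * f t))) (frft \<theta> (\<lambda>t. z * f t)) sequentially"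
    by (rule frft_tendsto[OF s L2_cmult[OF f]])
  have "truncate_fun N (\<lambda>t. z * f t) = (\<lambda>t. z * truncate_fun N f t)" for N
    by (auto simp: truncate_fun_def)
  then have "frft_int \<theta> (truncate_fun N (\<lambda>t. z * f t)) = (\<lambda>\<xi>. z * frft_int \<theta> (truncate_fun N f) \<xi>)" for N
    by (simp add: frft_int_def fun_eq_iff mult.assoc)
  then show "L2_tendsto lebesgue (\<lambda>N. frft_int \<theta> (truncate_fun N (\<lambda>t. z * f t)))
      (\<lambda>\<xi>. z * frft \<theta> f \<xi>) sequentially"
    using L2_tendsto_cmult[OF frft_tendsto[OF s f]] by simp
qed

lemma frft_diff:
  assumes s: "sin \<theta> \<noteq> 0" and f: "f \<in> L2 lebesgue" and g: "g \<in> L2 lebesgue"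
  shows "AE \<xi> in lebesgue. frft \<theta> (\<lambda>t. f t - g t) \<xi> = frft \<theta> f \<xi> - frft \<theta> g \<xi>"
  using frft_add[OF s f L2_cmult[OF g, of "-1"]] frft_cmult[OF s g, of "-1"]
  by eventually_elim simp

lemma frft_sum:
  assumes s: "sin \<theta> \<noteq> 0" and f: "\<And>i. i \<in> S \<Longrightarrow> f i \<in> L2 lebesgue"
  shows "AE \<xi> in lebesgue. frft \<theta> (\<lambda>t. \<Sum>i\<in>S. f i t) \<xi> = (\<Sum>i\<in>S. frft \<theta> (f i) \<xi>)"
proof -
  have zero: "AE \<xi> in lebesgue. frft \<theta> (\<lambda>t. 0) \<xi> = 0"
    using frft_cmult[OF s L2_zero, of 0] by simp
  show ?thesis using f
  proof (induction S rule: infinite_finite_induct)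
    case (insert i S)
    have "AE \<xi> in lebesgue. frft \<theta> (\<lambda>t. f i t + (\<Sum>i\<in>S. f i t)) \<xi> = frft \<theta> (f i) \<xi> + frft \<theta> (\<lambda>t. \<Sum>i\<in>S. f i t) \<xi>"
      by (rule frft_add[OF s]) (auto intro: insert.prems L2_sum)
    moreover have "AE \<xi> in lebesgue. frft \<theta> (\<lambda>t. \<Sum>i\<in>S. f i t) \<xi> = (\<Sum>i\<in>S. frft \<theta> (f i) \<xi>)"
      using insert by auto
    ultimately show ?case
      by eventually_elim (use insert.hyps in simp)
  qed (use zero in auto)
qed

lemma frft_measurable:
  "sin \<theta> \<noteq> 0 \<Longrightarrow> f \<in> L2 lebesgue \<Longrightarrow> frft \<theta> f \<in> borel_measurable lebesgue"
  by (rule L2_measurable[OF frft_L2])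

lemma L2norm_frft_diff:
  assumes s: "sin \<theta> \<noteq> 0" and f: "f \<in> L2 lebesgue" and g: "g \<in> L2 lebesgue"
  shows "L2norm lebesgue (\<lambda>\<xi>. frft \<theta> f \<xi> - frft \<theta> g \<xi>) = L2norm lebesgue (\<lambda>t. f t - g t)"
proof -
  have "L2norm lebesgue (\<lambda>\<xi>. frft \<theta> f \<xi> - frft \<theta> g \<xi>) = L2norm lebesgue (frft \<theta> (\<lambda>t. f t - g t))"
    using frft_diff[OF s f g]
    by (intro L2norm_cong_AE frft_measurable s L2_diff f g L2_measurable[OF L2_diff[OF frft_L2 frft_L2]])
       (auto elim!: eventually_mono)
  then show ?thesis using frft_isometry[OF s L2_diff[OF f g]] by simp
qed

lemma L2_tendsto_frft:
  assumes s: "sin \<theta> \<noteq> 0" and f: "L2_tendsto lebesgue f g F"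
  shows "L2_tendsto lebesgue (\<lambda>i. frft \<theta> (f i)) (frft \<theta> g) F"
proof -
  have g: "g \<in> L2 lebesgue" and ev: "\<forall>\<^sub>F i in F. f i \<in> L2 lebesgue"
    and lim: "((\<lambda>i. L2norm lebesgue (\<lambda>x. f i x - g x)) \<longlongrightarrow> 0) F"
    using f by (auto simp: L2_tendsto_def)
  have "((\<lambda>i. L2norm lebesgue (\<lambda>x. frft \<theta> (f i) x - frft \<theta> g x)) \<longlongrightarrow> 0) F"
    by (rule Lim_transform_eventually[OF lim])
       (use ev in \<open>auto simp: L2norm_frft_diff[OF s _ g] elim!: eventually_mono\<close>)
  moreover have "\<forall>\<^sub>F i in F. frft \<theta> (f i) \<in> L2 lebesgue"
    using ev by eventually_elim (rule frft_L2[OF s])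
  ultimately show ?thesis by (simp add: L2_tendsto_def frft_L2[OF s g])
qed

lemma frft_compact_support:
  assumes s: "sin \<theta> \<noteq> 0" and f: "f \<in> L2 lebesgue" and supp: "\<And>t. R < \<bar>t\<bar> \<Longrightarrow> f t = 0"
  shows "AE \<xi> in lebesgue. frft \<theta> f \<xi> = frft_int \<theta> f \<xi>"
proof (rule L2_tendsto_unique[OF sequentially_bot frft_tendsto[OF s f]])
  obtain N0 :: nat where N0: "R \<le> real N0" using real_arch_simple by blast
  have "truncate_fun N f = f" if "N \<ge> N0" for N
    using that N0 supp by (auto simp: truncate_fun_def fun_eq_iff)
  then have "\<forall>\<^sub>F N in sequentially. frft_int \<theta> (truncate_fun N f) = frft_int \<theta> f"
    unfolding eventually_sequentially by metis
  moreover have "frft_int \<theta> f \<in> L2 lebesgue" by (rule Plancherel_compact_support(1)[OF s f supp])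
  ultimately show "L2_tendsto lebesgue (\<lambda>N. frft_int \<theta> (truncate_fun N f)) (frft_int \<theta> f) sequentially"
    unfolding L2_tendsto_def
    by (auto elim: eventually_mono intro!: tendsto_eventually)
qed

section \<open>The generators and the kernel basis of the cell\<close>

lemma L2_shift:
  fixes f :: "real \<Rightarrow> complex"
  assumes f: "f \<in> L2 lebesgue"
  shows "(\<lambda>t. f (t + a)) \<in> L2 lebesgue" "L2norm lebesgue (\<lambda>t. f (t + a)) = L2norm lebesgue f"
proof -
  note [measurable] = L2_measurable[OF f] lebesgue_measurable_shift[OF L2_measurable[OF f]]
  have nn: "(\<integral>\<^sup>+t. ennreal ((cmod (f (t + a)))\<^sup>2) \<partial>lebesgue) = ennreal ((L2norm lebesgue f)\<^sup>2)"
    unfolding nn_integral_L2[OF f, symmetric]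
    by (rule nn_integral_lebesgue_shift[of "\<lambda>t. ennreal ((cmod (f t))\<^sup>2)"]) measurable
  show L: "(\<lambda>t. f (t + a)) \<in> L2 lebesgue" by (rule L2_I_nn_less) (simp_all add: nn)
  show "L2norm lebesgue (\<lambda>t. f (t + a)) = L2norm lebesgue f"
    by (rule L2norm_eq_nn[OF L nn L2norm_nonneg])
qed

text \<open>
  Up to a constant, a generator is a translate of \<open>\<phi>\<close> times a unimodular function. Hence it depends
  continuously on \<open>\<phi>\<close> in the mean, which allows \<open>\<phi>\<close> to be truncated when the transform is computed.
  The translation is written as addition of \<open>- n\<close> to match the translation lemmas.
\<close>

lemma V_gen_eq: "V_gen \<theta> \<phi> n t = frft_const \<theta> * (cnj (chirp \<theta> t) * chirp \<theta> (t + - of_int n) * \<phi> (t + - of_int n))"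
  by (simp add: V_gen_def chirp_mod_def)

lemma V_gen_unimodular:
  "(\<lambda>t. cnj (chirp \<theta> t) * chirp \<theta> (t + - of_int n)) \<in> borel_measurable lebesgue"
  "cmod (cnj (chirp \<theta> t) * chirp \<theta> (t + - of_int n)) = 1"
proof -
  show "(\<lambda>t. cnj (chirp \<theta> t) * chirp \<theta> (t + - of_int n)) \<in> borel_measurable lebesgue"
    by (intro borel_measurable_times borel_measurable_cnj chirp_measurable
        lebesgue_measurable_shift[OF chirp_measurable])
qed (simp add: norm_mult)

lemma V_gen_L2: "\<phi> \<in> L2 lebesgue \<Longrightarrow> V_gen \<theta> \<phi> n \<in> L2 lebesgue"
  unfolding V_gen_eq[abs_def]
  by (intro L2_cmult L2_mult_unimodular L2_shift V_gen_unimodular)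

lemma V_gen_tendsto:
  assumes "L2_tendsto lebesgue f \<phi> F"
  shows "L2_tendsto lebesgue (\<lambda>i. V_gen \<theta> (f i) n) (V_gen \<theta> \<phi> n) F"
proof -
  have "L2norm lebesgue (\<lambda>t. f i (t + - of_int n) - \<phi> (t + - of_int n)) = L2norm lebesgue (\<lambda>t. f i t - \<phi> t)"
    if "f i \<in> L2 lebesgue" for i
    by (rule L2_shift(2)) (intro L2_diff that L2_tendsto_in_L2[OF assms])
  then have "L2_tendsto lebesgue (\<lambda>i t. f i (t + - of_int n)) (\<lambda>t. \<phi> (t + - of_int n)) F"
    using assms unfolding L2_tendsto_def
    by (auto simp: L2_shift simp del: add_uminus_conv_diff elim!: eventually_mono
        intro: Lim_transform_eventually)
  then show ?thesis
    unfolding V_gen_eq[abs_def]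
    by (intro L2_tendsto_cmult L2_tendsto_mult_unimodular V_gen_unimodular)
qed

lemma chirp_cnj_mult [simp]: "cnj (chirp \<theta> x) * chirp \<theta> x = 1" "chirp \<theta> x * cnj (chirp \<theta> x) = 1"
  using cnj_chirp_mult_chirp[of \<theta> x] by (simp_all add: mult.commute)

lemma frft_int_V_gen:
  "frft_int \<theta> (V_gen \<theta> f n) \<xi> = frft_const \<theta> * cis (- (frft_b \<theta> * of_int n * \<xi>)) * frft_int \<theta> f \<xi>"
proof -
  have "frft_int \<theta> (V_gen \<theta> f n) \<xi> = (LINT t|lebesgue. V_gen \<theta> f n (of_int n + 1 * t) * frft_kernel \<theta> (of_int n + 1 * t) \<xi>)"
    unfolding frft_int_def
    using lebesgue_integral_real_affine[of 1 "\<lambda>t. V_gen \<theta> f n t * frft_kernel \<theta> t \<xi>" "of_int n"] by simp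
  also have "\<dots> = (LINT t|lebesgue. frft_const \<theta> * cis (- (frft_b \<theta> * of_int n * \<xi>)) * (f t * frft_kernel \<theta> t \<xi>))"
  proof (rule Bochner_Integration.integral_cong[OF refl])
    fix t
    have "cis (- (frft_b \<theta> * (of_int n + t) * \<xi>)) = cis (- (frft_b \<theta> * of_int n * \<xi>)) * cis (- (frft_b \<theta> * t * \<xi>))"
      by (simp add: cis_mult algebra_simps)
    then show "V_gen \<theta> f n (of_int n + 1 * t) * frft_kernel \<theta> (of_int n + 1 * t) \<xi>
        = frft_const \<theta> * cis (- (frft_b \<theta> * of_int n * \<xi>)) * (f t * frft_kernel \<theta> t \<xi>)"
      using cnj_chirp_mult_chirp[of \<theta> "of_int n + t"]
      by (simp add: V_gen_def chirp_mod_def frft_kernel_eq mult_ac)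
  qed
  also have "\<dots> = frft_const \<theta> * cis (- (frft_b \<theta> * of_int n * \<xi>)) * frft_int \<theta> f \<xi>"
    unfolding frft_int_def by (rule integral_mult_right_zero)
  finally show ?thesis .
qed

text \<open>
  For the truncations of \<open>\<phi>\<close> both sides are integrals, related by a change of variables
  (\<open>frft_int_V_gen\<close>); the two sides converge in the mean, so their limits agree.
\<close>

lemma frft_V_gen:
  assumes s: "sin \<theta> \<noteq> 0" and \<phi>: "\<phi> \<in> L2 lebesgue"
  shows "AE \<xi> in lebesgue. frft \<theta> (V_gen \<theta> \<phi> n) \<xi>
    = frft_const \<theta> * cis (- (frft_b \<theta> * of_int n * \<xi>)) * frft \<theta> \<phi> \<xi>"
proof (rule L2_tendsto_unique[OF sequentially_bot])
  note \<phi>N = truncate_fun_L2[OF \<phi>]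
  have um: "(\<lambda>\<xi>. cis (- (frft_b \<theta> * of_int n * \<xi>))) \<in> borel_measurable lebesgue"
    using continuous_on_cis_linear[of UNIV "- (frft_b \<theta> * of_int n)"]
    by (intro borel_measurable_lebesgue_continuous) simp
  have "L2_tendsto lebesgue (\<lambda>N \<xi>. frft_const \<theta> * (cis (- (frft_b \<theta> * of_int n * \<xi>)) * frft_int \<theta> (truncate_fun N \<phi>) \<xi>))
      (\<lambda>\<xi>. frft_const \<theta> * (cis (- (frft_b \<theta> * of_int n * \<xi>)) * frft \<theta> \<phi> \<xi>)) sequentially"
    by (intro L2_tendsto_cmult L2_tendsto_mult_unimodular[OF _ um] frft_tendsto[OF s \<phi>]) simp
  then show "L2_tendsto lebesgue (\<lambda>N. frft_int \<theta> (V_gen \<theta> (truncate_fun N \<phi>) n))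
      (\<lambda>\<xi>. frft_const \<theta> * cis (- (frft_b \<theta> * of_int n * \<xi>)) * frft \<theta> \<phi> \<xi>) sequentially"
    by (simp add: frft_int_V_gen[abs_def] mult.assoc)
  show "L2_tendsto lebesgue (\<lambda>N. frft_int \<theta> (V_gen \<theta> (truncate_fun N \<phi>) n)) (frft \<theta> (V_gen \<theta> \<phi> n)) sequentially"
  proof (rule L2_tendsto_cong_seq[OF L2_tendsto_frft[OF s V_gen_tendsto[OF truncate_fun_tendsto[OF \<phi>]]]])
    fix N
    have supp: "V_gen \<theta> (truncate_fun N \<phi>) n t = 0" if "real N + \<bar>of_int n\<bar> < \<bar>t\<bar>" for t
    proof -
      have "real N < \<bar>t - of_int n\<bar>" using that by linarith
      then show ?thesis by (simp add: V_gen_def chirp_mod_def truncate_fun_support)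
    qed
    note VL = V_gen_L2[OF \<phi>N[of N], of \<theta> n]
    show "frft_int \<theta> (V_gen \<theta> (truncate_fun N \<phi>) n) \<in> borel_measurable lebesgue"
      by (rule frft_int_measurable[OF L2_compact_support_integrable[OF VL supp]])
    show "AE \<xi> in lebesgue. frft \<theta> (V_gen \<theta> (truncate_fun N \<phi>) n) \<xi> = frft_int \<theta> (V_gen \<theta> (truncate_fun N \<phi>) n) \<xi>"
      by (rule frft_compact_support[OF s VL supp])
  qed
qed

lemma frft_period_pos: "sin \<theta> \<noteq> 0 \<Longrightarrow> 0 < frft_period \<theta>"
  by (simp add: frft_period_def frft_b_nonzero)

lemma frft_cell_eq: "frft_cell \<theta> = period_cell 0 (- frft_b \<theta>)"
  by (simp add: frft_cell_def period_cell_def frft_period_def)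

lemma orthonormal_basis_mult_unimodular:
  assumes u: "L2_orthonormal_basis M u" and w: "w \<in> borel_measurable M" "\<And>x. cmod (w x) = 1"
    and z: "\<And>n. cmod (z n) = 1"
  shows "L2_orthonormal_basis M (\<lambda>n x. z n * (w x * u n x))"
proof -
  have wc: "w x * cnj (w x) = 1" for x using w(2)[of x] by (metis complex_norm_square of_real_1 power_one)
  have zc: "z n * cnj (z n) = 1" for n using z[of n] by (metis complex_norm_square of_real_1 power_one)
  have L: "u n \<in> L2 M" for n using u by (simp add: L2_orthonormal_basis_def L2_orthonormal_def)
  have inner: "L2inner M f (\<lambda>x. z n * (w x * u n x)) = cnj (z n) * L2inner M (\<lambda>x. cnj (w x) * f x) (u n)"
    for f n
  proof -
    have "L2inner M f (\<lambda>x. z n * (w x * u n x)) = (LINT x|M. cnj (z n) * (cnj (w x) * f x * cnj (u n x)))"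
      unfolding L2inner_def by (intro Bochner_Integration.integral_cong refl) (simp add: mult_ac)
    then show ?thesis by (simp add: L2inner_def)
  qed
  have "L2inner M (\<lambda>x. z m * (w x * u m x)) (\<lambda>x. z n * (w x * u n x)) = (if m = n then 1 else 0)" for m n
  proof -
    have "(\<lambda>x. cnj (w x) * (z m * (w x * u m x))) = (\<lambda>x. z m * u m x)"
      using wc by (intro ext) (metis mult.assoc mult.commute mult_1)
    then have "L2inner M (\<lambda>x. z m * (w x * u m x)) (\<lambda>x. z n * (w x * u n x))
        = cnj (z n) * (z m * L2inner M (u m) (u n))"
      unfolding inner by (simp add: L2inner_cmult_left)
    then show ?thesis
      using u zc[of n] by (simp add: L2_orthonormal_basis_def L2_orthonormal_def mult.commute)
  qed
  moreover have "(\<lambda>x. z n * (w x * u n x)) \<in> L2 M" for n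
    by (intro L2_cmult L2_mult_unimodular L w)
  moreover have "AE x in M. f x = 0"
    if f: "f \<in> L2 M" and 0: "\<forall>n. L2inner M f (\<lambda>x. z n * (w x * u n x)) = 0" for f
  proof -
    have "z n \<noteq> 0" for n using z[of n] by auto
    then have "\<forall>n. L2inner M (\<lambda>x. cnj (w x) * f x) (u n) = 0" using 0 by (simp add: inner)
    moreover have "(\<lambda>x. cnj (w x) * f x) \<in> L2 M"
      by (rule L2_mult_unimodular[OF f borel_measurable_cnj[OF w(1)]]) (simp add: w(2))
    ultimately have "AE x in M. cnj (w x) * f x = 0"
      using u by (auto simp: L2_orthonormal_basis_def)
    moreover have "w x \<noteq> 0" for x using w(2)[of x] by auto
    ultimately show ?thesis by simp
  qed
  ultimately show ?thesis by (simp add: L2_orthonormal_basis_def L2_orthonormal_def)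
qed

text \<open>
  Since \<open>\<bar>c(\<theta>)\<bar>\<^sup>2 \<Delta> = 1\<close>, the kernel differs from the Fourier basis of frequency \<open>- b\<close> by
  constants of modulus one and by the chirp in \<open>\<xi>\<close>, both of which preserve orthonormal bases.
\<close>

lemma frft_kernel_orthonormal_basis:
  assumes s: "sin \<theta> \<noteq> 0"
  shows "L2_orthonormal_basis (frft_cell \<theta>) (\<lambda>n::int. frft_kernel \<theta> (of_int n))"
proof -
  define T where "T = frft_period \<theta>"
  have T: "0 < T" unfolding T_def by (rule frft_period_pos[OF s])
  define z where "z n = frft_const \<theta> * of_real (sqrt T) * chirp \<theta> (of_int n)" for n :: int
  have "(cmod (frft_const \<theta> * of_real (sqrt T)))\<^sup>2 = 1"
    using T frft_b_nonzero[OF s]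
    by (simp add: norm_mult power_mult_distrib cmod_frft_const[OF s]) (simp add: T_def frft_period_def)
  then have "cmod (frft_const \<theta> * of_real (sqrt T)) = 1"
    by (intro power2_eq_imp_eq[of _ 1]) simp_all
  then have z: "cmod (z n) = 1" for n by (simp add: z_def norm_mult)
  have eq: "frft_kernel \<theta> (of_int n) \<xi> = z n * (chirp \<theta> \<xi> * fourier_basis (- frft_b \<theta>) n \<xi>)" for n \<xi>
    using T frft_b_nonzero[OF s] by (simp add: frft_kernel_eq z_def fourier_basis_def T_def frft_period_def)
  have "chirp \<theta> \<in> borel_measurable (frft_cell \<theta>)"
    unfolding frft_cell_def by (rule measurable_restrict_space1[OF chirp_measurable])
  then have "L2_orthonormal_basis (frft_cell \<theta>)
      (\<lambda>(n::int) \<xi>. z n * (chirp \<theta> \<xi> * fourier_basis (- frft_b \<theta>) n \<xi>))"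
    using frft_b_nonzero[OF s] unfolding frft_cell_eq
    by (intro orthonormal_basis_mult_unimodular fourier_basis_complete z) auto
  then show ?thesis by (simp add: eq[abs_def])
qed

section \<open>Multiplication by the transform of the generator\<close>

text \<open>
  The operator that \<open>J\<close> becomes on the transform side: multiplication of \<open>frft \<theta> \<phi>\<close> by the
  periodic extension of \<open>F\<close> with its chirp removed.
\<close>

definition mult_op :: "real \<Rightarrow> (real \<Rightarrow> complex) \<Rightarrow> (real \<Rightarrow> complex) \<Rightarrow> real \<Rightarrow> complex" where
  "mult_op \<theta> \<phi> F \<xi> = cnj (chirp \<theta> \<xi>) * chirp_ext \<theta> F \<xi> * frft \<theta> \<phi> \<xi>"

lemma mult_op_eq:
  "mult_op \<theta> \<phi> F \<xi>
    = cnj (chirp \<theta> (\<xi> rmod frft_period \<theta>)) * F (\<xi> rmod frft_period \<theta>) * frft \<theta> \<phi> \<xi>"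
  by (simp add: mult_op_def chirp_ext_def flip: mult.assoc)

lemma mult_op_diff: "mult_op \<theta> \<phi> (\<lambda>x. F x - G x) \<xi> = mult_op \<theta> \<phi> F \<xi> - mult_op \<theta> \<phi> G \<xi>"
  by (simp add: mult_op_eq algebra_simps)

lemma mult_op_sum: "mult_op \<theta> \<phi> (\<lambda>x. \<Sum>n\<in>S. F n x) \<xi> = (\<Sum>n\<in>S. mult_op \<theta> \<phi> (F n) \<xi>)"
  by (simp add: mult_op_eq sum_distrib_left sum_distrib_right)

lemma mult_op_cmult: "mult_op \<theta> \<phi> (\<lambda>x. z * F x) \<xi> = z * mult_op \<theta> \<phi> F \<xi>"
  by (simp add: mult_op_eq)

lemma rmod_cell:
  assumes "0 < \<delta>" "x \<in> {of_int n * \<delta>..<of_int n * \<delta> + \<delta>}"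
  shows "x rmod \<delta> = x - of_int n * \<delta>"
  by (rule rmod_unique[where n = n]) (use assms in auto)

text \<open>
  Reduction modulo \<open>\<delta>\<close> is a translation on each half-open interval of the tiling. The argument goes
  through translations because measurability with respect to the completed measure is not preserved by
  composition with a general Borel function.
\<close>

lemma measurable_rmod:
  fixes F :: "real \<Rightarrow> complex"
  assumes F: "F \<in> borel_measurable (lebesgue_on {0..\<delta>})" and \<delta>: "0 < \<delta>"
  shows "(\<lambda>x. F (x rmod \<delta>)) \<in> borel_measurable lebesgue"
proof (rule measurable_piecewise_restrict2)
  define C where "C k = {of_int (int_decode k) * \<delta>..<of_int (int_decode k) * \<delta> + \<delta>}" for k
  show "C k \<in> sets lebesgue" for k unfolding C_def by (intro sets_lebesgue_of_borel) simp
  have "x \<in> C (int_encode \<lfloor>x / \<delta>\<rfloor>)" for x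
    unfolding C_def by (simp add: floor_cell[OF \<delta>] del: atLeastLessThan_iff)
  then show "space lebesgue = (\<Union>k. C k)" by auto
  fix k
  define F' where "F' x = indicator {0..\<delta>} x *\<^sub>R F x" for x
  have I: "{0..\<delta>} \<in> sets lebesgue" by (intro sets_lebesgue_of_borel) simp
  have F': "F' \<in> borel_measurable lebesgue"
    using F I unfolding F'_def[abs_def] by (subst (asm) borel_measurable_restrict_space_iff) auto
  show "\<exists>h\<in>borel_measurable lebesgue. \<forall>x\<in>C k. F (x rmod \<delta>) = h x"
  proof (intro bexI[OF _ lebesgue_measurable_shift[OF F', of "- (of_int (int_decode k) * \<delta>)"]] ballI)
    fix x assume x: "x \<in> C k"
    then have "x rmod \<delta> = x + - (of_int (int_decode k) * \<delta>)"
      using rmod_cell[OF \<delta>] unfolding C_def by simp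
    moreover have "x + - (of_int (int_decode k) * \<delta>) \<in> {0..\<delta>}" using x by (simp add: C_def)
    ultimately show "F (x rmod \<delta>) = F' (x + - (of_int (int_decode k) * \<delta>))"
      by (simp add: F'_def)
  qed
qed

lemma infsum_ennreal_cmult:
  fixes f :: "int \<Rightarrow> ennreal"
  shows "(\<Sum>\<^sub>\<infinity>n. c * f n) = c * (\<Sum>\<^sub>\<infinity>n. f n)"
  unfolding infsum_int_eq_suminf by (rule ennreal_suminf_cmult)

lemma summable_on_of_ennreal_finite:
  assumes "(\<Sum>\<^sub>\<infinity>n. ennreal (f n)) < \<infinity>" "\<And>n. 0 \<le> f n"
  shows "f summable_on UNIV"
proof (rule nonneg_bdd_above_summable_on)
  define s where "s = enn2real (\<Sum>\<^sub>\<infinity>n. ennreal (f n))"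
  have "sum f S \<le> s" if "finite S" for S
  proof -
    have "ennreal (sum f S) = (\<Sum>\<^sub>\<infinity>n\<in>S. ennreal (f n))" using that assms(2) by (simp add: sum_ennreal)
    also have "\<dots> \<le> (\<Sum>\<^sub>\<infinity>n. ennreal (f n))"
      by (rule infsum_mono_neutral) (auto intro: nonneg_summable_on_complete)
    also have "\<dots> = ennreal s" using assms(1) by (simp add: s_def)
    finally show ?thesis by (simp add: ennreal_le_iff s_def)
  qed
  then show "bdd_above (sum f ` {F. F \<subseteq> UNIV \<and> finite F})" by (intro bdd_aboveI[of _ s]) auto
qed (use assms in auto)

lemma summable_on_mult_of_squares:
  fixes a b :: "'i \<Rightarrow> complex"
  assumes "(\<lambda>n. (cmod (a n))\<^sup>2) summable_on UNIV" "(\<lambda>n. (cmod (b n))\<^sup>2) summable_on UNIV"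
  shows "(\<lambda>n. a n * b n) summable_on UNIV"
proof (rule abs_summable_summable)
  have s: "(\<lambda>n. (cmod (a n))\<^sup>2 + (cmod (b n))\<^sup>2) summable_on UNIV"
    by (rule summable_on_add[OF assms])
  have "cmod (a n * b n) \<le> (cmod (a n))\<^sup>2 + (cmod (b n))\<^sup>2" for n
  proof -
    have "0 \<le> cmod (a n) * cmod (b n)" by simp
    then show ?thesis
      using sum_squares_bound[of "cmod (a n)" "cmod (b n)"] unfolding norm_mult by linarith
  qed
  then show "(\<lambda>n. norm (a n * b n)) summable_on UNIV"
    by (intro summable_on_comparison_test[OF s]) auto
qed

lemma filterlim_symmetric_intervals:
  "filterlim (\<lambda>N::nat. {- int N..int N}) (finite_subsets_at_top UNIV) sequentially"
  unfolding filterlim_finite_subsets_at_top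
proof (intro allI impI)
  fix X :: "int set" assume "finite X \<and> X \<subseteq> UNIV"
  then have fX: "finite X" by simp
  define N0 where "N0 = Max (insert 0 (nat ` abs ` X))"
  have "nat \<bar>x\<bar> \<le> N0" if "x \<in> X" for x
    unfolding N0_def by (rule Max_ge) (use fX that in auto)
  then have "X \<subseteq> {- int N..int N}" if "N \<ge> N0" for N
    using that by (fastforce simp: abs_le_iff)
  then show "\<forall>\<^sub>F N in sequentially. finite {- int N..int N} \<and> X \<subseteq> {- int N..int N} \<and> {- int N..int N} \<subseteq> UNIV"
    unfolding eventually_sequentially by auto
qed

text \<open>
  The standing hypotheses on the generator, with the condition on \<open>\<theta>\<close> in the form in which it is used.
\<close>

locale frft_generator =
  fixes \<theta> A B :: real and \<phi> :: "real \<Rightarrow> complex"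
  assumes s: "sin \<theta> \<noteq> 0"
    and \<phi>: "\<phi> \<in> L2 lebesgue"
    and AB: "0 < A" "A \<le> B"
    and G: "AE \<xi> in frft_cell \<theta>. ennreal A \<le> G_fun \<theta> \<phi> \<xi> \<and> G_fun \<theta> \<phi> \<xi> \<le> ennreal B"
    and C: "\<forall>t. C_fun \<theta> \<phi> t < \<infinity>"
begin

lemma mult_op_measurable:
  assumes "F \<in> borel_measurable (frft_cell \<theta>)"
  shows "mult_op \<theta> \<phi> F \<in> borel_measurable lebesgue"
proof -
  have "(\<lambda>\<xi>. (\<lambda>x. cnj (chirp \<theta> x) * F x) (\<xi> rmod frft_period \<theta>)) \<in> borel_measurable lebesgue"
    using assms unfolding frft_cell_def
    by (intro measurable_rmod frft_period_pos[OF s] borel_measurable_times borel_measurable_cnj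
        measurable_restrict_space1[OF chirp_measurable])
  then show ?thesis
    unfolding mult_op_eq[abs_def] by (intro borel_measurable_times[OF _ frft_measurable[OF s \<phi>]])
qed

text \<open>
  In the periodization of \<open>\<bar>mult_op F\<bar>\<^sup>2\<close> the factor \<open>\<bar>F\<bar>\<^sup>2\<close> comes out of the sum by periodicity, and
  what remains is \<open>G\<close>.
\<close>

lemma nn_integral_mult_op:
  assumes F: "F \<in> borel_measurable (frft_cell \<theta>)"
  shows "(\<integral>\<^sup>+\<xi>. ennreal ((cmod (mult_op \<theta> \<phi> F \<xi>))\<^sup>2) \<partial>lebesgue)
    = (\<integral>\<^sup>+\<xi>. ennreal ((cmod (F \<xi>))\<^sup>2) * G_fun \<theta> \<phi> \<xi> \<partial>frft_cell \<theta>)"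
proof -
  define T where "T = frft_period \<theta>"
  have T: "0 < T" unfolding T_def by (rule frft_period_pos[OF s])
  have "(\<integral>\<^sup>+\<xi>. ennreal ((cmod (mult_op \<theta> \<phi> F \<xi>))\<^sup>2) \<partial>lebesgue)
      = (\<integral>\<^sup>+s. (\<Sum>\<^sub>\<infinity>n::int. ennreal ((cmod (mult_op \<theta> \<phi> F (s + of_int n * T)))\<^sup>2)) \<partial>lebesgue_on {0..T})"
    by (rule nn_integral_periodization[OF _ T]) (use mult_op_measurable[OF F] in measurable)
  also have "\<dots> = (\<integral>\<^sup>+\<xi>. ennreal ((cmod (F \<xi>))\<^sup>2) * G_fun \<theta> \<phi> \<xi> \<partial>lebesgue_on {0..T})"
  proof (rule nn_integral_cong_AE)
    have "AE s in lebesgue. s \<notin> {T}"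
      by (rule AE_not_in) (auto simp flip: negligible_iff_null_sets)
    then have "AE s in lebesgue_on {0..T}. s \<in> {0..<T}"
      by (subst AE_restrict_space_iff) (auto elim!: eventually_mono)
    then show "AE s in lebesgue_on {0..T}. (\<Sum>\<^sub>\<infinity>n::int. ennreal ((cmod (mult_op \<theta> \<phi> F (s + of_int n * T)))\<^sup>2))
        = ennreal ((cmod (F s))\<^sup>2) * G_fun \<theta> \<phi> s"
    proof eventually_elim
      case (elim s)
      have "(s + of_int n * T) rmod T = s" for n :: int
        by (rule rmod_unique[where n = n]) (use elim T in auto)
      then have "ennreal ((cmod (mult_op \<theta> \<phi> F (s + of_int n * T)))\<^sup>2)
          = ennreal ((cmod (F s))\<^sup>2) * ennreal ((cmod (frft \<theta> \<phi> (s + of_int n * T)))\<^sup>2)" for n :: int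
        by (simp add: mult_op_eq T_def[symmetric] norm_mult power_mult_distrib ennreal_mult)
      then show ?case by (simp add: infsum_ennreal_cmult G_fun_def T_def)
    qed
  qed
  finally show ?thesis by (simp add: T_def frft_cell_def)
qed

lemma mult_op_bounds:
  assumes F: "F \<in> L2 (frft_cell \<theta>)"
  shows "mult_op \<theta> \<phi> F \<in> L2 lebesgue"
    "L2norm lebesgue (mult_op \<theta> \<phi> F) \<le> sqrt B * L2norm (frft_cell \<theta>) F"
    "sqrt A * L2norm (frft_cell \<theta>) F \<le> L2norm lebesgue (mult_op \<theta> \<phi> F)"
proof -
  note [measurable] = L2_measurable[OF F]
  have GA: "AE \<xi> in frft_cell \<theta>. ennreal A \<le> G_fun \<theta> \<phi> \<xi>"
    and GB: "AE \<xi> in frft_cell \<theta>. G_fun \<theta> \<phi> \<xi> \<le> ennreal B"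
    using G by (auto elim: eventually_mono)
  have "(\<integral>\<^sup>+\<xi>. ennreal ((cmod (mult_op \<theta> \<phi> F \<xi>))\<^sup>2) \<partial>lebesgue)
      \<le> (\<integral>\<^sup>+\<xi>. ennreal ((cmod (F \<xi>))\<^sup>2) * ennreal B \<partial>frft_cell \<theta>)"
    unfolding nn_integral_mult_op[OF L2_measurable[OF F]]
    using GB by (intro nn_integral_mono_AE) (auto elim!: eventually_mono intro!: mult_left_mono)
  also have "\<dots> = ennreal ((L2norm (frft_cell \<theta>) F)\<^sup>2) * ennreal B"
    by (subst nn_integral_multc) (simp_all add: nn_integral_L2[OF F])
  also have "\<dots> = ennreal ((sqrt B * L2norm (frft_cell \<theta>) F)\<^sup>2)"
    using AB by (simp add: power_mult_distrib mult.commute flip: ennreal_mult)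
  finally have le: "(\<integral>\<^sup>+\<xi>. ennreal ((cmod (mult_op \<theta> \<phi> F \<xi>))\<^sup>2) \<partial>lebesgue)
      \<le> ennreal ((sqrt B * L2norm (frft_cell \<theta>) F)\<^sup>2)" .
  have nonneg: "0 \<le> sqrt B * L2norm (frft_cell \<theta>) F" using AB by simp
  note L = L2_I_nn[OF mult_op_measurable[OF L2_measurable[OF F]] le nonneg]
  show "mult_op \<theta> \<phi> F \<in> L2 lebesgue"
    "L2norm lebesgue (mult_op \<theta> \<phi> F) \<le> sqrt B * L2norm (frft_cell \<theta>) F" by (rule L)+
  have "ennreal ((sqrt A * L2norm (frft_cell \<theta>) F)\<^sup>2) = ennreal ((L2norm (frft_cell \<theta>) F)\<^sup>2) * ennreal A"
    using AB by (simp add: power_mult_distrib mult.commute flip: ennreal_mult)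
  also have "\<dots> = (\<integral>\<^sup>+\<xi>. ennreal ((cmod (F \<xi>))\<^sup>2) * ennreal A \<partial>frft_cell \<theta>)"
    by (subst nn_integral_multc) (simp_all add: nn_integral_L2[OF F])
  also have "\<dots> \<le> (\<integral>\<^sup>+\<xi>. ennreal ((cmod (mult_op \<theta> \<phi> F \<xi>))\<^sup>2) \<partial>lebesgue)"
    unfolding nn_integral_mult_op[OF L2_measurable[OF F]]
    using GA by (intro nn_integral_mono_AE) (auto elim!: eventually_mono intro!: mult_left_mono)
  also have "\<dots> = ennreal ((L2norm lebesgue (mult_op \<theta> \<phi> F))\<^sup>2)" by (rule nn_integral_L2[OF L(1)])
  finally have "(sqrt A * L2norm (frft_cell \<theta>) F)\<^sup>2 \<le> (L2norm lebesgue (mult_op \<theta> \<phi> F))\<^sup>2"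
    by (subst (asm) ennreal_le_iff) auto
  then show "sqrt A * L2norm (frft_cell \<theta>) F \<le> L2norm lebesgue (mult_op \<theta> \<phi> F)"
    by (rule power2_le_imp_le) simp
qed

lemma mult_op_tendsto:
  assumes P: "L2_tendsto (frft_cell \<theta>) P F Q"
  shows "L2_tendsto lebesgue (\<lambda>i. mult_op \<theta> \<phi> (P i)) (mult_op \<theta> \<phi> F) Q"
proof -
  have F: "F \<in> L2 (frft_cell \<theta>)" and ev: "\<forall>\<^sub>F i in Q. P i \<in> L2 (frft_cell \<theta>)"
    and lim: "((\<lambda>i. L2norm (frft_cell \<theta>) (\<lambda>x. P i x - F x)) \<longlongrightarrow> 0) Q"
    using P by (auto simp: L2_tendsto_def)
  from tendsto_mult_left[OF lim, of "sqrt B"]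
  have lim': "((\<lambda>i. sqrt B * L2norm (frft_cell \<theta>) (\<lambda>x. P i x - F x)) \<longlongrightarrow> 0) Q" by simp
  have "((\<lambda>i. L2norm lebesgue (\<lambda>\<xi>. mult_op \<theta> \<phi> (P i) \<xi> - mult_op \<theta> \<phi> F \<xi>)) \<longlongrightarrow> 0) Q"
  proof (rule Lim_null_comparison[OF _ lim'])
    show "\<forall>\<^sub>F i in Q. norm (L2norm lebesgue (\<lambda>\<xi>. mult_op \<theta> \<phi> (P i) \<xi> - mult_op \<theta> \<phi> F \<xi>))
        \<le> sqrt B * L2norm (frft_cell \<theta>) (\<lambda>x. P i x - F x)"
      using ev
    proof eventually_elim
      case (elim i)
      show ?case
        using mult_op_bounds(2)[OF L2_diff[OF elim F]] by (simp add: mult_op_diff[abs_def])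
    qed
  qed
  moreover have "\<forall>\<^sub>F i in Q. mult_op \<theta> \<phi> (P i) \<in> L2 lebesgue"
    using ev by eventually_elim (rule mult_op_bounds(1))
  ultimately show ?thesis by (simp add: L2_tendsto_def mult_op_bounds(1)[OF F])
qed

end

section \<open>The synthesis operator\<close>

context frft_generator
begin

abbreviation K :: "int \<Rightarrow> real \<Rightarrow> complex" where "K n \<equiv> frft_kernel \<theta> (of_int n)"

abbreviation cell :: "real measure" where "cell \<equiv> frft_cell \<theta>"

text \<open>
  The generators, rescaled by unimodular constants so that \<open>J F\<close> is exactly the series
  \<open>\<Sum> \<langle>F, K\<^sub>n\<rangle> W\<^sub>n\<close>.
\<close>

definition W :: "int \<Rightarrow> real \<Rightarrow> complex" where
  "W n t = chirp \<theta> (of_int n) * V_gen \<theta> \<phi> n t"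

lemma K_basis: "L2_orthonormal_basis cell K"
  by (rule frft_kernel_orthonormal_basis[OF s])

lemma K_orthonormal: "L2_orthonormal cell K"
  using K_basis by (simp add: L2_orthonormal_basis_def)

lemma K_L2: "K n \<in> L2 cell"
  by (rule orthonormal_L2[OF K_orthonormal])

lemma W_L2: "W n \<in> L2 lebesgue"
  unfolding W_def[abs_def] by (intro L2_cmult V_gen_L2 \<phi>)

text \<open>
  The exponential in \<open>K n\<close> already has period \<open>\<Delta>\<close>, because \<open>b \<Delta> = \<plusminus> 2 \<pi>\<close>; replacing \<open>\<xi>\<close> by its
  residue changes nothing.
\<close>

lemma mult_op_K:
  "mult_op \<theta> \<phi> (K n) \<xi>
    = chirp \<theta> (of_int n) * (frft_const \<theta> * cis (- (frft_b \<theta> * of_int n * \<xi>)) * frft \<theta> \<phi> \<xi>)"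
proof -
  define T where "T = frft_period \<theta>"
  have T: "0 < T" unfolding T_def by (rule frft_period_pos[OF s])
  define m where "m = \<lfloor>\<xi> / T\<rfloor>"
  define r where "r = \<xi> rmod T"
  have r: "r = \<xi> - of_int m * T"
    unfolding r_def by (rule rmod_cell[OF T]) (simp add: floor_cell[OF T] m_def del: atLeastLessThan_iff)
  have bT: "frft_b \<theta> * T = 2 * pi * sgn (frft_b \<theta>)"
    using frft_b_nonzero[OF s] by (simp add: T_def frft_period_def sgn_real_def)
  have "sgn (frft_b \<theta>) \<in> \<int>" by (simp add: sgn_real_def)
  then have I: "of_int n * of_int m * sgn (frft_b \<theta>) \<in> \<int>" by (intro Ints_mult) auto
  have "- (frft_b \<theta> * of_int n * r) = - (frft_b \<theta> * of_int n * \<xi>) + of_int n * of_int m * (frft_b \<theta> * T)"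
    unfolding r by (simp add: algebra_simps)
  also have "\<dots> = - (frft_b \<theta> * of_int n * \<xi>) + 2 * pi * (of_int n * of_int m * sgn (frft_b \<theta>))"
    unfolding bT by (simp add: mult_ac)
  finally have "cis (- (frft_b \<theta> * of_int n * r))
      = cis (- (frft_b \<theta> * of_int n * \<xi>)) * cis (2 * pi * (of_int n * of_int m * sgn (frft_b \<theta>)))"
    by (simp only: cis_mult)
  also have "cis (2 * pi * (of_int n * of_int m * sgn (frft_b \<theta>))) = 1"
    by (rule cis_multiple_2pi[OF I])
  finally have per: "cis (- (frft_b \<theta> * of_int n * r)) = cis (- (frft_b \<theta> * of_int n * \<xi>))" by simp
  have "mult_op \<theta> \<phi> (K n) \<xi> = cnj (chirp \<theta> r) * chirp \<theta> r * (frft_const \<theta> * chirp \<theta> (of_int n)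
      * cis (- (frft_b \<theta> * of_int n * r)) * frft \<theta> \<phi> \<xi>)"
    by (simp add: mult_op_eq T_def[symmetric] r_def[symmetric] frft_kernel_eq mult_ac)
  then show ?thesis unfolding per by (simp add: mult_ac)
qed

lemma frft_W: "AE \<xi> in lebesgue. frft \<theta> (W n) \<xi> = mult_op \<theta> \<phi> (K n) \<xi>"
  unfolding W_def[abs_def] mult_op_K
  using frft_V_gen[OF s \<phi>, of n] frft_cmult[OF s V_gen_L2[OF \<phi>, of \<theta> n], of "chirp \<theta> (of_int n)"]
  by eventually_elim simp

lemma frft_W_sum:
  assumes "finite S"
  shows "AE \<xi> in lebesgue. frft \<theta> (\<lambda>t. \<Sum>n\<in>S. a n * W n t) \<xi> = mult_op \<theta> \<phi> (\<lambda>x. \<Sum>n\<in>S. a n * K n x) \<xi>"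
proof -
  have "AE \<xi> in lebesgue. frft \<theta> (\<lambda>t. \<Sum>n\<in>S. a n * W n t) \<xi> = (\<Sum>n\<in>S. frft \<theta> (\<lambda>t. a n * W n t) \<xi>)"
    by (rule frft_sum[OF s L2_cmult[OF W_L2]])
  moreover have "AE \<xi> in lebesgue. \<forall>n\<in>S. frft \<theta> (\<lambda>t. a n * W n t) \<xi> = a n * mult_op \<theta> \<phi> (K n) \<xi>"
  proof (rule AE_finite_allI[OF assms])
    fix n
    show "AE \<xi> in lebesgue. frft \<theta> (\<lambda>t. a n * W n t) \<xi> = a n * mult_op \<theta> \<phi> (K n) \<xi>"
      using frft_cmult[OF s W_L2[of n], of "a n"] frft_W[of n] by eventually_elim simp
  qed
  ultimately show ?thesis
    by eventually_elim (simp add: mult_op_sum mult_op_cmult)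
qed

lemma C_summable: "(\<lambda>n::int. (cmod (chirp_mod \<theta> \<phi> (t - of_int n)))\<^sup>2) summable_on UNIV"
  using C unfolding C_fun_def by (intro summable_on_of_ennreal_finite) auto

lemma semi_conv_term:
  "d n * W n t = frft_const \<theta> * cnj (chirp \<theta> t) * (chirp_mod_seq \<theta> d n * chirp_mod \<theta> \<phi> (t - of_int n))"
  by (simp add: W_def V_gen_def chirp_mod_seq_def mult_ac)

text \<open>
  The coefficients are square-summable by Bessel's inequality and the translates of \<open>\<phi>\<close> at \<open>t\<close> are
  square-summable because \<open>C_fun \<theta> \<phi> t\<close> is finite, so the series converges absolutely at every \<open>t\<close>.
\<close>

lemma J_has_sum:
  assumes F: "F \<in> L2 cell"
  shows "((\<lambda>n. L2inner cell F (K n) * W n t) has_sum J_op \<theta> \<phi> F t) UNIV"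
proof -
  define d where "d n = L2inner cell F (K n)" for n
  have "(\<lambda>n. (cmod (chirp_mod_seq \<theta> d n))\<^sup>2) summable_on UNIV"
    using Bessel_summable[OF K_orthonormal F] by (simp add: chirp_mod_seq_def norm_mult d_def)
  from has_sum_infsum[OF summable_on_mult_of_squares[OF this C_summable]]
  have "((\<lambda>n. d n * W n t) has_sum frft_const \<theta> * cnj (chirp \<theta> t)
      * (\<Sum>\<^sub>\<infinity>n. chirp_mod_seq \<theta> d n * chirp_mod \<theta> \<phi> (t - of_int n))) UNIV"
    unfolding semi_conv_term by (rule has_sum_cmult_right)
  then show ?thesis by (simp add: J_op_def semi_conv_def d_def[abs_def])
qed

text \<open>
  The transforms of the partial sums of \<open>J F\<close> are \<open>mult_op\<close> of the partial sums of \<open>F\<close>, and these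
  converge in the mean by the upper bound on \<open>G\<close>. As the transform is an isometry, the partial sums
  of \<open>J F\<close> are a Cauchy sequence; their pointwise limit is \<open>J F\<close>, so they converge to it in the mean as
  well, and both statements follow.
\<close>

lemma J_tendsto:
  assumes F: "F \<in> L2 cell"
  shows "L2_tendsto lebesgue (\<lambda>N t. \<Sum>n\<in>{- int N..int N}. L2inner cell F (K n) * W n t) (J_op \<theta> \<phi> F) sequentially"
    (is "L2_tendsto _ ?J _ _")
    and frft_J: "AE \<xi> in lebesgue. frft \<theta> (J_op \<theta> \<phi> F) \<xi> = mult_op \<theta> \<phi> F \<xi>"
proof -
  let ?P = "\<lambda>N x. \<Sum>n\<in>{- int N..int N}. L2inner cell F (K n) * K n x"
  have P: "L2_tendsto cell ?P F sequentially"
    by (rule L2_tendsto_compose[OF orthonormal_basis_expansion[OF K_basis F] filterlim_symmetric_intervals])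
  have PL: "?P N \<in> L2 cell" for N by (rule orthonormal_sum_L2[OF K_orthonormal])
  have JL: "?J N \<in> L2 lebesgue" for N by (intro L2_sum L2_cmult W_L2)
  have mP: "L2_tendsto lebesgue (\<lambda>N. mult_op \<theta> \<phi> (?P N)) (mult_op \<theta> \<phi> F) sequentially"
    by (rule mult_op_tendsto[OF P])
  have fJ: "AE \<xi> in lebesgue. frft \<theta> (?J N) \<xi> = mult_op \<theta> \<phi> (?P N) \<xi>" for N
    by (rule frft_W_sum) simp
  have CJ: "L2_Cauchy lebesgue ?J"
    unfolding L2_Cauchy_def
  proof (intro conjI allI impI JL)
    fix e :: real assume "0 < e"
    have eq: "L2norm lebesgue (\<lambda>t. ?J m t - ?J n t)
        = L2norm lebesgue (\<lambda>\<xi>. mult_op \<theta> \<phi> (?P m) \<xi> - mult_op \<theta> \<phi> (?P n) \<xi>)" for m n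
      unfolding L2norm_frft_diff[OF s JL JL, symmetric]
    proof (rule L2norm_cong_AE)
      show "AE \<xi> in lebesgue. frft \<theta> (?J m) \<xi> - frft \<theta> (?J n) \<xi>
          = mult_op \<theta> \<phi> (?P m) \<xi> - mult_op \<theta> \<phi> (?P n) \<xi>"
        using fJ[of m] fJ[of n] by eventually_elim simp
    qed (intro borel_measurable_diff frft_measurable s JL mult_op_measurable L2_measurable[OF PL])+
    have "L2_Cauchy lebesgue (\<lambda>N. mult_op \<theta> \<phi> (?P N))"
      by (rule L2_tendsto_imp_Cauchy[OF mP mult_op_bounds(1)[OF PL]])
    then show "\<exists>N. \<forall>m\<ge>N. \<forall>n\<ge>N. L2norm lebesgue (\<lambda>t. ?J m t - ?J n t) \<le> e"
      using \<open>0 < e\<close> unfolding eq L2_Cauchy_def by blast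
  qed
  have pw: "(\<lambda>N. ?J N t) \<longlonglongrightarrow> J_op \<theta> \<phi> F t" for t
    using filterlim_compose[OF J_has_sum[OF F, of t, unfolded has_sum_def] filterlim_symmetric_intervals] .
  have "J_op \<theta> \<phi> F \<in> borel_measurable lebesgue"
    by (rule borel_measurable_LIMSEQ_metric[OF L2_measurable[OF JL] pw])
  then show J: "L2_tendsto lebesgue ?J (J_op \<theta> \<phi> F) sequentially"
    using CJ pw by (intro L2_Cauchy_pointwise_limit) auto
  show "AE \<xi> in lebesgue. frft \<theta> (J_op \<theta> \<phi> F) \<xi> = mult_op \<theta> \<phi> F \<xi>"
  proof (rule L2_tendsto_unique[OF sequentially_bot _ mP])
    show "L2_tendsto lebesgue (\<lambda>N. mult_op \<theta> \<phi> (?P N)) (frft \<theta> (J_op \<theta> \<phi> F)) sequentially"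
      by (rule L2_tendsto_cong_seq[OF L2_tendsto_frft[OF s J] mult_op_measurable[OF L2_measurable[OF PL]] fJ])
  qed
qed

lemma J_L2: "F \<in> L2 cell \<Longrightarrow> J_op \<theta> \<phi> F \<in> L2 lebesgue"
  by (rule L2_tendsto_in_L2[OF J_tendsto(1)])

lemma J_bounds:
  assumes F: "F \<in> L2 cell"
  shows "L2norm lebesgue (J_op \<theta> \<phi> F) \<le> sqrt B * L2norm cell F"
    "sqrt A * L2norm cell F \<le> L2norm lebesgue (J_op \<theta> \<phi> F)"
proof -
  have "L2norm lebesgue (J_op \<theta> \<phi> F) = L2norm lebesgue (frft \<theta> (J_op \<theta> \<phi> F))"
    by (rule frft_isometry[OF s J_L2[OF F], symmetric])
  also have "\<dots> = L2norm lebesgue (mult_op \<theta> \<phi> F)"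
    by (intro L2norm_cong_AE frft_measurable s J_L2 F mult_op_measurable L2_measurable[OF F] frft_J)
  finally show "L2norm lebesgue (J_op \<theta> \<phi> F) \<le> sqrt B * L2norm cell F"
    "sqrt A * L2norm cell F \<le> L2norm lebesgue (J_op \<theta> \<phi> F)"
    using mult_op_bounds[OF F] by simp_all
qed

lemma J_add:
  assumes F: "F \<in> L2 cell" and H: "H \<in> L2 cell"
  shows "J_op \<theta> \<phi> (\<lambda>x. F x + H x) t = J_op \<theta> \<phi> F t + J_op \<theta> \<phi> H t"
proof (rule has_sum_unique)
  show "((\<lambda>n. L2inner cell (\<lambda>x. F x + H x) (K n) * W n t) has_sum J_op \<theta> \<phi> (\<lambda>x. F x + H x) t) UNIV"
    by (rule J_has_sum[OF L2_add[OF F H]])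
  show "((\<lambda>n. L2inner cell (\<lambda>x. F x + H x) (K n) * W n t) has_sum J_op \<theta> \<phi> F t + J_op \<theta> \<phi> H t) UNIV"
    using has_sum_add[OF J_has_sum[OF F, of t] J_has_sum[OF H, of t]]
    by (simp add: L2inner_add_left[OF F H K_L2] distrib_right)
qed

lemma J_cmult:
  assumes F: "F \<in> L2 cell"
  shows "J_op \<theta> \<phi> (\<lambda>x. z * F x) t = z * J_op \<theta> \<phi> F t"
proof (rule has_sum_unique)
  show "((\<lambda>n. L2inner cell (\<lambda>x. z * F x) (K n) * W n t) has_sum J_op \<theta> \<phi> (\<lambda>x. z * F x) t) UNIV"
    by (rule J_has_sum[OF L2_cmult[OF F]])
  show "((\<lambda>n. L2inner cell (\<lambda>x. z * F x) (K n) * W n t) has_sum z * J_op \<theta> \<phi> F t) UNIV"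
    using has_sum_cmult_right[OF J_has_sum[OF F, of t], of z] by (simp add: L2inner_cmult_left mult.assoc)
qed

lemma J_diff:
  assumes F: "F \<in> L2 cell" and H: "H \<in> L2 cell"
  shows "J_op \<theta> \<phi> (\<lambda>x. F x - H x) t = J_op \<theta> \<phi> F t - J_op \<theta> \<phi> H t"
  using J_add[OF F L2_cmult[OF H, of "-1"], of t] J_cmult[OF H, of "-1" t] by simp

lemma J_cong_AE:
  assumes F: "F \<in> L2 cell" and H: "H \<in> L2 cell" and eq: "AE x in cell. F x = H x"
  shows "J_op \<theta> \<phi> F = J_op \<theta> \<phi> H"
  using L2inner_cong_AE_left[OF L2_measurable[OF F] L2_measurable[OF H] L2_measurable[OF K_L2] eq]
  by (simp add: J_op_def)

lemma J_inj_AE: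
  assumes F: "F \<in> L2 cell" and H: "H \<in> L2 cell" and eq: "AE t in lebesgue. J_op \<theta> \<phi> F t = J_op \<theta> \<phi> H t"
  shows "AE x in cell. F x = H x"
proof -
  note D = L2_diff[OF F H]
  have "L2norm lebesgue (J_op \<theta> \<phi> (\<lambda>x. F x - H x)) = 0"
    using eq by (subst L2norm_eq_0_iff[OF J_L2[OF D]]) (simp add: J_diff[OF F H])
  then have "sqrt A * L2norm cell (\<lambda>x. F x - H x) \<le> sqrt A * 0" using J_bounds(2)[OF D] by simp
  then have "L2norm cell (\<lambda>x. F x - H x) \<le> 0"
    by (rule mult_left_le_imp_le) (use AB in simp)
  then have "L2norm cell (\<lambda>x. F x - H x) = 0" by (intro antisym L2norm_nonneg)
  then show ?thesis using L2norm_eq_0_iff[OF D] by simp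
qed

lemma J_kernel_sum:
  assumes "finite S"
  shows "J_op \<theta> \<phi> (\<lambda>x. \<Sum>n\<in>S. a n * K n x) t = (\<Sum>n\<in>S. a n * W n t)"
proof (rule has_sum_unique)
  show "((\<lambda>m. L2inner cell (\<lambda>x. \<Sum>n\<in>S. a n * K n x) (K m) * W m t)
      has_sum J_op \<theta> \<phi> (\<lambda>x. \<Sum>n\<in>S. a n * K n x) t) UNIV"
    by (rule J_has_sum[OF orthonormal_sum_L2[OF K_orthonormal]])
  show "((\<lambda>m. L2inner cell (\<lambda>x. \<Sum>n\<in>S. a n * K n x) (K m) * W m t) has_sum (\<Sum>n\<in>S. a n * W n t)) UNIV"
    by (rule has_sum_finite_neutralI[OF assms])
       (auto simp: L2inner_orthonormal_sum[OF K_orthonormal assms] intro!: sum.cong)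
qed

lemma J_in_V:
  assumes F: "F \<in> L2 cell" shows "J_op \<theta> \<phi> F \<in> V_space \<theta> \<phi>"
  unfolding V_space_def mem_Collect_eq
proof (intro conjI allI impI J_L2[OF F])
  fix e :: real assume "0 < e"
  let ?J = "\<lambda>N t. \<Sum>n\<in>{- int N..int N}. L2inner cell F (K n) * W n t"
  have "(\<lambda>N. L2norm lebesgue (\<lambda>t. ?J N t - J_op \<theta> \<phi> F t)) \<longlonglongrightarrow> 0"
    using J_tendsto[OF F] by (simp add: L2_tendsto_def)
  from order_tendstoD(2)[OF this \<open>0 < e\<close>]
  obtain N where "L2norm lebesgue (\<lambda>t. ?J N t - J_op \<theta> \<phi> F t) < e"
    by (auto dest: eventually_happens)
  then show "\<exists>S d. finite S \<and> L2norm lebesgue (\<lambda>t. J_op \<theta> \<phi> F t - (\<Sum>n\<in>S. d n * V_gen \<theta> \<phi> n t)) < e"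
    by (intro exI[of _ "{- int N..int N}"] exI[of _ "\<lambda>n. L2inner cell F (K n) * chirp \<theta> (of_int n)"])
       (simp add: W_def L2norm_minus_commute[of lebesgue "J_op \<theta> \<phi> F"] mult.assoc)
qed

text \<open>
  Approximate \<open>f\<close> by finite combinations of generators, each of which is \<open>J F\<^sub>k\<close> for a combination
  \<open>F\<^sub>k\<close> of kernel functions. By the lower bound the \<open>F\<^sub>k\<close> form a Cauchy sequence, and \<open>J\<close> maps their limit
  to \<open>f\<close>.
\<close>

lemma J_onto_V:
  assumes f: "f \<in> V_space \<theta> \<phi>"
  obtains F where "F \<in> L2 cell" "AE t in lebesgue. J_op \<theta> \<phi> F t = f t"
proof -
  have fL: "f \<in> L2 lebesgue" using f by (simp add: V_space_def)
  have "\<forall>k::nat. \<exists>S d. finite S \<and> L2norm lebesgue (\<lambda>t. f t - (\<Sum>n\<in>S. d n * V_gen \<theta> \<phi> n t)) < 1 / (real k + 1)"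
  proof
    fix k :: nat
    have "0 < 1 / (real k + 1)" by simp
    then show "\<exists>S d. finite S \<and> L2norm lebesgue (\<lambda>t. f t - (\<Sum>n\<in>S. d n * V_gen \<theta> \<phi> n t)) < 1 / (real k + 1)"
      using f unfolding V_space_def by blast
  qed
  then obtain S d where fS: "\<And>k. finite (S k)"
    and Sd: "\<And>k. L2norm lebesgue (\<lambda>t. f t - (\<Sum>n\<in>S k. d k n * V_gen \<theta> \<phi> n t)) < 1 / (real k + 1)"
    by metis
  define F where "F k x = (\<Sum>n\<in>S k. d k n * cnj (chirp \<theta> (of_int n)) * K n x)" for k x
  have FL: "F k \<in> L2 cell" for k unfolding F_def[abs_def] by (rule orthonormal_sum_L2[OF K_orthonormal])
  have JF: "J_op \<theta> \<phi> (F k) = (\<lambda>t. \<Sum>n\<in>S k. d k n * V_gen \<theta> \<phi> n t)" for k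
  proof
    fix t
    have "d k n * cnj (chirp \<theta> (of_int n)) * W n t = d k n * V_gen \<theta> \<phi> n t" for n
    proof -
      have "d k n * cnj (chirp \<theta> (of_int n)) * W n t
          = cnj (chirp \<theta> (of_int n)) * chirp \<theta> (of_int n) * (d k n * V_gen \<theta> \<phi> n t)"
        by (simp only: W_def mult_ac)
      then show ?thesis by simp
    qed
    then show "J_op \<theta> \<phi> (F k) t = (\<Sum>n\<in>S k. d k n * V_gen \<theta> \<phi> n t)"
      unfolding F_def[abs_def] J_kernel_sum[OF fS] by (simp only:)
  qed
  have lim: "L2_tendsto lebesgue (\<lambda>k. J_op \<theta> \<phi> (F k)) f sequentially"
  proof -
    have "(\<lambda>k. L2norm lebesgue (\<lambda>t. J_op \<theta> \<phi> (F k) t - f t)) \<longlonglongrightarrow> 0"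
    proof (rule Lim_null_comparison)
      show "\<forall>\<^sub>F k in sequentially. norm (L2norm lebesgue (\<lambda>t. J_op \<theta> \<phi> (F k) t - f t)) \<le> 1 / (real k + 1)"
      proof (intro always_eventually allI)
        fix k
        show "norm (L2norm lebesgue (\<lambda>t. J_op \<theta> \<phi> (F k) t - f t)) \<le> 1 / (real k + 1)"
          using Sd[of k] unfolding JF L2norm_minus_commute[of lebesgue "\<lambda>t. \<Sum>n\<in>S k. d k n * V_gen \<theta> \<phi> n t" f]
          by simp
      qed
      show "(\<lambda>k. 1 / (real k + 1)) \<longlonglongrightarrow> 0"
        using LIMSEQ_inverse_real_of_nat by (simp add: inverse_eq_divide add.commute)
    qed
    then show ?thesis by (simp add: L2_tendsto_def fL J_L2 FL)
  qed
  have "L2_Cauchy cell F"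
    unfolding L2_Cauchy_def
  proof (intro conjI allI impI FL)
    fix e :: real assume "0 < e"
    then have "0 < sqrt A * e" using AB by simp
    moreover have "L2_Cauchy lebesgue (\<lambda>k. J_op \<theta> \<phi> (F k))"
      by (rule L2_tendsto_imp_Cauchy[OF lim J_L2[OF FL]])
    ultimately obtain N where N: "\<And>m n. m \<ge> N \<Longrightarrow> n \<ge> N \<Longrightarrow>
        L2norm lebesgue (\<lambda>t. J_op \<theta> \<phi> (F m) t - J_op \<theta> \<phi> (F n) t) \<le> sqrt A * e"
      unfolding L2_Cauchy_def by blast
    have "L2norm cell (\<lambda>x. F m x - F n x) \<le> e" if "m \<ge> N" "n \<ge> N" for m n
    proof -
      have "sqrt A * L2norm cell (\<lambda>x. F m x - F n x) \<le> L2norm lebesgue (J_op \<theta> \<phi> (\<lambda>x. F m x - F n x))"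
        by (rule J_bounds(2)[OF L2_diff[OF FL FL]])
      also have "\<dots> \<le> sqrt A * e" using N[OF that] by (simp add: J_diff[OF FL FL, abs_def])
      finally show ?thesis using AB by simp
    qed
    then show "\<exists>N. \<forall>m\<ge>N. \<forall>n\<ge>N. L2norm cell (\<lambda>x. F m x - F n x) \<le> e" by blast
  qed
  then obtain H where H: "L2_tendsto cell F H sequentially" by (rule L2_complete)
  have HL: "H \<in> L2 cell" by (rule L2_tendsto_in_L2[OF H])
  have "L2_tendsto lebesgue (\<lambda>k. J_op \<theta> \<phi> (F k)) (J_op \<theta> \<phi> H) sequentially"
  proof -
    have lim: "(\<lambda>k. sqrt B * L2norm cell (\<lambda>x. F k x - H x)) \<longlonglongrightarrow> 0"
      using H by (intro tendsto_mult_right_zero) (simp add: L2_tendsto_def)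
    have "(\<lambda>k. L2norm lebesgue (\<lambda>t. J_op \<theta> \<phi> (F k) t - J_op \<theta> \<phi> H t)) \<longlonglongrightarrow> 0"
    proof (rule Lim_null_comparison[OF _ lim])
      show "\<forall>\<^sub>F k in sequentially. norm (L2norm lebesgue (\<lambda>t. J_op \<theta> \<phi> (F k) t - J_op \<theta> \<phi> H t))
          \<le> sqrt B * L2norm cell (\<lambda>x. F k x - H x)"
        using J_bounds(1)[OF L2_diff[OF FL HL]]
        by (intro always_eventually allI) (simp add: J_diff[OF FL HL, abs_def])
    qed
    then show ?thesis by (simp add: L2_tendsto_def J_L2 FL HL)
  qed
  from L2_tendsto_unique[OF sequentially_bot this lim] show ?thesis by (rule that[OF HL])
qed

text \<open>
  The inverse picks a preimage of \<open>f\<close>. Injectivity of \<open>J\<close> up to null sets makes the choice immaterial, which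
  gives linearity: \<open>S f + S g\<close> is also a preimage of \<open>f + g\<close>.
\<close>

theorem J_isomorphism:
  "L2_isomorphism cell (L2 cell) lebesgue (V_space \<theta> \<phi>) (J_op \<theta> \<phi>)"
proof -
  have J: "L2_bounded_linear cell (L2 cell) lebesgue (V_space \<theta> \<phi>) (J_op \<theta> \<phi>)"
    unfolding L2_bounded_linear_def
  proof (intro conjI ballI allI impI)
    show "\<exists>C. \<forall>F\<in>L2 cell. L2norm lebesgue (J_op \<theta> \<phi> F) \<le> C * L2norm cell F"
      using J_bounds(1) by blast
    fix F assume F: "F \<in> L2 cell"
    show "J_op \<theta> \<phi> F \<in> V_space \<theta> \<phi>" by (rule J_in_V[OF F])
    show "AE t in lebesgue. J_op \<theta> \<phi> (\<lambda>x. z * F x) t = z * J_op \<theta> \<phi> F t" for z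
      by (intro AE_I2 J_cmult F)
    fix H assume H: "H \<in> L2 cell"
    show "AE t in lebesgue. J_op \<theta> \<phi> (\<lambda>x. F x + H x) t = J_op \<theta> \<phi> F t + J_op \<theta> \<phi> H t"
      by (intro AE_I2 J_add F H)
    assume "AE x in cell. F x = H x"
    from J_cong_AE[OF F H this] show "AE t in lebesgue. J_op \<theta> \<phi> F t = J_op \<theta> \<phi> H t" by simp
  qed
  define S where "S f = (SOME F. F \<in> L2 cell \<and> (AE t in lebesgue. J_op \<theta> \<phi> F t = f t))" for f
  have S: "S f \<in> L2 cell \<and> (AE t in lebesgue. J_op \<theta> \<phi> (S f) t = f t)"
    if "F \<in> L2 cell" "AE t in lebesgue. J_op \<theta> \<phi> F t = f t" for F f
    unfolding S_def by (rule someI[of _ F]) (use that in simp)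
  have SV: "S f \<in> L2 cell" "AE t in lebesgue. J_op \<theta> \<phi> (S f) t = f t" if f: "f \<in> V_space \<theta> \<phi>" for f
  proof -
    obtain F where "F \<in> L2 cell" "AE t in lebesgue. J_op \<theta> \<phi> F t = f t" by (rule J_onto_V[OF f])
    from S[OF this] show "S f \<in> L2 cell" "AE t in lebesgue. J_op \<theta> \<phi> (S f) t = f t" by simp_all
  qed
  have "L2_bounded_linear lebesgue (V_space \<theta> \<phi>) cell (L2 cell) S"
    unfolding L2_bounded_linear_def
  proof (intro conjI ballI allI impI)
    fix f assume f: "f \<in> V_space \<theta> \<phi>"
    show "S f \<in> L2 cell" by (rule SV[OF f])
    fix g assume g: "g \<in> V_space \<theta> \<phi>"
    show "AE x in cell. S f x = S g x" if "AE t in lebesgue. f t = g t"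
    proof (rule J_inj_AE[OF SV(1)[OF f] SV(1)[OF g]])
      show "AE t in lebesgue. J_op \<theta> \<phi> (S f) t = J_op \<theta> \<phi> (S g) t"
        using that SV(2)[OF f] SV(2)[OF g] by eventually_elim simp
    qed
    have fg: "AE t in lebesgue. J_op \<theta> \<phi> (\<lambda>x. S f x + S g x) t = f t + g t"
      using SV(2)[OF f] SV(2)[OF g] by eventually_elim (simp add: J_add SV f g)
    note Sfg = S[OF L2_add[OF SV(1)[OF f] SV(1)[OF g]] fg]
    show "AE x in cell. S (\<lambda>x. f x + g x) x = S f x + S g x"
    proof (rule J_inj_AE[OF _ L2_add[OF SV(1)[OF f] SV(1)[OF g]]])
      show "AE t in lebesgue. J_op \<theta> \<phi> (S (\<lambda>x. f x + g x)) t = J_op \<theta> \<phi> (\<lambda>x. S f x + S g x) t"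
        using fg conjunct2[OF Sfg] by eventually_elim simp
    qed (use Sfg in simp)
  next
    fix z f assume f: "f \<in> V_space \<theta> \<phi>"
    have zf: "AE t in lebesgue. J_op \<theta> \<phi> (\<lambda>x. z * S f x) t = z * f t"
      using SV(2)[OF f] by eventually_elim (simp add: J_cmult SV f)
    note Szf = S[OF L2_cmult[OF SV(1)[OF f]] zf]
    show "AE x in cell. S (\<lambda>x. z * f x) x = z * S f x"
    proof (rule J_inj_AE[OF _ L2_cmult[OF SV(1)[OF f]]])
      show "AE t in lebesgue. J_op \<theta> \<phi> (S (\<lambda>x. z * f x)) t = J_op \<theta> \<phi> (\<lambda>x. z * S f x) t"
        using zf conjunct2[OF Szf] by eventually_elim simp
    qed (use Szf in simp)
  next
    show "\<exists>Q. \<forall>f\<in>V_space \<theta> \<phi>. L2norm cell (S f) \<le> Q * L2norm lebesgue f"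
    proof (intro exI[of _ "1 / sqrt A"] ballI)
      fix f assume f: "f \<in> V_space \<theta> \<phi>"
      have "sqrt A * L2norm cell (S f) \<le> L2norm lebesgue (J_op \<theta> \<phi> (S f))"
        by (rule J_bounds(2)[OF SV(1)[OF f]])
      also have "\<dots> = L2norm lebesgue f"
      proof (rule L2norm_cong_AE[OF L2_measurable[OF J_L2[OF SV(1)[OF f]]] _ SV(2)[OF f]])
        show "f \<in> borel_measurable lebesgue" using f by (simp add: V_space_def L2_measurable)
      qed
      finally show "L2norm cell (S f) \<le> 1 / sqrt A * L2norm lebesgue f"
        using AB by (simp add: field_simps)
    qed
  qed
  moreover have "AE x in cell. S (J_op \<theta> \<phi> F) x = F x" if F: "F \<in> L2 cell" for F
    by (rule J_inj_AE[OF SV(1)[OF J_in_V[OF F]] F SV(2)[OF J_in_V[OF F]]])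
  ultimately show ?thesis
    unfolding L2_isomorphism_def using J SV(2) by (intro conjI exI[of _ S] ballI) simp_all
qed

text \<open>
  The Zak series is an orthogonal series with square-summable coefficients, so it converges in the mean and
  can be paired with \<open>F\<close> term by term; the result is the series of \<open>J F\<close> at \<open>t\<close>.
\<close>

lemma J_zak:
  assumes F: "F \<in> L2 cell"
  shows "J_op \<theta> \<phi> F t = L2inner cell F (\<lambda>\<xi>. chirp \<theta> t * cnj (frft_const \<theta> * zak \<theta> \<phi> t \<xi>))"
proof -
  let ?c = "\<lambda>n::int. chirp_mod \<theta> \<phi> (t - of_int n) * chirp \<theta> (of_int n)"
  let ?Z = "\<lambda>S \<xi>. \<Sum>n\<in>S. ?c n * cnj (K n \<xi>)"
  note on = L2_orthonormal_cnj[OF K_orthonormal]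
  have "(\<lambda>n. (cmod (?c n))\<^sup>2) summable_on UNIV" using C_summable[of t] by (simp add: norm_mult)
  then obtain g where "L2_tendsto cell ?Z g (finite_subsets_at_top UNIV)"
    by (rule Riesz_Fischer[OF on])
  then have Z: "L2_tendsto cell ?Z (zak \<theta> \<phi> t) (finite_subsets_at_top UNIV)"
    unfolding zak_def L2_lim_def
    by (rule someI[where P = "\<lambda>g. L2_tendsto cell ?Z g (finite_subsets_at_top UNIV)"])
  have "L2inner cell (?Z S) (\<lambda>x. cnj (F x)) = (\<Sum>n\<in>S. ?c n * L2inner cell F (K n))" for S
  proof -
    have "L2inner cell (?Z S) (\<lambda>x. cnj (F x)) = (\<Sum>n\<in>S. L2inner cell (\<lambda>\<xi>. ?c n * cnj (K n \<xi>)) (\<lambda>x. cnj (F x)))"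
      by (rule L2inner_sum_left[OF L2_cmult[OF L2_cnj[OF K_L2]] L2_cnj[OF F]])
    moreover have "L2inner cell (\<lambda>\<xi>. cnj (K n \<xi>)) (\<lambda>x. cnj (F x)) = L2inner cell F (K n)" for n
      by (simp add: L2inner_def mult.commute)
    ultimately show ?thesis by (simp only: L2inner_cmult_left)
  qed
  with tendsto_L2inner[OF Z L2_cnj[OF F]]
  have "((\<lambda>n. ?c n * L2inner cell F (K n)) has_sum L2inner cell (zak \<theta> \<phi> t) (\<lambda>x. cnj (F x))) UNIV"
    unfolding has_sum_def by simp
  then have "((\<lambda>n. frft_const \<theta> * cnj (chirp \<theta> t) * (?c n * L2inner cell F (K n))) has_sum
      frft_const \<theta> * cnj (chirp \<theta> t) * L2inner cell (zak \<theta> \<phi> t) (\<lambda>x. cnj (F x))) UNIV"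
    by (rule has_sum_cmult_right)
  then have "((\<lambda>n. L2inner cell F (K n) * W n t) has_sum
      frft_const \<theta> * cnj (chirp \<theta> t) * L2inner cell (zak \<theta> \<phi> t) (\<lambda>x. cnj (F x))) UNIV"
    unfolding semi_conv_term[of "\<lambda>n. L2inner cell F (K n)"] by (simp add: chirp_mod_seq_def mult_ac)
  then have "J_op \<theta> \<phi> F t = frft_const \<theta> * cnj (chirp \<theta> t) * L2inner cell (zak \<theta> \<phi> t) (\<lambda>x. cnj (F x))"
    using J_has_sum[OF F] has_sum_unique by blast
  also have "\<dots> = (LINT \<xi>|cell. frft_const \<theta> * cnj (chirp \<theta> t) * (zak \<theta> \<phi> t \<xi> * F \<xi>))"
    by (simp add: L2inner_def)
  also have "\<dots> = L2inner cell F (\<lambda>\<xi>. chirp \<theta> t * cnj (frft_const \<theta> * zak \<theta> \<phi> t \<xi>))"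
    unfolding L2inner_def by (intro Bochner_Integration.integral_cong refl) (simp add: mult_ac)
  finally show ?thesis .
qed

end

text \<open>
  The chirped coefficients \<open>d F n\<close> are ordinary Fourier coefficients, so the modulation replaces \<open>d F n\<close> by
  \<open>d F (n - k)\<close>, and reindexing the sum moves the shift to \<open>t\<close>.
\<close>

lemma J_op_modulation:
  fixes k :: int
  shows "chirp \<theta> t * J_op \<theta> \<phi> (\<lambda>\<xi>. F \<xi> * exp (- \<i> * of_real (frft_b \<theta> * of_int k * \<xi>))) t
    = chirp \<theta> (t - of_int k) * J_op \<theta> \<phi> F (t - of_int k)"
proof -
  define d where "d F n = chirp_mod_seq \<theta> (\<lambda>n. L2inner (frft_cell \<theta>) F (frft_kernel \<theta> (of_int n))) n" for F n
  define F' where "F' \<xi> = F \<xi> * exp (- \<i> * of_real (frft_b \<theta> * of_int k * \<xi>))" for \<xi>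
  have d_eq: "d F n = (LINT \<xi>|frft_cell \<theta>. F \<xi> * (cnj (frft_const \<theta>) * cnj (chirp \<theta> \<xi>) * cis (frft_b \<theta> * of_int n * \<xi>)))" for F n
  proof -
    have "d F n = (LINT \<xi>|frft_cell \<theta>. chirp \<theta> (of_int n) * (F \<xi> * cnj (frft_kernel \<theta> (of_int n) \<xi>)))"
      by (simp add: d_def chirp_mod_seq_def L2inner_def)
    also have "\<dots> = (LINT \<xi>|frft_cell \<theta>. F \<xi> * (cnj (frft_const \<theta>) * cnj (chirp \<theta> \<xi>) * cis (frft_b \<theta> * of_int n * \<xi>)))"
    proof (intro Bochner_Integration.integral_cong refl)
      fix \<xi>
      have "chirp \<theta> (of_int n) * (F \<xi> * cnj (frft_kernel \<theta> (of_int n) \<xi>))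
          = chirp \<theta> (of_int n) * cnj (chirp \<theta> (of_int n))
            * (F \<xi> * (cnj (frft_const \<theta>) * cnj (chirp \<theta> \<xi>) * cis (frft_b \<theta> * of_int n * \<xi>)))"
        by (simp add: frft_kernel_eq cis_cnj mult_ac)
      then show "chirp \<theta> (of_int n) * (F \<xi> * cnj (frft_kernel \<theta> (of_int n) \<xi>))
          = F \<xi> * (cnj (frft_const \<theta>) * cnj (chirp \<theta> \<xi>) * cis (frft_b \<theta> * of_int n * \<xi>))"
        by simp
    qed
    finally show ?thesis .
  qed
  have shift: "d F' n = d F (n - k)" for n
    unfolding d_eq
  proof (intro Bochner_Integration.integral_cong refl)
    fix \<xi>
    have "exp (- \<i> * of_real (frft_b \<theta> * of_int k * \<xi>)) = cis (- (frft_b \<theta> * of_int k * \<xi>))"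
      by (simp add: cis_conv_exp)
    moreover have "cis (- (frft_b \<theta> * of_int k * \<xi>)) * cis (frft_b \<theta> * of_int n * \<xi>) = cis (frft_b \<theta> * of_int (n - k) * \<xi>)"
      by (simp add: cis_mult algebra_simps)
    ultimately show "F' \<xi> * (cnj (frft_const \<theta>) * cnj (chirp \<theta> \<xi>) * cis (frft_b \<theta> * of_int n * \<xi>))
        = F \<xi> * (cnj (frft_const \<theta>) * cnj (chirp \<theta> \<xi>) * cis (frft_b \<theta> * of_int (n - k) * \<xi>))"
      by (simp add: F'_def mult_ac)
  qed
  have J: "chirp \<theta> t * J_op \<theta> \<phi> F t = frft_const \<theta> * (\<Sum>\<^sub>\<infinity>n. d F n * chirp_mod \<theta> \<phi> (t - of_int n))" for F t
  proof -
    have "chirp \<theta> t * J_op \<theta> \<phi> F t = chirp \<theta> t * cnj (chirp \<theta> t)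
        * (frft_const \<theta> * (\<Sum>\<^sub>\<infinity>n. d F n * chirp_mod \<theta> \<phi> (t - of_int n)))"
      by (simp only: J_op_def semi_conv_def d_def mult_ac)
    then show ?thesis by simp
  qed
  have "(\<Sum>\<^sub>\<infinity>n. d F' n * chirp_mod \<theta> \<phi> (t - of_int n)) = (\<Sum>\<^sub>\<infinity>n. d F n * chirp_mod \<theta> \<phi> (t - of_int k - of_int n))"
    unfolding shift
    by (rule infsum_reindex_bij_witness[where i = "\<lambda>n. n + k" and j = "\<lambda>n. n - k"]) (auto simp: algebra_simps)
  then show ?thesis unfolding J F'_def[abs_def, symmetric] by simp
qed

theorem proposition4p2:
  fixes \<theta> A B :: real and \<phi> :: "real \<Rightarrow> complex"
  assumes theta: "\<forall>k::int. \<theta> \<noteq> of_int k * pi"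
    and phi: "\<phi> \<in> L2 lebesgue"
    and AB: "0 < A" "A \<le> B"
    and G: "AE \<xi> in frft_cell \<theta>. ennreal A \<le> G_fun \<theta> \<phi> \<xi> \<and> G_fun \<theta> \<phi> \<xi> \<le> ennreal B"
    and C: "\<forall>t. C_fun \<theta> \<phi> t < \<infinity>"
  shows
    "(\<forall>F\<in>L2 (frft_cell \<theta>). \<forall>t.
        J_op \<theta> \<phi> F t =
        L2inner (frft_cell \<theta>) F (\<lambda>\<xi>. chirp \<theta> t * cnj (frft_const \<theta> * zak \<theta> \<phi> t \<xi>)))
     \<and> L2_isomorphism (frft_cell \<theta>) (L2 (frft_cell \<theta>)) lebesgue (V_space \<theta> \<phi>) (J_op \<theta> \<phi>)
     \<and> (\<forall>F\<in>L2 (frft_cell \<theta>). AE \<xi> in lebesgue.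
          frft \<theta> (J_op \<theta> \<phi> F) \<xi> = cnj (chirp \<theta> \<xi>) * chirp_ext \<theta> F \<xi> * frft \<theta> \<phi> \<xi>)
     \<and> (\<forall>F\<in>L2 (frft_cell \<theta>). \<forall>(k::int) t.
          chirp \<theta> t * J_op \<theta> \<phi> (\<lambda>\<xi>. F \<xi> * exp (- \<i> * of_real (frft_b \<theta> * of_int k * \<xi>))) t =
          chirp \<theta> (t - of_int k) * J_op \<theta> \<phi> F (t - of_int k))"
proof -
  have "sin \<theta> \<noteq> 0" using theta by (auto simp: sin_zero_iff_int2)
  then interpret frft_generator \<theta> A B \<phi>
    by unfold_locales (use phi AB G C in auto)
  show ?thesis
    using J_zak J_isomorphism frft_J J_op_modulation unfolding mult_op_def by blast
qed

end
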